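(* Let $\mathbf{E}_1,\mathbf{E}_2$ be elliptic curves together with complexified Kähler classes. Then the following are equivalent: 1) $\mathbf{E}_1$ and $\mathbf{E}_2$ form a mirror pair. 2) There is a self-dual manifold of the form $\mathbf{X}=\mathbf{X}_{\tau,t}$, for some $(\tau,t)\in\mathbb{H}\times\mathbb{H}$ ($\mathbb{H}\subset\mathbb{C}$ the upper half plane), such that $\mathbf{X}\to_1\mathbf{E}_1$ and $\mathbf{X}\to_2\mathbf{E}_2$.
   Context: For $(\tau,t)\in\mathbb{H}\times\mathbb{H}$, $\tau=\tau_1+i\tau_2$, $t=t_1+it_2$, $\mathbf{E}_{\tau,t}$ is the complex manifold $E_\tau=\mathbb{C}/(\mathbb{Z}\tau\oplus\mathbb{Z})$ with the complexified Kähler form $\omega^{\tau,t}=-\frac{t}{2\mathrm{Im}(\tau)}dz\wedge d\bar z$. Elliptic curves with complexified Kähler classes are considered up to isomorphism: biholomorphisms under which the complexified Kähler forms correspond in cohomology up to $\sqrt{-1}$ times an integral class. The mirror dual of $\mathbf{E}_{\tau,t}$ is $\mathbf{E}_{t,\tau}$; so $\mathbf{E}_1,\mathbf{E}_2$ form a mirror pair if $\mathbf{E}_1\cong\mathbf{E}_{\tau,t}$ and $\mathbf{E}_2\cong\mathbf{E}_{t,\tau}$ for some $(\tau,t)\in\mathbb{H}\times\mathbb{H}$. The almost $2$-Kähler manifold $\mathbf{X}_{\tau,t}=(X_{\tau,t},\omega_1^{\tau,t},\omega_2^{\tau,t},\mathbf{g}^{\tau,t})$: give $E_\tau$ the Kähler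 form $-i\frac{t_2}{2\tau_2}dz\wedge d\bar z$ and metric $\frac{t_2}{\tau_2}(dx^2+dy^2)$, and $E_t$ the Kähler form $-i\frac{\tau_2}{2t_2}dz\wedge d\bar z$ and metric $\frac{\tau_2}{t_2}(dx^2+dy^2)$. Let $B=\mathbb{R}/\sqrt{t_2\tau_2}\,\mathbb{Z}$, $f_1([z])=\sqrt{t_2/\tau_2}\,\mathrm{Im}\,z$ on $E_\tau$, $f_2([z])=\sqrt{\tau_2/t_2}\,\mathrm{Im}\,z$ on $E_t$, $X_{\tau,t}=E_\tau\times_BE_t$, and let $\omega_1^{\tau,t},\omega_2^{\tau,t}$ be the pull-backs of the Kähler forms $-i\frac{t_2}{2\tau_2}dz\wedge d\bar z$ from $E_\tau$ and $-i\frac{\tau_2}{2t_2}dz\wedge d\bar z$ from $E_t$ respectively. With $F:X_{\tau,t}\to B$ the natural map and $\mathbf{g}'$ the metric induced from the product metric on $E_\tau\times E_t$, $\mathbf{g}^{\tau,t}$ equals $\mathbf{g}'$ on $\mathrm{Ker}(dF)$, $\frac12\mathbf{g}'$ on its $\mathbf{g}'$-orthogonal complement, and keeps these subbundles orthogonal. An almost $2$-Kähler manifold $(X,\omega_1,\omega_2,\mathbf{g})$ is a $3n$-manifold with closed $2$-forms and a Riemannian metric such that $\omega_1^\perp+\omega_2^\perp$ is integrable ($\alpha^\perp=\{v:\iota_v\alpha=0\}$) and each tangent space has an orthonormal basis $v_i,w_i^1,w_i^2$ ($i=1,\dots,n$) with $\omega_j=\sum_iv_i^*\wedge(w_i^j)^*$;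 $\omega_D=\sum_i(w_i^1)^*\wedge(w_i^2)^*$. It is self-dual if $d\omega_D=0$ and all leaves of $\omega_1^\perp+\omega_2^\perp$ have Riemannian volume one. Notation: the almost $2$-Kähler isomorphism class of $\mathbf{X}_{\tau,t}$ determines $\mathbf{E}_{\tau,t}$ and $\mathbf{E}_{t,\tau}$ up to isomorphism. For $\mathbf{X}\cong\mathbf{X}_{\tau,t}$, $\mathbf{X}\to_1\mathbf{E}$ means that $\mathbf{E}$ is isomorphic to the first of these, $\mathbf{E}_{\tau,t}$, and $\mathbf{X}\to_2\mathbf{E}$ that $\mathbf{E}$ is isomorphic to the second, $\mathbf{E}_{t,\tau}$. *)

theory Defs
  imports "HOL-Complex_Analysis.Complex_Analysis" "HOL-Homology.Homology"
begin

section \<open>Smooth manifolds and tensor fields\<close>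

fun Ck_on :: "nat \<Rightarrow> 'e::real_normed_vector set \<Rightarrow> ('e \<Rightarrow> 'f::real_normed_vector) \<Rightarrow> bool" where
  "Ck_on 0 S f \<longleftrightarrow> continuous_on S f"
| "Ck_on (Suc k) S f \<longleftrightarrow>
     (\<forall>x\<in>S. f differentiable (at x)) \<and> (\<forall>v. Ck_on k S (\<lambda>x. frechet_derivative f (at x) v))"

text \<open>Only used for open sets \<open>S\<close>.\<close>

definition smooth_on :: "'e::real_normed_vector set \<Rightarrow> ('e \<Rightarrow> 'f::real_normed_vector) \<Rightarrow> bool" where
  "smooth_on S f \<longleftrightarrow> (\<forall>k. Ck_on k S f)"

text \<open>A chart is given by its inverse: a pair \<open>(V, \<psi>)\<close> where \<open>\<psi>\<close> parametrizes an open subset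
  of the manifold by the open subset \<open>V\<close> of the model space.\<close>

type_synonym ('a, 'e) chart = "'e set \<times> ('e \<Rightarrow> 'a)"

record ('a, 'e) manifold =
  mtop :: "'a topology"
  charts :: "('a, 'e) chart set"

definition cdom :: "('a, 'e) chart \<Rightarrow> 'e set" where
  "cdom c = fst c"

definition cimg :: "('a, 'e) chart \<Rightarrow> 'a set" where
  "cimg c = snd c ` fst c"

definition cinv :: "('a, 'e) chart \<Rightarrow> 'a \<Rightarrow> 'e" where
  "cinv c = the_inv_into (fst c) (snd c)"

definition smooth_manifold :: "('a, 'e::euclidean_space) manifold \<Rightarrow> bool" where
  "smooth_manifold M \<longleftrightarrow>
     Hausdorff_space (mtop M) \<and> second_countable (mtop M) \<and>
     (\<Union>c\<in>charts M. cimg c) = topspace (mtop M) \<and>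
     (\<forall>c\<in>charts M. open (cdom c) \<and> openin (mtop M) (cimg c) \<and>
        homeomorphic_map (top_of_set (cdom c)) (subtopology (mtop M) (cimg c)) (snd c)) \<and>
     (\<forall>c\<in>charts M. \<forall>d\<in>charts M.
        smooth_on {x \<in> cdom c. snd c x \<in> cimg d} (cinv d \<circ> snd c))"

text \<open>Smooth maps from an open subset of a Euclidean space into a manifold, and between manifolds.\<close>

definition smooth_into ::
  "('a, 'e::euclidean_space) manifold \<Rightarrow> 'd::euclidean_space set \<Rightarrow> ('d \<Rightarrow> 'a) \<Rightarrow> bool" where
  "smooth_into M U f \<longleftrightarrow>
     open U \<and> continuous_map (top_of_set U) (mtop M) f \<and>
     (\<forall>c\<in>charts M. smooth_on {x \<in> U. f x \<in> cimg c} (cinv c \<circ> f))"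

definition smooth_map ::
  "('a, 'd::euclidean_space) manifold \<Rightarrow> ('b, 'e::euclidean_space) manifold \<Rightarrow> ('a \<Rightarrow> 'b) \<Rightarrow> bool" where
  "smooth_map M N h \<longleftrightarrow>
     continuous_map (mtop M) (mtop N) h \<and>
     (\<forall>c\<in>charts M. smooth_into N (cdom c) (h \<circ> snd c))"

definition diffeo ::
  "('a, 'd::euclidean_space) manifold \<Rightarrow> ('b, 'e::euclidean_space) manifold \<Rightarrow> ('a \<Rightarrow> 'b) \<Rightarrow> bool" where
  "diffeo M N h \<longleftrightarrow>
     smooth_map M N h \<and> (\<exists>h'. homeomorphic_maps (mtop M) (mtop N) h h' \<and> smooth_map N M h')"

text \<open>Tensor fields are families of local expressions: \<open>\<omega> c x u v\<close> is the value, at the point with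
  coordinate \<open>x\<close> in the chart \<open>c\<close>, on the tangent vectors with components \<open>u\<close> and \<open>v\<close> in \<open>c\<close>.  Only
  the values for charts \<open>c\<close> of the manifold and \<open>x \<in> cdom c\<close> matter.\<close>

type_synonym ('a, 'e, 'c) tensor1 = "('a, 'e) chart \<Rightarrow> 'e \<Rightarrow> 'e \<Rightarrow> 'c"
type_synonym ('a, 'e, 'c) tensor2 = "('a, 'e) chart \<Rightarrow> 'e \<Rightarrow> 'e \<Rightarrow> 'e \<Rightarrow> 'c"

definition one_form ::
  "('a, 'e::euclidean_space) manifold \<Rightarrow> ('a, 'e, 'c::real_normed_vector) tensor1 \<Rightarrow> bool" where
  "one_form M \<alpha> \<longleftrightarrow>
     (\<forall>c\<in>charts M. \<forall>x\<in>cdom c. linear (\<alpha> c x)) \<and>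
     (\<forall>c\<in>charts M. \<forall>u. smooth_on (cdom c) (\<lambda>x. \<alpha> c x u)) \<and>
     (\<forall>c\<in>charts M. \<forall>d\<in>charts M. \<forall>x\<in>cdom c. \<forall>u. snd c x \<in> cimg d \<longrightarrow>
        (let f = cinv d \<circ> snd c in \<alpha> c x u = \<alpha> d (f x) (frechet_derivative f (at x) u)))"

definition tensor2_field ::
  "('a, 'e::euclidean_space) manifold \<Rightarrow> ('a, 'e, 'c::real_normed_vector) tensor2 \<Rightarrow> bool" where
  "tensor2_field M \<omega> \<longleftrightarrow>
     (\<forall>c\<in>charts M. \<forall>x\<in>cdom c. (\<forall>u. linear (\<lambda>v. \<omega> c x u v)) \<and> (\<forall>v. linear (\<lambda>u. \<omega> c x u v))) \<and>
     (\<forall>c\<in>charts M. \<forall>u v. smooth_on (cdom c) (\<lambda>x. \<omega> c x u v)) \<and>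
     (\<forall>c\<in>charts M. \<forall>d\<in>charts M. \<forall>x\<in>cdom c. \<forall>u v. snd c x \<in> cimg d \<longrightarrow>
        (let f = cinv d \<circ> snd c; Df = frechet_derivative f (at x)
         in \<omega> c x u v = \<omega> d (f x) (Df u) (Df v)))"

definition two_form ::
  "('a, 'e::euclidean_space) manifold \<Rightarrow> ('a, 'e, 'c::real_normed_vector) tensor2 \<Rightarrow> bool" where
  "two_form M \<omega> \<longleftrightarrow> tensor2_field M \<omega> \<and> (\<forall>c\<in>charts M. \<forall>x\<in>cdom c. \<forall>u. \<omega> c x u u = 0)"

definition riemannian_metric ::
  "('a, 'e::euclidean_space) manifold \<Rightarrow> ('a, 'e, real) tensor2 \<Rightarrow> bool" where
  "riemannian_metric M g \<longleftrightarrow> tensor2_field M g \<and>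
     (\<forall>c\<in>charts M. \<forall>x\<in>cdom c. (\<forall>u v. g c x u v = g c x v u) \<and> (\<forall>u. u \<noteq> 0 \<longrightarrow> g c x u u > 0))"

text \<open>Exterior derivatives, computed in a chart on constant vector fields.\<close>

definition ext_d1 ::
  "('a, 'e::euclidean_space, 'c::real_normed_vector) tensor1 \<Rightarrow> ('a, 'e, 'c) tensor2" where
  "ext_d1 \<alpha> c x u v =
     frechet_derivative (\<lambda>y. \<alpha> c y v) (at x) u - frechet_derivative (\<lambda>y. \<alpha> c y u) (at x) v"

definition ext_d2 ::
  "('a, 'e::euclidean_space, 'c::real_normed_vector) tensor2 \<Rightarrow>
   ('a, 'e) chart \<Rightarrow> 'e \<Rightarrow> 'e \<Rightarrow> 'e \<Rightarrow> 'e \<Rightarrow> 'c" where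
  "ext_d2 \<omega> c x u v w =
     frechet_derivative (\<lambda>y. \<omega> c y v w) (at x) u - frechet_derivative (\<lambda>y. \<omega> c y u w) (at x) v
     + frechet_derivative (\<lambda>y. \<omega> c y u v) (at x) w"

definition closed_two_form ::
  "('a, 'e::euclidean_space) manifold \<Rightarrow> ('a, 'e, 'c::real_normed_vector) tensor2 \<Rightarrow> bool" where
  "closed_two_form M \<omega> \<longleftrightarrow>
     two_form M \<omega> \<and> (\<forall>c\<in>charts M. \<forall>x\<in>cdom c. \<forall>u v w. ext_d2 \<omega> c x u v w = 0)"

text \<open>The chart around a point picked by \<open>chart_at\<close> is arbitrary; pulled-back tensors and the
  kernel of \<open>tderiv\<close> do not depend on the choice.\<close>

definition chart_at :: "('a, 'e) manifold \<Rightarrow> 'a \<Rightarrow> ('a, 'e) chart" where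
  "chart_at M p = (SOME c. c \<in> charts M \<and> p \<in> cimg c)"

definition tderiv ::
  "('a, 'e::euclidean_space) manifold \<Rightarrow> ('d::euclidean_space \<Rightarrow> 'a) \<Rightarrow> 'd \<Rightarrow> 'd \<Rightarrow> 'e" where
  "tderiv M f x u = frechet_derivative (cinv (chart_at M (f x)) \<circ> f) (at x) u"

definition pull2 ::
  "('a, 'e::euclidean_space) manifold \<Rightarrow> ('a, 'e, 'c) tensor2 \<Rightarrow> ('d::euclidean_space \<Rightarrow> 'a) \<Rightarrow>
   'd \<Rightarrow> 'd \<Rightarrow> 'd \<Rightarrow> 'c" where
  "pull2 M \<omega> f x u v =
     (let c = chart_at M (f x) in \<omega> c (cinv c (f x)) (tderiv M f x u) (tderiv M f x v))"

definition pullback ::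
  "('b, 'e::euclidean_space) manifold \<Rightarrow> ('a \<Rightarrow> 'b) \<Rightarrow> ('b, 'e, 'c) tensor2 \<Rightarrow>
   ('a, 'd::euclidean_space, 'c) tensor2" where
  "pullback N h \<omega> c x u v = pull2 N \<omega> (h \<circ> snd c) x u v"


section \<open>Riemannian volume\<close>

definition gram_det :: "('e::euclidean_space \<Rightarrow> 'e \<Rightarrow> real) \<Rightarrow> real" where
  "gram_det h = (\<Sum>p | p permutes (Basis :: 'e set). of_int (sign p) * (\<Prod>b\<in>Basis. h b (p b)))"

text \<open>The Riemannian measure is the Borel measure given by \<open>sqrt (det g) dx\<close> in every chart.\<close>

definition riemannian_measure ::
  "('a, 'e::euclidean_space) manifold \<Rightarrow> ('a, 'e, real) tensor2 \<Rightarrow> 'a measure \<Rightarrow> bool" where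
  "riemannian_measure M g \<mu> \<longleftrightarrow>
     space \<mu> = topspace (mtop M) \<and>
     sets \<mu> = sigma_sets (topspace (mtop M)) {U. openin (mtop M) U} \<and>
     (\<forall>c\<in>charts M. \<forall>A\<in>sets borel. A \<subseteq> cdom c \<longrightarrow>
        emeasure \<mu> (snd c ` A) = (\<integral>\<^sup>+x\<in>A. ennreal (sqrt (gram_det (g c x))) \<partial>lborel))"

definition riemannian_volume ::
  "('a, 'e::euclidean_space) manifold \<Rightarrow> ('a, 'e, real) tensor2 \<Rightarrow> ennreal" where
  "riemannian_volume M g =
     emeasure (SOME \<mu>. riemannian_measure M g \<mu>) (topspace (mtop M))"


section \<open>Distributions and their leaves\<close>

type_synonym ('a, 'e) distribution = "('a, 'e) chart \<Rightarrow> 'e \<Rightarrow> 'e set"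

text \<open>Parametrized, injectively immersed integral manifolds of a distribution \<open>D\<close>.\<close>

definition plaques ::
  "('a, 'e::euclidean_space) manifold \<Rightarrow> ('a, 'e) distribution \<Rightarrow> ('a, 'w::euclidean_space) chart set"
  where
  "plaques M D = {(W, k). smooth_into M W k \<and> inj_on k W \<and>
     (\<forall>x\<in>W. \<forall>c\<in>charts M. k x \<in> cimg c \<longrightarrow>
        (let Dk = frechet_derivative (cinv c \<circ> k) (at x)
         in inj Dk \<and> range Dk = D c (cinv c (k x))))}"

text \<open>In the following two definitions \<open>P\<close> is the set of plaques of an integrable distribution.  The
  leaf through \<open>p\<close>, i.e. the maximal connected integral manifold, is the set of points that can be
  reached from \<open>p\<close> by a finite chain of connected plaques; it carries the leaf topology, which may be
  finer than the subspace topology.\<close>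

definition leaf :: "('a, 'w::euclidean_space) chart set \<Rightarrow> 'a \<Rightarrow> 'a set" where
  "leaf P p =
     {q. (p, q) \<in> {(a, b). \<exists>k\<in>P. connected (cdom k) \<and> a \<in> cimg k \<and> b \<in> cimg k}\<^sup>*}"

definition leaf_manifold ::
  "('a, 'w::euclidean_space) chart set \<Rightarrow> 'a \<Rightarrow> ('a, 'w) manifold" where
  "leaf_manifold P p =
     \<lparr> mtop = topology_generated_by
         {snd k ` A |k A. k \<in> P \<and> cimg k \<subseteq> leaf P p \<and> open A \<and> A \<subseteq> cdom k},
       charts = {k \<in> P. cimg k \<subseteq> leaf P p} \<rparr>"

definition leaf_volume ::
  "('a, 'e::euclidean_space) manifold \<Rightarrow> ('a, 'e, real) tensor2 \<Rightarrow>
   ('a, 'w::euclidean_space) chart set \<Rightarrow> 'a \<Rightarrow> ennreal" where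
  "leaf_volume M g P p = riemannian_volume (leaf_manifold P p) (\<lambda>k. pull2 M g (snd k))"


section \<open>Almost 2-Kaehler and self-dual manifolds\<close>

text \<open>The dimension \<open>3n\<close> is encoded by the model space \<open>'v \<times> 'v \<times> 'v\<close> with \<open>n = DIM('v)\<close>; the leaves
  are modelled on \<open>'v \<times> 'v\<close>.\<close>

record ('a, 'v) two_kaehler =
  tk_mfd :: "('a, 'v \<times> 'v \<times> 'v) manifold"
  tk_om1 :: "('a, 'v \<times> 'v \<times> 'v, real) tensor2"
  tk_om2 :: "('a, 'v \<times> 'v \<times> 'v, real) tensor2"
  tk_met :: "('a, 'v \<times> 'v \<times> 'v, real) tensor2"

definition perp :: "('a, 'e::euclidean_space, real) tensor2 \<Rightarrow> ('a, 'e) distribution" where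
  "perp \<omega> c x = {v. \<forall>u. \<omega> c x v u = 0}"

definition leaf_dist ::
  "('a, 'v::euclidean_space) two_kaehler \<Rightarrow> ('a, 'v \<times> 'v \<times> 'v) distribution" where
  "leaf_dist X c x = {u + v |u v. u \<in> perp (tk_om1 X) c x \<and> v \<in> perp (tk_om2 X) c x}"

definition tk_plaques ::
  "('a, 'v::euclidean_space) two_kaehler \<Rightarrow> ('a, 'v \<times> 'v) chart set" where
  "tk_plaques X = plaques (tk_mfd X) (leaf_dist X)"

text \<open>For an orthonormal basis the dual basis vectors are \<open>v\<^sub>i\<^sup>* = h v\<^sub>i\<close>, so the following is
  \<open>\<Sum>i. a\<^sub>i\<^sup>* \<and> b\<^sub>i\<^sup>*\<close>.\<close>

definition wedge_sum ::
  "nat \<Rightarrow> ('e \<Rightarrow> 'e \<Rightarrow> real) \<Rightarrow> (nat \<Rightarrow> 'e) \<Rightarrow> (nat \<Rightarrow> 'e) \<Rightarrow> 'e \<Rightarrow> 'e \<Rightarrow> real" where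
  "wedge_sum n h a b u v = (\<Sum>i<n. h (a i) u * h (b i) v - h (a i) v * h (b i) u)"

text \<open>\<open>3n\<close> orthonormal vectors in a space of dimension \<open>3n\<close> form a basis.\<close>

definition adapted_basis ::
  "('a, 'v::euclidean_space) two_kaehler \<Rightarrow> ('a, 'v \<times> 'v \<times> 'v) chart \<Rightarrow> 'v \<times> 'v \<times> 'v \<Rightarrow>
   (nat \<Rightarrow> 'v \<times> 'v \<times> 'v) \<Rightarrow> (nat \<Rightarrow> 'v \<times> 'v \<times> 'v) \<Rightarrow> (nat \<Rightarrow> 'v \<times> 'v \<times> 'v) \<Rightarrow> bool" where
  "adapted_basis X c x v w1 w2 \<longleftrightarrow>
     (let n = DIM('v); h = tk_met X c x in
       (\<forall>i<n. \<forall>j<n.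
          h (v i) (v j) = (if i = j then 1 else 0) \<and>
          h (w1 i) (w1 j) = (if i = j then 1 else 0) \<and>
          h (w2 i) (w2 j) = (if i = j then 1 else 0) \<and>
          h (v i) (w1 j) = 0 \<and> h (v i) (w2 j) = 0 \<and> h (w1 i) (w2 j) = 0) \<and>
       tk_om1 X c x = wedge_sum n h v w1 \<and>
       tk_om2 X c x = wedge_sum n h v w2)"

text \<open>Integrability of \<open>leaf_dist\<close> is expressed by the existence of an integral manifold through every
  point.\<close>

definition almost_2kaehler :: "('a, 'v::euclidean_space) two_kaehler \<Rightarrow> bool" where
  "almost_2kaehler X \<longleftrightarrow>
     smooth_manifold (tk_mfd X) \<and>
     closed_two_form (tk_mfd X) (tk_om1 X) \<and> closed_two_form (tk_mfd X) (tk_om2 X) \<and>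
     riemannian_metric (tk_mfd X) (tk_met X) \<and>
     (\<forall>p\<in>topspace (mtop (tk_mfd X)). \<exists>k\<in>tk_plaques X. p \<in> cimg k) \<and>
     (\<forall>c\<in>charts (tk_mfd X). \<forall>x\<in>cdom c. \<exists>v w1 w2. adapted_basis X c x v w1 w2)"

text \<open>\<open>\<omega>\<^sub>D\<close> does not depend on the choice of the adapted bases.\<close>

definition omega_D :: "('a, 'v::euclidean_space) two_kaehler \<Rightarrow> ('a, 'v \<times> 'v \<times> 'v, real) tensor2" where
  "omega_D X c x =
     (let (v, w1, w2) = (SOME (v, w1, w2). adapted_basis X c x v w1 w2)
      in wedge_sum DIM('v) (tk_met X c x) w1 w2)"

definition self_dual :: "('a, 'v::euclidean_space) two_kaehler \<Rightarrow> bool" where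
  "self_dual X \<longleftrightarrow>
     almost_2kaehler X \<and> closed_two_form (tk_mfd X) (omega_D X) \<and>
     (\<forall>p\<in>topspace (mtop (tk_mfd X)). leaf_volume (tk_mfd X) (tk_met X) (tk_plaques X) p = 1)"

definition tk_iso ::
  "('a, 'v::euclidean_space) two_kaehler \<Rightarrow> ('b, 'v) two_kaehler \<Rightarrow> bool" where
  "tk_iso X Y \<longleftrightarrow> (\<exists>\<phi>. diffeo (tk_mfd X) (tk_mfd Y) \<phi> \<and>
     (\<forall>c\<in>charts (tk_mfd X). \<forall>x\<in>cdom c. \<forall>u v.
        pullback (tk_mfd Y) \<phi> (tk_om1 Y) c x u v = tk_om1 X c x u v \<and>
        pullback (tk_mfd Y) \<phi> (tk_om2 Y) c x u v = tk_om2 X c x u v \<and>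
        pullback (tk_mfd Y) \<phi> (tk_met Y) c x u v = tk_met X c x u v))"


section \<open>Quotients by lattices, complex curves\<close>

definition coset :: "'e::euclidean_space set \<Rightarrow> 'e \<Rightarrow> 'e set" where
  "coset L x = (+) x ` L"

text \<open>The quotient of a Euclidean space by a discrete subgroup \<open>L\<close>, with the quotient topology and the
  restrictions of the quotient map as parametrizations.\<close>

definition quot :: "'e::euclidean_space set \<Rightarrow> ('e set, 'e) manifold" where
  "quot L =
     \<lparr> mtop = topology (\<lambda>U. U \<subseteq> range (coset L) \<and> open {x. coset L x \<in> U}),
       charts = {(V, coset L) |V. open V \<and> inj_on (coset L) V} \<rparr>"

definition complex_curve :: "('a, complex) manifold \<Rightarrow> bool" where
  "complex_curve M \<longleftrightarrow> smooth_manifold M \<and>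
     (\<forall>c\<in>charts M. \<forall>d\<in>charts M.
        (cinv d \<circ> snd c) holomorphic_on {x \<in> cdom c. snd c x \<in> cimg d})"

definition holo_map :: "('a, complex) manifold \<Rightarrow> ('b, complex) manifold \<Rightarrow> ('a \<Rightarrow> 'b) \<Rightarrow> bool" where
  "holo_map M N h \<longleftrightarrow> smooth_map M N h \<and>
     (\<forall>c\<in>charts M. \<forall>d\<in>charts N.
        (cinv d \<circ> h \<circ> snd c) holomorphic_on {x \<in> cdom c. h (snd c x) \<in> cimg d})"

definition biholo :: "('a, complex) manifold \<Rightarrow> ('b, complex) manifold \<Rightarrow> ('a \<Rightarrow> 'b) \<Rightarrow> bool" where
  "biholo M N h \<longleftrightarrow>
     holo_map M N h \<and> (\<exists>h'. homeomorphic_maps (mtop M) (mtop N) h h' \<and> holo_map N M h')"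

definition lattice :: "complex \<Rightarrow> complex \<Rightarrow> complex set" where
  "lattice a b = {of_int m * a + of_int n * b |m n. True}"

definition elliptic_curve :: "('a, complex) manifold \<Rightarrow> bool" where
  "elliptic_curve M \<longleftrightarrow> complex_curve M \<and>
     (\<exists>a b. Im (cnj a * b) \<noteq> 0 \<and> (\<exists>h. biholo M (quot (lattice a b)) h))"


section \<open>Integral classes and complexified Kaehler classes\<close>

text \<open>A point \<open>(s, t)\<close> of the plane in barycentric coordinates \<open>(1 - s - t, s, t)\<close>.\<close>

definition bary :: "real \<times> real \<Rightarrow> nat \<Rightarrow> real" where
  "bary = (\<lambda>(s, t) i. if i = 0 then 1 - s - t else if i = 1 then s else if i = 2 then t else 0)"

definition smooth_simplex :: "('a, 'e::euclidean_space) manifold \<Rightarrow> ((nat \<Rightarrow> real) \<Rightarrow> 'a) \<Rightarrow> bool" where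
  "smooth_simplex M \<sigma> \<longleftrightarrow>
     singular_simplex 2 (mtop M) \<sigma> \<and>
     (\<exists>U h. smooth_into M U h \<and>
        (\<forall>y. bary y \<in> standard_simplex 2 \<longrightarrow> y \<in> U \<and> h y = \<sigma> (bary y)))"

text \<open>Integration takes place over the interior of the triangle, as \<open>\<sigma> \<circ> bary\<close> is meaningless outside
  the triangle.\<close>

definition period ::
  "('a, 'e::euclidean_space) manifold \<Rightarrow> ('a, 'e, real) tensor2 \<Rightarrow> 'a chain \<Rightarrow> real" where
  "period M \<eta> z = (\<Sum>\<sigma>\<in>Poly_Mapping.keys z. of_int (Poly_Mapping.lookup z \<sigma>) *
     integral {(s, t). 0 < s \<and> 0 < t \<and> s + t < 1}
       (\<lambda>y. pull2 M \<eta> (\<sigma> \<circ> bary) y (1, 0) (0, 1)))"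

text \<open>A closed real 2-form represents an integral class if its de Rham class lies in the image of
  \<open>H\<^sup>2(M; \<int>)\<close>, i.e. if all its periods over smooth singular cycles are integers.\<close>

definition integral_form ::
  "('a, 'e::euclidean_space) manifold \<Rightarrow> ('a, 'e, real) tensor2 \<Rightarrow> bool" where
  "integral_form M \<eta> \<longleftrightarrow> closed_two_form M \<eta> \<and>
     (\<forall>z. singular_relcycle 2 (mtop M) {} z \<and> (\<forall>\<sigma>\<in>Poly_Mapping.keys z. smooth_simplex M \<sigma>)
        \<longrightarrow> period M \<eta> z \<in> \<int>)"

text \<open>A complexified Kaehler class is given by a representing form.\<close>

record 'a ck_curve =
  ck_mfd :: "('a, complex) manifold"
  ck_form :: "('a, complex, complex) tensor2"

text \<open>The sign convention for Kaehler forms is \<open>\<omega>(u, v) = g(u, J v)\<close>, equivalently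
  \<open>g(u, v) = \<omega>(J u, v)\<close>, as is the case for the Kaehler form \<open>-i (t\<^sub>2 / 2\<tau>\<^sub>2) dz \<and> dz'\<close>
  (where \<open>z'\<close> is the conjugate of \<open>z\<close>) and the metric \<open>(t\<^sub>2 / \<tau>\<^sub>2) (dx\<^sup>2 + dy\<^sup>2)\<close>.
  On a complex curve every 2-form is of type (1,1).\<close>

definition complexified_kaehler_form ::
  "('a, complex) manifold \<Rightarrow> ('a, complex, complex) tensor2 \<Rightarrow> bool" where
  "complexified_kaehler_form M \<omega> \<longleftrightarrow> closed_two_form M \<omega> \<and>
     (\<forall>c\<in>charts M. \<forall>x\<in>cdom c. \<forall>u. u \<noteq> 0 \<longrightarrow> Re (\<omega> c x (\<i> * u) u) > 0)"

definition elliptic_ck :: "'a ck_curve \<Rightarrow> bool" where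
  "elliptic_ck E \<longleftrightarrow> elliptic_curve (ck_mfd E) \<and> complexified_kaehler_form (ck_mfd E) (ck_form E)"

definition ck_iso :: "'a ck_curve \<Rightarrow> 'b ck_curve \<Rightarrow> bool" where
  "ck_iso E F \<longleftrightarrow> (\<exists>\<phi> \<eta> \<alpha>.
     biholo (ck_mfd E) (ck_mfd F) \<phi> \<and> integral_form (ck_mfd E) \<eta> \<and> one_form (ck_mfd E) \<alpha> \<and>
     (\<forall>c\<in>charts (ck_mfd E). \<forall>x\<in>cdom c. \<forall>u v.
        pullback (ck_mfd F) \<phi> (ck_form F) c x u v =
          ck_form E c x u v + \<i> * of_real (\<eta> c x u v) + ext_d1 \<alpha> c x u v))"


section \<open>The curves E(\<tau>,t), the manifolds X(\<tau>,t) and mirror pairs\<close>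

definition upper_half_plane :: "complex set" where
  "upper_half_plane = {z. Im z > 0}"

definition dz_dzbar :: "complex \<Rightarrow> complex \<Rightarrow> complex" where
  "dz_dzbar u v = u * cnj v - v * cnj u"

definition E_mfd :: "complex \<Rightarrow> (complex set, complex) manifold" where
  "E_mfd \<tau> = quot (lattice \<tau> 1)"

definition E_ck :: "complex \<Rightarrow> complex \<Rightarrow> complex set ck_curve" where
  "E_ck \<tau> t = \<lparr> ck_mfd = E_mfd \<tau>,
     ck_form = (\<lambda>c x u v. - (t / (2 * of_real (Im \<tau>))) * dz_dzbar u v) \<rparr>"

definition mirror_pair :: "'a ck_curve \<Rightarrow> 'b ck_curve \<Rightarrow> bool" where
  "mirror_pair E1 E2 \<longleftrightarrow> (\<exists>\<tau>\<in>upper_half_plane. \<exists>t\<in>upper_half_plane.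
     ck_iso E1 (E_ck \<tau> t) \<and> ck_iso E2 (E_ck t \<tau>))"

text \<open>For \<open>E(\<tau>)\<close> with area parameter \<open>s\<close>: the form \<open>-i (s / 2\<tau>\<^sub>2) dz \<and> dz'\<close>, which is real-valued,
  and the metric \<open>(s / \<tau>\<^sub>2) (dx\<^sup>2 + dy\<^sup>2)\<close>.\<close>

definition E_kaehler :: "complex \<Rightarrow> real \<Rightarrow> (complex set, complex, real) tensor2" where
  "E_kaehler \<tau> s c x u v = Re (- \<i> * of_real (s / (2 * Im \<tau>)) * dz_dzbar u v)"

definition E_metric :: "complex \<Rightarrow> real \<Rightarrow> (complex set, complex, real) tensor2" where
  "E_metric \<tau> s c x u v = s / Im \<tau> * (u \<bullet> v)"

definition base_lattice :: "complex \<Rightarrow> complex \<Rightarrow> real set" where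
  "base_lattice \<tau> t = {of_int k * sqrt (Im t * Im \<tau>) |k. True}"

definition base_mfd :: "complex \<Rightarrow> complex \<Rightarrow> (real set, real) manifold" where
  "base_mfd \<tau> t = quot (base_lattice \<tau> t)"

text \<open>\<open>E_to_base \<tau> t\<close> is the map \<open>f\<^sub>1\<close> on \<open>E(\<tau>)\<close>, and \<open>E_to_base t \<tau>\<close> is the map \<open>f\<^sub>2\<close> on \<open>E(t)\<close>
  (note that \<open>base_lattice\<close> is symmetric).\<close>

definition E_to_base :: "complex \<Rightarrow> complex \<Rightarrow> complex set \<Rightarrow> real set" where
  "E_to_base \<tau> t p =
     the_elem ((\<lambda>z. coset (base_lattice \<tau> t) (sqrt (Im t / Im \<tau>) * Im z)) ` p)"

text \<open>The point \<open>([z], [w])\<close> with \<open>sqrt (t\<^sub>2 / \<tau>\<^sub>2) z = a + i y\<close> and \<open>sqrt (\<tau>\<^sub>2 / t\<^sub>2) w = b + i y\<close>.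
  These coordinates parametrize the fibre product by smooth embeddings into the product
  \<open>E(\<tau>) \<times> E(t)\<close>, so they define its structure of a submanifold.\<close>

definition X_param :: "complex \<Rightarrow> complex \<Rightarrow> real \<times> real \<times> real \<Rightarrow> complex set \<times> complex set" where
  "X_param \<tau> t = (\<lambda>(y, a, b).
     (coset (lattice \<tau> 1) (of_real (sqrt (Im \<tau> / Im t)) * Complex a y),
      coset (lattice t 1) (of_real (sqrt (Im t / Im \<tau>)) * Complex b y)))"

definition X_mfd :: "complex \<Rightarrow> complex \<Rightarrow> (complex set \<times> complex set, real \<times> real \<times> real) manifold" where
  "X_mfd \<tau> t =
     \<lparr> mtop = subtopology (prod_topology (mtop (E_mfd \<tau>)) (mtop (E_mfd t)))
         {(p, q). p \<in> topspace (mtop (E_mfd \<tau>)) \<and> q \<in> topspace (mtop (E_mfd t)) \<and>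
                  E_to_base \<tau> t p = E_to_base t \<tau> q},
       charts = {(V, X_param \<tau> t) |V. open V \<and> inj_on (X_param \<tau> t) V} \<rparr>"

text \<open>\<open>X_metric'\<close> is induced from the product metric on \<open>E(\<tau>) \<times> E(t)\<close>.\<close>

definition X_metric' ::
  "complex \<Rightarrow> complex \<Rightarrow> (complex set \<times> complex set, real \<times> real \<times> real, real) tensor2" where
  "X_metric' \<tau> t c x u v =
     pullback (E_mfd \<tau>) fst (E_metric \<tau> (Im t)) c x u v +
     pullback (E_mfd t) snd (E_metric t (Im \<tau>)) c x u v"

definition X_ker_dF ::
  "complex \<Rightarrow> complex \<Rightarrow> (complex set \<times> complex set, real \<times> real \<times> real) distribution" where
  "X_ker_dF \<tau> t c x = {u. tderiv (base_mfd \<tau> t) (E_to_base \<tau> t \<circ> fst \<circ> snd c) x u = 0}"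

definition orth_proj :: "('e::real_vector \<Rightarrow> 'e \<Rightarrow> real) \<Rightarrow> 'e set \<Rightarrow> 'e \<Rightarrow> 'e" where
  "orth_proj h K u = (THE k. k \<in> K \<and> (\<forall>w\<in>K. h (u - k) w = 0))"

definition X_metric ::
  "complex \<Rightarrow> complex \<Rightarrow> (complex set \<times> complex set, real \<times> real \<times> real, real) tensor2" where
  "X_metric \<tau> t c x u v =
     (let h = X_metric' \<tau> t c x; P = orth_proj h (X_ker_dF \<tau> t c x)
      in h (P u) (P v) + 1/2 * h (u - P u) (v - P v))"

definition X_tk :: "complex \<Rightarrow> complex \<Rightarrow> (complex set \<times> complex set, real) two_kaehler" where
  "X_tk \<tau> t =
     \<lparr> tk_mfd = X_mfd \<tau> t,
       tk_om1 = pullback (E_mfd \<tau>) fst (E_kaehler \<tau> (Im t)),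
       tk_om2 = pullback (E_mfd t) snd (E_kaehler t (Im \<tau>)),
       tk_met = X_metric \<tau> t \<rparr>"

text \<open>The relations between almost 2-Kaehler manifolds isomorphic to some \<open>X(\<tau>,t)\<close> and elliptic curves
  with complexified Kaehler classes; they only depend on isomorphism classes.\<close>

definition arrow1 :: "('a, real) two_kaehler \<Rightarrow> 'b ck_curve \<Rightarrow> bool" where
  "arrow1 X E \<longleftrightarrow> (\<exists>\<tau>\<in>upper_half_plane. \<exists>t\<in>upper_half_plane.
     tk_iso X (X_tk \<tau> t) \<and> ck_iso E (E_ck \<tau> t))"

definition arrow2 :: "('a, real) two_kaehler \<Rightarrow> 'b ck_curve \<Rightarrow> bool" where
  "arrow2 X E \<longleftrightarrow> (\<exists>\<tau>\<in>upper_half_plane. \<exists>t\<in>upper_half_plane.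
     tk_iso X (X_tk \<tau> t) \<and> ck_iso E (E_ck t \<tau>))"

end

theory Submission
  imports Defs
begin

text \<open>In the coordinates \<open>(y, a, b)\<close> the manifold \<open>X(\<tau>,t)\<close> is a quotient of \<open>\<real>\<^sup>3\<close> by a lattice, with
  \<open>\<omega>\<^sub>1 = dy \<and> da\<close>, \<open>\<omega>\<^sub>2 = dy \<and> db\<close>, \<open>\<omega>\<^sub>D = da \<and> db\<close> and the Euclidean metric.  Its leaves \<open>y = const\<close> are
  rectangular tori with side lengths \<open>sqrt (t\<^sub>2 / \<tau>\<^sub>2)\<close> and \<open>sqrt (\<tau>\<^sub>2 / t\<^sub>2)\<close>, so every \<open>X(\<tau>,t)\<close> is self-dual.
  A linear map preserving both forms and the metric is \<open>\<plusminus>1\<close>; hence an isomorphism lifts to \<open>x \<mapsto> \<plusminus>x + c\<close>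
  and identifies the lattices.  The lattice determines \<open>Im \<tau>\<close>, \<open>Im t\<close> and the classes of \<open>Re \<tau>\<close>, \<open>Re t\<close>
  modulo \<open>\<int>\<close>.  If \<open>X(\<tau>',t')\<close> and \<open>X(\<tau>'',t'')\<close> are isomorphic, then \<open>E(\<tau>',t') = E(\<tau>'',t')\<close> and
  \<open>E(t'',\<tau>'') = E(t',\<tau>'')\<close>, so the pair \<open>(\<tau>'',t')\<close> exhibits the two targets as mirror duals.\<close>

section \<open>Smooth functions\<close>

text \<open>Three obstacles shape the proof. Charts, adapted bases and measures enter through
  \<open>SOME\<close>, so no result may depend on a choice: near a point two lifts of a map into the
  quotient differ by a lattice vector, which derivatives do not see; two adapted bases differ by a
  common sign; and the volume of a leaf is computed for every Riemannian measure on it. Next,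
  \<open>arrow1\<close> and \<open>arrow2\<close> each bring their own pair of parameters, related
  only through an isomorphism of the three-dimensional manifolds, so the parameters have to be
  recovered from the isomorphism class as far as possible. Finally, the atlas of a leaf consists of
  all plaques inside it, not only of pieces of coordinate planes. The existence of a Riemannian
  measure on a leaf therefore requires the change of variables formula in arbitrary curvilinear
  coordinates, which accounts for the measure theory.\<close>

lemma Ck_on_locally_const:
  assumes "open S" "\<And>x. x \<in> S \<Longrightarrow> f x = c"
  shows "Ck_on k S f"
  using assms(2)
proof (induction k arbitrary: f c)
  case 0
  then show ?case by (simp cong: continuous_on_cong)
next
  case (Suc k)
  have "(f has_derivative (\<lambda>v. 0)) (at x)" if "x \<in> S" for x
    by (rule has_derivative_transform_within_open[OF has_derivative_const assms(1) that])
      (simp add: Suc.prems)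
  then have "f differentiable (at x) \<and> frechet_derivative f (at x) = (\<lambda>v. 0)" if "x \<in> S" for x
    using that frechet_derivative_at unfolding differentiable_def by metis
  then show ?case
    using Suc.IH by simp
qed

text \<open>The derivative is the same linear map \<open>f'\<close> at every point, so all higher
  derivatives vanish. Chart changes of a quotient by translations are of this kind.\<close>

lemma smooth_on_locally_affine:
  assumes "open S" "\<And>x. x \<in> S \<Longrightarrow> (f has_derivative f') (at x)"
  shows "smooth_on S f"
  unfolding smooth_on_def
proof
  fix k
  have "continuous_on S f"
    using assms(2) by (meson continuous_at_imp_continuous_on has_derivative_continuous)
  moreover have "Ck_on j S (\<lambda>x. frechet_derivative f (at x) v)" for j v
    by (rule Ck_on_locally_const[OF assms(1), where c = "f' v"])
      (simp add: frechet_derivative_at[OF assms(2), symmetric])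
  moreover have "f differentiable (at x)" if "x \<in> S" for x
    using assms(2)[OF that] by (auto simp: differentiable_def)
  ultimately show "Ck_on k S f"
    by (cases k) auto
qed

lemma smooth_on_differentiable: "smooth_on S f \<Longrightarrow> x \<in> S \<Longrightarrow> f differentiable (at x)"
  unfolding smooth_on_def by (metis Ck_on.simps(2))

lemma smooth_on_has_derivative:
  "smooth_on S f \<Longrightarrow> x \<in> S \<Longrightarrow> (f has_derivative frechet_derivative f (at x)) (at x)"
  using smooth_on_differentiable frechet_derivative_works by blast

lemma smooth_on_continuous_derivative:
  "smooth_on S f \<Longrightarrow> continuous_on S (\<lambda>x. frechet_derivative f (at x) v)"
  unfolding smooth_on_def by (metis Ck_on.simps)

section \<open>Quotients by discrete subgroups\<close>

text \<open>Chart changes of a quotient by translations have the identity as derivative, so one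
  bilinear form can serve in all charts. Every tensor field on the curves and on the fibre product
  is brought into this form, after which only linear algebra remains.\<close>

definition const_tensor2 ::
  "('a, 'e::euclidean_space) manifold \<Rightarrow> ('a, 'e, 'c) tensor2 \<Rightarrow> ('e \<Rightarrow> 'e \<Rightarrow> 'c) \<Rightarrow> bool" where
  "const_tensor2 M \<omega> B \<longleftrightarrow> (\<forall>c\<in>charts M. \<forall>x\<in>cdom c. \<forall>u v. \<omega> c x u v = B u v)"

lemma const_tensor2D:
  "const_tensor2 M \<omega> B \<Longrightarrow> c \<in> charts M \<Longrightarrow> x \<in> cdom c \<Longrightarrow> \<omega> c x = B"
  by (intro ext) (simp add: const_tensor2_def)

text \<open>The projection and the topology are abstract because two kinds of spaces must fit:
  \<open>quot L\<close>, whose points are cosets, and the fibre product, whose points are pairs of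
  cosets in a subspace topology. That \<open>L\<close> is a subgroup follows from
  \<open>eq_iff\<close>, since equality of images is an equivalence relation; \<open>r\<close> makes
  it discrete.\<close>

locale discrete_quotient =
  fixes M :: "('a, 'e::euclidean_space) manifold" and \<pi> :: "'e \<Rightarrow> 'a" and L :: "'e set" and r :: real
  assumes openin_iff: "openin (mtop M) U \<longleftrightarrow> U \<subseteq> range \<pi> \<and> open (\<pi> -` U)"
    and charts_eq: "charts M = {(V, \<pi>) |V. open V \<and> inj_on \<pi> V}"
    and eq_iff: "\<pi> x = \<pi> y \<longleftrightarrow> x - y \<in> L"
    and r_pos: "0 < r"
    and r_le: "l \<in> L \<Longrightarrow> l \<noteq> 0 \<Longrightarrow> r \<le> norm l"
begin

lemma zero_mem: "0 \<in> L"
  using eq_iff[of 0 0] by simp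

lemma uminus_mem: "l \<in> L \<Longrightarrow> - l \<in> L"
  using eq_iff[of l 0] eq_iff[of 0 l] by simp

lemma translate: "l \<in> L \<Longrightarrow> \<pi> (x + l) = \<pi> x"
  using eq_iff by simp

lemma add_mem: "l \<in> L \<Longrightarrow> m \<in> L \<Longrightarrow> l + m \<in> L"
  using translate[of l m] translate[of m 0] eq_iff[of "m + l" 0] by (simp add: add.commute)

lemma diff_mem: "l \<in> L \<Longrightarrow> m \<in> L \<Longrightarrow> l - m \<in> L"
  using add_mem[of l "- m"] uminus_mem by simp

lemma eq_if_close: "\<pi> x = \<pi> y \<Longrightarrow> dist x y < r \<Longrightarrow> x = y"
  using eq_iff r_le[of "x - y"] by (force simp: dist_norm)

lemma topspace_eq: "topspace (mtop M) = range \<pi>"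
proof
  show "topspace (mtop M) \<subseteq> range \<pi>"
    using openin_iff[of "topspace (mtop M)"] by simp
  have "\<pi> -` range \<pi> = UNIV"
    by auto
  then have "openin (mtop M) (range \<pi>)"
    by (simp add: openin_iff)
  then show "range \<pi> \<subseteq> topspace (mtop M)"
    by (rule openin_subset)
qed

lemma vimage_image: "\<pi> -` (\<pi> ` V) = (\<Union>l\<in>L. (+) l ` V)"
proof -
  have "x \<in> (+) (x - y) ` V" if "y \<in> V" for x y
    using that by (intro image_eqI[of _ _ y]) auto
  then show ?thesis
    by (force simp: eq_iff translate add.commute)
qed

lemma open_image: "open V \<Longrightarrow> openin (mtop M) (\<pi> ` V)"
  by (auto simp: openin_iff vimage_image intro: open_translation)

lemma continuous_proj: "continuous_map (top_of_set U) (mtop M) \<pi>"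
proof -
  have "openin (top_of_set U) {x \<in> U. \<pi> x \<in> W}" if "openin (mtop M) W" for W
  proof -
    have "{x \<in> U. \<pi> x \<in> W} = U \<inter> \<pi> -` W"
      by auto
    then show ?thesis
      using that by (auto simp: openin_iff openin_open)
  qed
  then show ?thesis
    by (auto simp: continuous_map topspace_eq)
qed

lemma inj_on_ball: "inj_on \<pi> (ball x (r / 2))"
proof (rule inj_onI)
  fix y z assume "y \<in> ball x (r / 2)" "z \<in> ball x (r / 2)" "\<pi> y = \<pi> z"
  then show "y = z"
    using eq_if_close dist_triangle_half_l[of y x r z] by (simp add: dist_commute)
qed

lemma chart_ball: "(ball x (r / 2), \<pi>) \<in> charts M"
  using charts_eq inj_on_ball by auto

lemma chartD:
  assumes "c \<in> charts M"
  shows "snd c = \<pi>" "open (cdom c)" "inj_on \<pi> (cdom c)" "cimg c = \<pi> ` cdom c"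
  using assms by (auto simp: charts_eq cdom_def cimg_def)

lemma cinv_chart: "c \<in> charts M \<Longrightarrow> x \<in> cdom c \<Longrightarrow> cinv c (\<pi> x) = x"
  by (auto simp: charts_eq cdom_def cinv_def the_inv_into_f_f)

lemma cinv_mem:
  assumes "c \<in> charts M" "p \<in> cimg c"
  shows "cinv c p \<in> cdom c" "\<pi> (cinv c p) = p"
proof -
  obtain x where "x \<in> cdom c" "p = \<pi> x"
    using assms by (auto simp: chartD)
  then show "cinv c p \<in> cdom c" "\<pi> (cinv c p) = p"
    using cinv_chart[OF assms(1)] by simp_all
qed

lemma chart_at:
  assumes "p \<in> range \<pi>"
  shows "chart_at M p \<in> charts M \<and> p \<in> cimg (chart_at M p)"
proof -
  obtain x where "p = \<pi> x"
    using assms by auto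
  then have "p \<in> cimg (ball x (r / 2), \<pi>)"
    using r_pos by (auto simp: cimg_def)
  then show ?thesis
    unfolding chart_at_def using chart_ball by (metis (mono_tags, lifting) someI_ex)
qed

lemma cimg_open: "c \<in> charts M \<Longrightarrow> openin (mtop M) (cimg c)"
  by (simp add: chartD open_image)

text \<open>In a chart, a map that lifts to \<open>F\<close> is a translate of \<open>F\<close>; this is why all derivatives can be
  read off from lifts.\<close>

lemma local_lift:
  assumes "c \<in> charts M" "isCont F x" "f x \<in> cimg c" "\<forall>\<^sub>F y in nhds x. f y = \<pi> (F y)"
  obtains l where "l \<in> L" "\<forall>\<^sub>F y in nhds x. f y \<in> cimg c \<and> cinv c (f y) = F y + l"
proof -
  \<comment> \<open>At \<open>x\<close> the local inverse of the chart and the lift \<open>F\<close>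
    differ by the lattice vector \<open>l\<close>. By continuity \<open>F + l\<close> stays in the
    chart domain near \<open>x\<close>, where injectivity of the projection identifies it with the
    chart expression of \<open>f\<close>.\<close>
  define l where "l = cinv c (f x) - F x"
  have fx: "f x = \<pi> (F x)"
    using assms(4) eventually_nhds_x_imp_x by blast
  have l: "l \<in> L"
    using cinv_mem[OF assms(1,3)] fx by (simp add: l_def eq_iff[symmetric])
  have "isCont (\<lambda>y. F y + l) x"
    using assms(2) by (intro continuous_intros)
  then have "((\<lambda>y. F y + l) \<longlongrightarrow> F x + l) (nhds x)"
    using continuous_at filterlim_at_within_not_equal tendsto_at_iff_tendsto_nhds isCont_def by blast
  moreover have "F x + l \<in> cdom c"
    using cinv_mem[OF assms(1,3)] by (simp add: l_def)
  ultimately have "\<forall>\<^sub>F y in nhds x. F y + l \<in> cdom c"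
    using topological_tendstoD chartD(2)[OF assms(1)] by blast
  with assms(4) have "\<forall>\<^sub>F y in nhds x. f y \<in> cimg c \<and> cinv c (f y) = F y + l"
  proof eventually_elim
    case (elim y)
    then have "f y = \<pi> (F y + l)"
      using translate[OF l] by simp
    then show ?case
      using elim assms(1) by (simp add: cinv_chart chartD)
  qed
  then show ?thesis
    by (rule that[OF l])
qed

section \<open>Derivatives and pullbacks computed from lifts\<close>

lemma has_derivative_chart:
  assumes "c \<in> charts M" "(F has_derivative F') (at x)" "f x \<in> cimg c"
    "\<forall>\<^sub>F y in nhds x. f y = \<pi> (F y)"
  shows "(cinv c \<circ> f has_derivative F') (at x)"
proof -
  obtain l where "\<forall>\<^sub>F y in nhds x. f y \<in> cimg c \<and> cinv c (f y) = F y + l"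
    by (rule local_lift[OF assms(1) has_derivative_continuous[OF assms(2)] assms(3,4)])
  then obtain S where S: "open S" "x \<in> S" "\<And>y. y \<in> S \<Longrightarrow> cinv c (f y) = F y + l"
    by (auto simp: eventually_nhds)
  have "((\<lambda>y. F y + l) has_derivative F') (at x)"
    using has_derivative_add_const[OF assms(2)] by simp
  then show ?thesis
    by (rule has_derivative_transform_within_open[OF _ S(1,2)]) (simp add: S(3))
qed

text \<open>The chart picked by \<open>chart_at\<close> is arbitrary, but its inverse agrees with
  the lift up to a constant lattice vector, which differentiation removes.\<close>

lemma tderiv_lift:
  assumes "(F has_derivative F') (at x)" "\<forall>\<^sub>F y in nhds x. f y = \<pi> (F y)"
  shows "tderiv M f x u = F' u"
proof -
  have "f x \<in> range \<pi>"
    using eventually_nhds_x_imp_x[OF assms(2)] by simp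
  then have "(cinv (chart_at M (f x)) \<circ> f has_derivative F') (at x)"
    using has_derivative_chart[OF _ assms(1) _ assms(2)] chart_at by simp
  from frechet_derivative_at[OF this] show ?thesis
    unfolding tderiv_def by simp
qed

text \<open>Both choices hidden in \<open>pull2\<close> disappear: the coefficients are the same in
  every chart, and the tangent map is that of the lift. All pullbacks below are evaluated with this
  rule.\<close>

lemma pull2_lift:
  assumes "(F has_derivative F') (at x)" "\<forall>\<^sub>F y in nhds x. f y = \<pi> (F y)" "const_tensor2 M \<omega> B"
  shows "pull2 M \<omega> f x u v = B (F' u) (F' v)"
proof -
  have "f x \<in> range \<pi>"
    using eventually_nhds_x_imp_x[OF assms(2)] by simp
  then show ?thesis
    using chart_at cinv_mem assms(3)
    by (simp add: pull2_def Let_def tderiv_lift[OF assms(1,2)] const_tensor2D)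
qed

lemma smooth_into_lift:
  assumes "open U" and F: "\<And>x. x \<in> U \<Longrightarrow> (F has_derivative F') (at x)"
  shows "smooth_into M U (\<pi> \<circ> F)"
  unfolding smooth_into_def
proof (intro conjI ballI)
  have contF: "continuous_on U F"
    using F by (meson continuous_at_imp_continuous_on has_derivative_continuous)
  then have "continuous_map (top_of_set U) (top_of_set UNIV) F"
    by simp
  then show cont: "continuous_map (top_of_set U) (mtop M) (\<pi> \<circ> F)"
    using continuous_map_compose continuous_proj by blast
  fix c assume c: "c \<in> charts M"
  have "open {x \<in> U. (\<pi> \<circ> F) x \<in> cimg c}"
    using openin_continuous_map_preimage[OF cont cimg_open[OF c]] assms(1)
    by (simp add: openin_open_eq)
  moreover have "(cinv c \<circ> (\<pi> \<circ> F) has_derivative F') (at x)"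
    if "x \<in> U" "(\<pi> \<circ> F) x \<in> cimg c" for x
    using that by (intro has_derivative_chart[OF c F]) auto
  ultimately show "smooth_on {x \<in> U. (\<pi> \<circ> F) x \<in> cimg c} (cinv c \<circ> (\<pi> \<circ> F))"
    by (intro smooth_on_locally_affine) auto
qed (rule assms(1))

lemma smooth_into_proj: "open U \<Longrightarrow> smooth_into M U \<pi>"
  using smooth_into_lift[of U id "\<lambda>h. h"] by (simp add: id_def comp_def)

section \<open>The manifold axioms for the quotient\<close>

lemma hausdorff: "Hausdorff_space (mtop M)"
  unfolding Hausdorff_space_def
proof (intro allI impI, elim conjE)
  fix p q assume "p \<in> topspace (mtop M)" "q \<in> topspace (mtop M)" "p \<noteq> q"
  then obtain x y where xy: "p = \<pi> x" "q = \<pi> y" "x - y \<notin> L"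
    using eq_iff by (auto simp: topspace_eq)
  \<comment> \<open>Lattice points are at least \<open>r\<close> apart, so \<open>L\<close> is
    closed and \<open>x - y\<close> has a positive distance \<open>d\<close> from it. If the images
    of the balls of radius \<open>d / 2\<close> met, two representatives would differ by a lattice
    vector nearer than \<open>d\<close> to \<open>x - y\<close>.\<close>
  have "closed L"
  proof (rule discrete_imp_closed[OF r_pos], intro ballI impI)
    fix l m assume "l \<in> L" "m \<in> L" "dist m l < r"
    then show "m = l"
      using r_le[OF diff_mem[of m l]] by (cases "m = l") (simp_all add: dist_norm)
  qed
  from separate_point_closed[OF this xy(3)]
  obtain d where d: "0 < d" "\<And>l. l \<in> L \<Longrightarrow> d \<le> dist (x - y) l"
    by blast
  have "disjnt (\<pi> ` ball x (d / 2)) (\<pi> ` ball y (d / 2))"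
  proof (rule ccontr)
    assume "\<not> ?thesis"
    then obtain x' y' where *: "dist x x' < d / 2" "dist y y' < d / 2" "\<pi> x' = \<pi> y'"
      by (auto simp: disjnt_def)
    have "dist (x - y) (x' - y') = norm ((x - x') - (y - y'))"
      by (simp add: dist_norm algebra_simps)
    also have "\<dots> \<le> dist x x' + dist y y'"
      using norm_triangle_ineq4 by (auto simp: dist_norm)
    finally show False
      using d(2)[of "x' - y'"] * by (simp add: eq_iff)
  qed
  then show "\<exists>U V. openin (mtop M) U \<and> openin (mtop M) V \<and> p \<in> U \<and> q \<in> V \<and> disjnt U V"
    using d(1) xy(1,2) open_image
    by (intro exI[of _ "\<pi> ` ball x (d / 2)"] exI[of _ "\<pi> ` ball y (d / 2)"]) auto
qed

lemma second_countable_mtop: "second_countable (mtop M)"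
proof -
  obtain \<B> :: "'e set set" where \<B>: "countable \<B>" "\<And>C. C \<in> \<B> \<Longrightarrow> open C"
    "\<And>S. open S \<Longrightarrow> \<exists>U. U \<subseteq> \<B> \<and> S = \<Union>U"
    using univ_second_countable by blast
  show ?thesis
    unfolding second_countable_def
  proof (intro exI conjI ballI allI impI)
    show "countable ((`) \<pi> ` \<B>)"
      using \<B>(1) by simp
    fix V assume "V \<in> (`) \<pi> ` \<B>"
    then show "openin (mtop M) V"
      using \<B>(2) open_image by auto
  next
    fix U p assume "openin (mtop M) U \<and> p \<in> U"
    then obtain x where x: "p = \<pi> x" "open (\<pi> -` U)" "x \<in> \<pi> -` U"
      by (auto simp: openin_iff)
    then obtain C where "C \<in> \<B>" "x \<in> C" "C \<subseteq> \<pi> -` U"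
      using \<B>(3)[of "\<pi> -` U"] by blast
    then show "\<exists>V\<in>(`) \<pi> ` \<B>. p \<in> V \<and> V \<subseteq> U"
      using x by blast
  qed
qed

lemma homeomorphic_chart:
  assumes "c \<in> charts M"
  shows "homeomorphic_map (top_of_set (cdom c)) (subtopology (mtop M) (cimg c)) \<pi>"
proof (rule bijective_open_imp_homeomorphic_map)
  show "continuous_map (top_of_set (cdom c)) (subtopology (mtop M) (cimg c)) \<pi>"
    using continuous_proj chartD(4)[OF assms] by (auto simp: continuous_map_in_subtopology)
  show "open_map (top_of_set (cdom c)) (subtopology (mtop M) (cimg c)) \<pi>"
    unfolding open_map_def
  proof (intro allI impI)
    fix U assume "openin (top_of_set (cdom c)) U"
    then have "open U" "U \<subseteq> cdom c"
      using chartD(2)[OF assms] by (auto simp: openin_open_eq)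
    then show "openin (subtopology (mtop M) (cimg c)) (\<pi> ` U)"
      unfolding openin_subtopology using open_image chartD(4)[OF assms] by blast
  qed
  show "\<pi> ` topspace (top_of_set (cdom c)) = topspace (subtopology (mtop M) (cimg c))"
    using chartD(4)[OF assms] by (auto simp: topspace_eq)
  show "inj_on \<pi> (topspace (top_of_set (cdom c)))"
    using chartD(3)[OF assms] by simp
qed

lemma smooth_manifold: "smooth_manifold M"
  unfolding smooth_manifold_def
proof (intro conjI ballI)
  have "\<pi> x \<in> (\<Union>c\<in>charts M. cimg c)" for x
    using chart_at[of "\<pi> x"] by blast
  then show "(\<Union>c\<in>charts M. cimg c) = topspace (mtop M)"
    by (auto simp: topspace_eq chartD)
  fix c assume c: "c \<in> charts M"
  show "open (cdom c)" "openin (mtop M) (cimg c)"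
    using c chartD(2) cimg_open by blast+
  show "homeomorphic_map (top_of_set (cdom c)) (subtopology (mtop M) (cimg c)) (snd c)"
    using homeomorphic_chart[OF c] chartD(1)[OF c] by simp
  fix d assume "d \<in> charts M"
  then show "smooth_on {x \<in> cdom c. snd c x \<in> cimg d} (cinv d \<circ> snd c)"
    using smooth_into_proj[OF chartD(2)[OF c]] chartD(1)[OF c] unfolding smooth_into_def by simp
qed (rule hausdorff second_countable_mtop)+

lemma smooth_map_id: "smooth_map M M id"
  unfolding smooth_map_def id_comp
proof (intro conjI ballI)
  show "continuous_map (mtop M) (mtop M) id"
    by (rule continuous_map_id)
  fix c assume c: "c \<in> charts M"
  show "smooth_into M (cdom c) (snd c)"
    unfolding chartD(1)[OF c] by (rule smooth_into_proj[OF chartD(2)[OF c]])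
qed

lemma diffeo_id: "diffeo M M id"
proof -
  have "homeomorphic_maps (mtop M) (mtop M) id id"
    by (simp add: homeomorphic_maps_id)
  then show ?thesis
    unfolding diffeo_def using smooth_map_id by (intro conjI exI[of _ id])
qed

lemma pullback_id:
  assumes "const_tensor2 M \<omega> B" "c \<in> charts M" "x \<in> cdom c"
  shows "pullback M id \<omega> c x u v = \<omega> c x u v"
proof -
  have "\<forall>\<^sub>F y in nhds x. (id \<circ> snd c) y = \<pi> y"
    by (simp add: chartD(1)[OF assms(2)])
  then have "pullback M id \<omega> c x u v = B u v"
    unfolding pullback_def using pull2_lift[OF has_derivative_ident _ assms(1)] by blast
  then show ?thesis
    using assms by (simp add: const_tensor2D)
qed

section \<open>Tensor fields with constant coefficients\<close>

lemma tensor2_field_const: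
  fixes B :: "'e \<Rightarrow> 'e \<Rightarrow> 'c::real_normed_vector"
  assumes "const_tensor2 M \<omega> B" "\<And>u. linear (B u)" "\<And>v. linear (\<lambda>u. B u v)"
  shows "tensor2_field M \<omega>"
  unfolding tensor2_field_def
proof (intro conjI ballI allI impI)
  fix c u v assume c: "c \<in> charts M"
  show "linear (\<omega> c x u)" "linear (\<lambda>u. \<omega> c x u v)" if "x \<in> cdom c" for x
    using assms(2,3) const_tensor2D[OF assms(1) c that] by simp_all
  show "smooth_on (cdom c) (\<lambda>x. \<omega> c x u v)"
    unfolding smooth_on_def
    using Ck_on_locally_const[OF chartD(2)[OF c], of "\<lambda>x. \<omega> c x u v" "B u v"]
    by (simp add: const_tensor2D[OF assms(1) c])
  fix d x assume x: "x \<in> cdom c" and d: "d \<in> charts M" "snd c x \<in> cimg d"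
  \<comment> \<open>The projection of \<open>c\<close> lifts to the identity, so the chart change
    from \<open>c\<close> to \<open>d\<close> has the identity as derivative.\<close>
  have "(cinv d \<circ> snd c has_derivative (\<lambda>h. h)) (at x)"
    by (rule has_derivative_chart[where F = "\<lambda>y. y"])
      (simp_all add: d chartD(1)[OF c, symmetric])
  then have "frechet_derivative (cinv d \<circ> snd c) (at x) = (\<lambda>h. h)"
    by (rule frechet_derivative_at[symmetric])
  moreover have "(cinv d \<circ> snd c) x \<in> cdom d"
    using cinv_mem(1)[OF d] by simp
  ultimately show "let f = cinv d \<circ> snd c; Df = frechet_derivative f (at x)
      in \<omega> c x u v = \<omega> d (f x) (Df u) (Df v)"
    unfolding Let_def by (simp only: const_tensor2D[OF assms(1) c x] const_tensor2D[OF assms(1) d(1)])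
qed

lemma closed_two_form_const:
  fixes B :: "'e \<Rightarrow> 'e \<Rightarrow> 'c::real_normed_vector"
  assumes "const_tensor2 M \<omega> B" "\<And>u. linear (B u)" "\<And>v. linear (\<lambda>u. B u v)" "\<And>u. B u u = 0"
  shows "closed_two_form M \<omega>"
  unfolding closed_two_form_def two_form_def
proof (intro conjI ballI allI)
  show "tensor2_field M \<omega>"
    by (rule tensor2_field_const[OF assms(1-3)])
  show "\<omega> c x u u = 0" if "c \<in> charts M" "x \<in> cdom c" for c x u
    using that assms by (simp add: const_tensor2D)
  fix c x u v w assume c: "c \<in> charts M" and x: "x \<in> cdom c"
  have "((\<lambda>y. \<omega> c y u v) has_derivative (\<lambda>h. 0)) (at x)" for u v
    by (rule has_derivative_transform_within_open[OF has_derivative_const chartD(2)[OF c] x])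
      (simp add: const_tensor2D[OF assms(1) c])
  then have "frechet_derivative (\<lambda>y. \<omega> c y u v) (at x) = (\<lambda>h. 0)" for u v
    by (intro frechet_derivative_at[symmetric])
  then show "ext_d2 \<omega> c x u v w = 0"
    by (simp add: ext_d2_def)
qed

end

section \<open>Measure theory in the plane\<close>

text \<open>\<open>has_measure_differentiable_image\<close> is an equivalence for each finite value
  \<open>m\<close>. Two elements of \<open>ennreal\<close> that equal the same finite values are
  equal, so the case of infinite area is covered as well.\<close>

lemma emeasure_differentiable_image:
  fixes f :: "real^'n::{finite,wellorder} \<Rightarrow> real^'n::_"
  assumes S: "S \<in> sets borel" "f ` S \<in> sets borel"
    and der: "\<And>x. x \<in> S \<Longrightarrow> (f has_derivative f' x) (at x)"
    and inj: "inj_on f S"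
    and meas: "(\<lambda>x. indicator S x * \<bar>det (matrix (f' x))\<bar>) \<in> borel_measurable borel"
  shows "emeasure lborel (f ` S) = (\<integral>\<^sup>+x\<in>S. ennreal \<bar>det (matrix (f' x))\<bar> \<partial>lborel)"
proof -
  define g where "g = (\<lambda>x. indicator S x * \<bar>det (matrix (f' x))\<bar>)"
  have int_eq: "(\<integral>\<^sup>+x\<in>S. ennreal \<bar>det (matrix (f' x))\<bar> \<partial>lborel) = (\<integral>\<^sup>+x. ennreal (g x) \<partial>lborel)"
    by (intro nn_integral_cong) (simp add: g_def indicator_def)
  have iff: "emeasure lborel (f ` S) = ennreal m \<longleftrightarrow> (\<integral>\<^sup>+x. ennreal (g x) \<partial>lborel) = ennreal m"
    if m: "0 \<le> m" for m
  proof -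
    have "emeasure lborel (f ` S) = ennreal m \<longleftrightarrow> f ` S \<in> lmeasurable \<and> measure lebesgue (f ` S) = m"
    proof
      assume *: "emeasure lborel (f ` S) = ennreal m"
      then have "measure lborel (f ` S) = m"
        using m by (simp add: measure_def)
      then show "f ` S \<in> lmeasurable \<and> measure lebesgue (f ` S) = m"
        using * S(2) by (auto simp: fmeasurable_def)
    next
      assume *: "f ` S \<in> lmeasurable \<and> measure lebesgue (f ` S) = m"
      then have "emeasure lebesgue (f ` S) = ennreal m"
        using emeasure_eq_measure2 by blast
      then show "emeasure lborel (f ` S) = ennreal m"
        using S(2) by simp
    qed
    also have "\<dots> \<longleftrightarrow> ((\<lambda>x. \<bar>det (matrix (f' x))\<bar>) has_integral m) S"
      by (rule has_measure_differentiable_image)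
        (use S der inj in \<open>auto intro: has_derivative_at_withinI\<close>)
    also have "\<dots> \<longleftrightarrow> (g has_integral m) UNIV"
    proof -
      have "g = (\<lambda>x. if x \<in> S then \<bar>det (matrix (f' x))\<bar> else 0)"
        by (auto simp: g_def indicator_def)
      then show ?thesis
        by (simp add: has_integral_restrict_UNIV)
    qed
    also have "\<dots> \<longleftrightarrow> (\<integral>\<^sup>+x. ennreal (g x) \<partial>lborel) = ennreal m"
    proof (subst has_integral_iff_nn_integral_lebesgue)
      have "g \<in> borel_measurable lebesgue"
        using meas by (simp add: g_def measurable_completion)
      then show "g \<in> borel_measurable lebesgue \<and> integral\<^sup>N lebesgue g = ennreal m \<and> 0 \<le> m \<longleftrightarrow>
          (\<integral>\<^sup>+x. ennreal (g x) \<partial>lborel) = ennreal m"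
        using m by (simp add: nn_integral_completion)
    qed (simp add: g_def)
    finally show ?thesis .
  qed
  show ?thesis
    unfolding int_eq
  proof (cases "emeasure lborel (f ` S)" rule: ennreal_cases)
    case (real r)
    then show "emeasure lborel (f ` S) = (\<integral>\<^sup>+x. ennreal (g x) \<partial>lborel)"
      using iff[of r] by simp
  next
    case top
    then show "emeasure lborel (f ` S) = (\<integral>\<^sup>+x. ennreal (g x) \<partial>lborel)"
      using iff by (cases "\<integral>\<^sup>+x. ennreal (g x) \<partial>lborel" rule: ennreal_cases) auto
  qed
qed

lemma borel_sets_image:
  fixes f :: "'a::topological_space \<Rightarrow> 'b"
  assumes "open W" "inj_on f W" and open_image: "\<And>U. open U \<Longrightarrow> U \<subseteq> W \<Longrightarrow> f ` U \<in> sets M"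
    and A: "A \<in> sets borel" "A \<subseteq> W"
  shows "f ` A \<in> sets M"
proof -
  define g where "g = the_inv_into W f"
  have W: "f ` W \<in> sets M"
    using open_image assms(1) by blast
  then have sub: "f ` W \<inter> space M = f ` W"
    using sets.sets_into_space by blast
  have pre: "g -` B \<inter> f ` W = f ` (B \<inter> W)" for B
    using assms(2) by (auto simp: g_def the_inv_into_f_f)
  have "g \<in> borel_measurable (restrict_space M (f ` W))"
  proof (rule borel_measurableI)
    fix S :: "'a set" assume "open S"
    then have "f ` (S \<inter> W) \<in> sets M"
      using open_image assms(1) by (simp add: open_Int)
    then show "g -` S \<inter> space (restrict_space M (f ` W)) \<in> sets (restrict_space M (f ` W))"
      using W by (auto simp: space_restrict_space sub pre sets_restrict_space_iff)
  qed
  from measurable_sets[OF this A(1)] have "f ` (A \<inter> W) \<in> sets (restrict_space M (f ` W))"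
    by (simp add: space_restrict_space sub pre)
  then have "f ` (A \<inter> W) \<in> sets M"
    using W by (simp add: sets_restrict_space_iff sub)
  then show ?thesis
    using A(2) by (simp add: Int_absorb2)
qed

section \<open>Change of variables for the plane as a product\<close>

definition jac :: "(real \<times> real \<Rightarrow> real \<times> real) \<Rightarrow> real" where
  "jac A = fst (A (1, 0)) * snd (A (0, 1)) - snd (A (1, 0)) * fst (A (0, 1))"

text \<open>Leaves are modelled on \<open>real \<times> real\<close>, whereas determinants and the
  change of variables formula live on \<open>real^2\<close>; \<open>to_pair\<close> and
  \<open>of_pair\<close> carry the formula over by conjugation.\<close>

definition to_pair :: "real^2 \<Rightarrow> real \<times> real" where
  "to_pair v = (v $ 1, v $ 2)"

definition of_pair :: "real \<times> real \<Rightarrow> real^2" where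
  "of_pair p = vector [fst p, snd p]"

lemma to_pair_inverse: "to_pair (of_pair p) = p" "of_pair (to_pair v) = v"
  by (simp_all add: to_pair_def of_pair_def vec_eq_iff forall_2)

lemma linear_to_pair: "linear to_pair" and linear_of_pair: "linear of_pair"
  by (auto intro!: linearI simp: to_pair_def of_pair_def vec_eq_iff forall_2)

lemma bounded_linear_to_pair: "bounded_linear to_pair"
  and bounded_linear_of_pair: "bounded_linear of_pair"
  using linear_to_pair linear_of_pair linear_conv_bounded_linear by blast+

lemma measurable_to_pair: "to_pair \<in> borel_measurable borel"
  by (intro borel_measurable_continuous_onI linear_continuous_on bounded_linear_to_pair)

text \<open>Lebesgue measure is determined by its values on boxes, and \<open>to_pair\<close>
  matches boxes with boxes of the same side lengths.\<close>

lemma lborel_to_pair: "distr lborel borel to_pair = (lborel :: (real \<times> real) measure)"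
proof (rule lborel_eqI[symmetric])
  fix l u :: "real \<times> real" assume le: "\<And>b. b \<in> Basis \<Longrightarrow> l \<bullet> b \<le> u \<bullet> b"
  have le': "fst l \<le> fst u" "snd l \<le> snd u"
    using le[of "(1, 0)"] le[of "(0, 1)"] by (auto simp: Basis_prod_def inner_prod_def)
  have "to_pair -` box l u = box (of_pair l) (of_pair u)"
    by (auto simp: to_pair_def of_pair_def mem_box_cart forall_2 box_prod mem_box)
  then have "emeasure (distr lborel borel to_pair) (box l u) = emeasure lborel (box (of_pair l) (of_pair u))"
    using measurable_to_pair by (simp add: emeasure_distr)
  also have "\<dots> = ennreal ((fst u - fst l) * (snd u - snd l))"
    using le' by (subst emeasure_lborel_box)
      (auto simp: Basis_vec_def UNIV_2 of_pair_def inner_axis axis_eq_axis forall_2 prod.insert)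
  finally show "emeasure (distr lborel borel to_pair) (box l u) = ennreal (\<Prod>b\<in>Basis. (u - l) \<bullet> b)"
    by (simp add: Basis_prod_def prod.union_disjoint inner_prod_def mult.commute)
qed simp

lemma emeasure_differentiable_image_plane:
  fixes f :: "real \<times> real \<Rightarrow> real \<times> real"
  assumes S: "S \<in> sets borel" "f ` S \<in> sets borel"
    and der: "\<And>x. x \<in> S \<Longrightarrow> (f has_derivative f' x) (at x)"
    and inj: "inj_on f S"
    and meas: "(\<lambda>x. indicator S x * \<bar>jac (f' x)\<bar>) \<in> borel_measurable borel"
  shows "emeasure lborel (f ` S) = (\<integral>\<^sup>+x\<in>S. ennreal \<bar>jac (f' x)\<bar> \<partial>lborel)"
proof -
  define F where "F = of_pair \<circ> f \<circ> to_pair"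
  define F' where "F' = (\<lambda>v. of_pair \<circ> f' (to_pair v) \<circ> to_pair)"
  define T where "T = to_pair -` S"
  have T: "T \<in> sets borel"
    unfolding T_def using measurable_sets[OF measurable_to_pair S(1)] by simp
  have FT: "F ` T = to_pair -` (f ` S)"
  proof (intro equalityI subsetI)
    fix y assume "y \<in> F ` T"
    then show "y \<in> to_pair -` (f ` S)"
      by (auto simp: F_def T_def to_pair_inverse)
  next
    fix y assume "y \<in> to_pair -` (f ` S)"
    then obtain x where "x \<in> S" "to_pair y = f x"
      by auto
    then have "of_pair x \<in> T" "y = F (of_pair x)"
      by (simp_all add: F_def T_def to_pair_inverse flip: \<open>to_pair y = f x\<close>)
    then show "y \<in> F ` T"
      by blast
  qed
  have FT': "F ` T \<in> sets borel"
    unfolding FT using measurable_sets[OF measurable_to_pair S(2)] by simp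
  have derF: "(F has_derivative F' v) (at v)" if "v \<in> T" for v
    unfolding F_def F'_def
    using that der[of "to_pair v"]
    by (intro diff_chain_at bounded_linear_imp_has_derivative bounded_linear_to_pair
        bounded_linear_of_pair) (auto simp: T_def)
  have jacF: "det (matrix (F' v)) = jac (f' (to_pair v))" for v
  proof -
    have "to_pair (axis 1 1) = (1, 0)" "to_pair (axis 2 1) = (0, 1)"
      by (simp_all add: to_pair_def axis_def)
    then show ?thesis
      by (simp add: det_2 matrix_def F'_def jac_def of_pair_def)
  qed
  have injF: "inj_on F T"
  proof (rule inj_onI)
    fix v w assume "v \<in> T" "w \<in> T" "F v = F w"
    then have "to_pair v \<in> S" "to_pair w \<in> S" "f (to_pair v) = f (to_pair w)"
      using to_pair_inverse(1) by (simp_all add: F_def T_def) metis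
    then have "to_pair v = to_pair w"
      using inj by (simp add: inj_on_def)
    then show "v = w"
      using to_pair_inverse(2) by metis
  qed
  have meas': "(\<lambda>v. indicator T v * \<bar>det (matrix (F' v))\<bar>) \<in> borel_measurable borel"
    using measurable_compose[OF measurable_to_pair meas] unfolding jacF T_def
    by (simp add: indicator_def)
  have "emeasure lborel (f ` S) = emeasure lborel (F ` T)"
    unfolding FT using emeasure_distr[OF measurable_to_pair[folded measurable_lborel2], of "f ` S"] S(2)
    by (simp add: lborel_to_pair)
  also have "\<dots> = (\<integral>\<^sup>+v\<in>T. ennreal \<bar>det (matrix (F' v))\<bar> \<partial>lborel)"
    by (rule emeasure_differentiable_image[OF T FT' derF injF meas'])
  also have "\<dots> = (\<integral>\<^sup>+v. ennreal (indicator S (to_pair v) * \<bar>jac (f' (to_pair v))\<bar>) \<partial>lborel)"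
    unfolding jacF T_def by (intro nn_integral_cong) (simp add: indicator_def)
  also have "\<dots> = (\<integral>\<^sup>+x. ennreal (indicator S x * \<bar>jac (f' x)\<bar>) \<partial>distr lborel borel to_pair)"
    using meas measurable_to_pair by (subst nn_integral_distr) auto
  also have "\<dots> = (\<integral>\<^sup>+x\<in>S. ennreal \<bar>jac (f' x)\<bar> \<partial>lborel)"
    unfolding lborel_to_pair by (intro nn_integral_cong) (simp add: indicator_def)
  finally show ?thesis .
qed

lemma gram_det_plane:
  fixes h :: "real \<times> real \<Rightarrow> real \<times> real \<Rightarrow> real"
  shows "gram_det h = h (1, 0) (1, 0) * h (0, 1) (0, 1) - h (1, 0) (0, 1) * h (0, 1) (1, 0)"
proof -
  have basis: "(Basis :: (real \<times> real) set) = insert (1, 0) {(0, 1)}"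
    by (auto simp: Basis_prod_def)
  have "finite {(0, 1) :: real \<times> real}" "(1, 0) \<notin> {(0, 1) :: real \<times> real}"
    by auto
  note ins = this
  show ?thesis
    unfolding gram_det_def basis sum_over_permutations_insert[OF ins] permutes_sing
    by (simp add: sign_swap_id sign_id swap_id_eq)
qed

text \<open>The Gram matrix is the product of the transpose of \<open>A\<close> with
  \<open>A\<close>, so its determinant is the square of that of \<open>A\<close>. This turns the
  Riemannian density of a plaque into the Jacobian of its lift.\<close>

lemma sqrt_gram_det_jac:
  assumes "linear A" "\<And>u v. h u v = A u \<bullet> A v"
  shows "sqrt (gram_det h) = \<bar>jac A\<bar>"
proof -
  have "gram_det h = (jac A)\<^sup>2"
    unfolding gram_det_plane assms(2) jac_def inner_prod_def
    by (simp add: power2_eq_square algebra_simps)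
  then show ?thesis
    by simp
qed

text \<open>A disjoint countable refinement of a cover on which the two set functions agree, obtained from
  the Lindelof property, lets countable additivity do the rest.\<close>

lemma countably_additive_local_eq:
  fixes F G :: "'e::second_countable_topology set \<Rightarrow> ennreal"
  assumes add1: "\<And>A :: nat \<Rightarrow> 'e set. range A \<subseteq> sets borel \<Longrightarrow> disjoint_family A \<Longrightarrow> (\<Union>n. A n) \<subseteq> W \<Longrightarrow>
      F (\<Union>n. A n) = suminf (\<lambda>n. F (A n))"
    and add2: "\<And>A :: nat \<Rightarrow> 'e set. range A \<subseteq> sets borel \<Longrightarrow> disjoint_family A \<Longrightarrow> (\<Union>n. A n) \<subseteq> W \<Longrightarrow>
      G (\<Union>n. A n) = suminf (\<lambda>n. G (A n))"
    and empty: "F {} = 0" "G {} = 0"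
    and loc: "\<And>x. x \<in> W \<Longrightarrow> \<exists>S. open S \<and> x \<in> S \<and>
      (\<forall>A\<in>sets borel. A \<subseteq> S \<longrightarrow> A \<subseteq> W \<longrightarrow> F A = G A)"
    and A: "A \<in> sets borel" "A \<subseteq> W"
  shows "F A = G A"
proof -
  define \<F> where "\<F> = {S. open S \<and> (\<forall>A\<in>sets borel. A \<subseteq> S \<longrightarrow> A \<subseteq> W \<longrightarrow> F A = G A)}"
  have "open S" if "S \<in> \<F>" for S
    using that by (simp add: \<F>_def)
  then obtain \<F>' where \<F>': "\<F>' \<subseteq> \<F>" "countable \<F>'" "\<Union>\<F>' = \<Union>\<F>"
    by (rule Lindelof)
  \<comment> \<open>\<open>from_nat_into\<close> has the given countable set as its range only if
    that set is nonempty; adding the empty set is harmless because \<open>F\<close> and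
    \<open>G\<close> agree on it.\<close>
  define B where "B = from_nat_into (insert {} \<F>')"
  have range_B: "range B = insert {} \<F>'"
    unfolding B_def using \<F>'(2) by (intro range_from_nat_into) auto
  have B: "B n \<in> \<F>" for n
  proof -
    have "{} \<in> \<F>"
      using empty by (simp add: \<F>_def)
    then have "range B \<subseteq> \<F>"
      unfolding range_B using \<F>'(1) by (rule insert_subsetI)
    then show ?thesis
      by (simp add: image_subset_iff)
  qed
  then have "B n \<in> sets borel" for n
    by (auto simp: \<F>_def)
  then have dB: "disjointed B n \<in> sets borel" for n
    using sets.range_disjointed_sets[of B borel] by (simp add: image_subset_iff)
  define D where "D = (\<lambda>n. A \<inter> disjointed B n)"
  have "W \<subseteq> \<Union>\<F>"
  proof
    fix x assume "x \<in> W"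
    from loc[OF this] obtain S where "S \<in> \<F>" "x \<in> S"
      unfolding \<F>_def by blast
    then show "x \<in> \<Union>\<F>" ..
  qed
  also have "\<Union>\<F> = (\<Union>n. B n)"
    using \<F>'(3) by (simp add: range_B)
  finally have "W \<subseteq> (\<Union>n. disjointed B n)"
    by (simp add: UN_disjointed_eq)
  then have D_Un: "(\<Union>n. D n) = A"
    using A(2) by (auto simp: D_def)
  have D: "range D \<subseteq> sets borel" "disjoint_family D"
    using A(1) dB disjoint_family_disjointed[of B] by (auto simp: D_def disjoint_family_on_def)
  have "F (D n) = G (D n)" for n
  proof -
    have "D n \<in> sets borel" "D n \<subseteq> B n" "D n \<subseteq> W"
      using D(1) A(2) disjointed_subset[of B n] by (auto simp: D_def)
    then show ?thesis
      using B[of n] by (simp add: \<F>_def)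
  qed
  then show ?thesis
    using add1[OF D] add2[OF D] A(2) by (simp add: D_Un)
qed

section \<open>Rectangular lattices and their fundamental domains\<close>

definition rect_lattice :: "real \<Rightarrow> real \<Rightarrow> (real \<times> real) set" where
  "rect_lattice \<alpha> \<beta> = range (\<lambda>(m, n). (\<alpha> * of_int m, \<beta> * of_int n))"

text \<open>Half open, so that each class modulo the lattice has exactly one representative. The
  closed end is on the right to suit the ceiling function.\<close>

definition rect_domain :: "real \<Rightarrow> real \<Rightarrow> (real \<times> real) set" where
  "rect_domain \<alpha> \<beta> = {0<..\<alpha>} \<times> {0<..\<beta>}"

lemma mem_rect_lattice_iff:
  "x \<in> rect_lattice \<alpha> \<beta> \<longleftrightarrow> (\<exists>(m::int) (n::int). x = (\<alpha> * m, \<beta> * n))"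
  by (auto simp: rect_lattice_def)

lemma countable_rect_lattice: "countable (rect_lattice \<alpha> \<beta>)"
  by (simp add: rect_lattice_def)

lemma rect_lattice_diff:
  assumes "l \<in> rect_lattice \<alpha> \<beta>" "m \<in> rect_lattice \<alpha> \<beta>"
  shows "l - m \<in> rect_lattice \<alpha> \<beta>"
proof -
  obtain a b c d :: int where "l = (\<alpha> * a, \<beta> * b)" "m = (\<alpha> * c, \<beta> * d)"
    using assms unfolding mem_rect_lattice_iff by blast
  then have "l - m = (\<alpha> * of_int (a - c), \<beta> * of_int (b - d))"
    by (simp add: right_diff_distrib)
  then show ?thesis
    unfolding mem_rect_lattice_iff by blast
qed

lemma rect_domain_decomp:
  assumes "0 < \<alpha>" "0 < \<beta>"
  obtains l where "l \<in> rect_lattice \<alpha> \<beta>" "x - l \<in> rect_domain \<alpha> \<beta>"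
proof -
  have "0 < a - c * of_int (\<lceil>a / c\<rceil> - 1) \<and> a - c * of_int (\<lceil>a / c\<rceil> - 1) \<le> c"
    if "0 < c" for a c :: real
  proof -
    \<comment> \<open>\<open>k\<close> is the integer with \<open>k < a / c \<le> k + 1\<close>,
      hence the shift by one from the ceiling.\<close>
    define k where "k = real_of_int (\<lceil>a / c\<rceil> - 1)"
    have "k < a / c" "a / c \<le> k + 1"
      unfolding k_def by linarith+
    then show ?thesis
      unfolding k_def[symmetric] using that by (simp add: field_simps)
  qed
  note bounds = this[OF assms(1), of "fst x"] this[OF assms(2), of "snd x"]
  show ?thesis
  proof (rule that)
    show "(\<alpha> * of_int (\<lceil>fst x / \<alpha>\<rceil> - 1), \<beta> * of_int (\<lceil>snd x / \<beta>\<rceil> - 1)) \<in> rect_lattice \<alpha> \<beta>"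
      unfolding mem_rect_lattice_iff by blast
    show "x - (\<alpha> * of_int (\<lceil>fst x / \<alpha>\<rceil> - 1), \<beta> * of_int (\<lceil>snd x / \<beta>\<rceil> - 1)) \<in> rect_domain \<alpha> \<beta>"
      using bounds by (simp add: rect_domain_def mem_Times_iff)
  qed
qed

lemma rect_lattice_small:
  assumes "0 < \<alpha>" "0 < \<beta>" "l \<in> rect_lattice \<alpha> \<beta>" "\<bar>fst l\<bar> < \<alpha>" "\<bar>snd l\<bar> < \<beta>"
  shows "l = 0"
proof -
  obtain m n :: int where l: "l = (\<alpha> * m, \<beta> * n)"
    using assms(3) unfolding mem_rect_lattice_iff by blast
  have "i = 0" if "0 < c" "\<bar>c * of_int i\<bar> < c" for c :: real and i :: int
  proof -
    have "\<bar>real_of_int i\<bar> < 1"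
      using that by (simp add: abs_mult)
    then show "i = 0"
      by linarith
  qed
  then have "m = 0" "n = 0"
    using assms l by auto
  then show ?thesis
    by (simp add: l zero_prod_def)
qed

lemma rect_domain_unique:
  assumes "0 < \<alpha>" "0 < \<beta>" "x \<in> rect_domain \<alpha> \<beta>" "y \<in> rect_domain \<alpha> \<beta>"
    "x - y \<in> rect_lattice \<alpha> \<beta>"
  shows "x = y"
proof -
  have "\<bar>fst (x - y)\<bar> < \<alpha>" "\<bar>snd (x - y)\<bar> < \<beta>"
    using assms(3,4) by (auto simp: rect_domain_def)
  then show ?thesis
    using rect_lattice_small[OF assms(1,2,5)] by simp
qed

lemma rect_domain_borel: "rect_domain \<alpha> \<beta> \<in> sets borel"
  unfolding rect_domain_def by (intro borel_Times) auto

lemma emeasure_rect_domain: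
  assumes "0 < \<alpha>" "0 < \<beta>"
  shows "emeasure lborel (rect_domain \<alpha> \<beta>) = ennreal (\<alpha> * \<beta>)"
proof -
  have "emeasure (lborel \<Otimes>\<^sub>M lborel) ({0<..\<alpha>} \<times> {0<..\<beta>}) = ennreal \<alpha> * ennreal \<beta>"
    using assms by (subst lborel.emeasure_pair_measure_Times) auto
  then show ?thesis
    using assms by (simp add: rect_domain_def lborel_prod ennreal_mult)
qed

text \<open>Cutting \<open>V\<close> along the translates of the fundamental domain and moving the pieces back.\<close>

lemma emeasure_fold_rect_domain:
  assumes "0 < \<alpha>" "0 < \<beta>" and V: "V \<in> sets borel"
    and inj: "\<And>v w. v \<in> V \<Longrightarrow> w \<in> V \<Longrightarrow> v - w \<in> rect_lattice \<alpha> \<beta> \<Longrightarrow> v = w"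
  shows "emeasure lborel {x \<in> rect_domain \<alpha> \<beta>. \<exists>v\<in>V. x - v \<in> rect_lattice \<alpha> \<beta>} = emeasure lborel V"
proof -
  let ?L = "rect_lattice \<alpha> \<beta>" and ?D = "rect_domain \<alpha> \<beta>"
  define piece where "piece = (\<lambda>l. V \<inter> (\<lambda>v. v - l) -` ?D)"
  define moved where "moved = (\<lambda>l. (+) l -` piece l)"
  have "(\<lambda>v. v - l) \<in> borel_measurable borel" for l :: "real \<times> real"
    by measurable
  from measurable_sets[OF this rect_domain_borel]
  have piece: "piece l \<in> sets borel" for l
    using V by (simp add: piece_def)
  have plus: "(+) l \<in> measurable lborel borel" for l :: "real \<times> real"
    by measurable
  have moved: "moved l \<in> sets borel" for l
    using measurable_sets[OF plus piece] by (simp add: moved_def)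
  have moved_eq: "moved l = {x \<in> ?D. l + x \<in> V}" for l
  proof -
    have "x \<in> moved l \<longleftrightarrow> x \<in> ?D \<and> l + x \<in> V" for x
      by (simp add: moved_def piece_def conj_commute)
    then show ?thesis
      by blast
  qed
  have eq: "emeasure lborel (moved l) = emeasure lborel (piece l)" for l
    using emeasure_distr[OF plus piece, of l l] by (simp add: lborel_distr_plus moved_def)
  have "(\<Union>l\<in>?L. piece l) = V"
  proof
    show "V \<subseteq> (\<Union>l\<in>?L. piece l)"
    proof
      fix v assume "v \<in> V"
      moreover obtain l where "l \<in> ?L" "v - l \<in> ?D"
        by (rule rect_domain_decomp[OF assms(1,2)])
      ultimately show "v \<in> (\<Union>l\<in>?L. piece l)"
        by (auto simp: piece_def)
    qed
  qed (auto simp: piece_def)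
  moreover have "disjoint_family_on piece ?L"
    unfolding disjoint_family_on_def
  proof (intro ballI impI)
    fix l m assume lm: "l \<in> ?L" "m \<in> ?L" "l \<noteq> m"
    have False if "v \<in> piece l" "v \<in> piece m" for v
      using rect_domain_unique[OF assms(1,2), of "v - l" "v - m"] rect_lattice_diff[OF lm(2,1)] lm(3) that
      by (simp add: piece_def)
    then show "piece l \<inter> piece m = {}"
      by blast
  qed
  ultimately have "emeasure lborel V = (\<integral>\<^sup>+l. emeasure lborel (piece l) \<partial>count_space ?L)"
    using emeasure_UN_countable[of ?L piece lborel] piece countable_rect_lattice by simp
  moreover have "(\<Union>l\<in>?L. moved l) = {x \<in> ?D. \<exists>v\<in>V. x - v \<in> ?L}"
  proof (intro equalityI subsetI)
    fix x assume "x \<in> (\<Union>l\<in>?L. moved l)"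
    then obtain l where l: "l \<in> ?L" "x \<in> ?D" "l + x \<in> V"
      by (auto simp: moved_eq)
    have "0 \<in> ?L"
      using rect_lattice_diff[OF l(1) l(1)] by simp
    then have "x - (l + x) \<in> ?L"
      using rect_lattice_diff[of 0 \<alpha> \<beta> l] l(1) by simp
    then show "x \<in> {x \<in> ?D. \<exists>v\<in>V. x - v \<in> ?L}"
      using l by blast
  next
    fix x assume "x \<in> {x \<in> ?D. \<exists>v\<in>V. x - v \<in> ?L}"
    then obtain v where v: "x \<in> ?D" "v \<in> V" "x - v \<in> ?L"
      by blast
    then have "v - x \<in> ?L"
      using rect_lattice_diff[OF rect_lattice_diff[OF v(3) v(3)] v(3)] by simp
    moreover have "x \<in> moved (v - x)"
      using v by (simp add: moved_eq)
    ultimately show "x \<in> (\<Union>l\<in>?L. moved l)"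
      by blast
  qed
  \<comment> \<open>A point \<open>x\<close> of two moved pieces yields points \<open>l + x\<close>
    and \<open>m + x\<close> of \<open>V\<close> that differ by a lattice vector, which
    \<open>inj\<close> excludes. The unmoved pieces are disjoint for another reason: representatives
    in the domain are unique.\<close>
  moreover have "disjoint_family_on moved ?L"
    unfolding disjoint_family_on_def
  proof (intro ballI impI)
    fix l m assume lm: "l \<in> ?L" "m \<in> ?L" "l \<noteq> m"
    have False if "x \<in> moved l" "x \<in> moved m" for x
      using inj[of "l + x" "m + x"] rect_lattice_diff[OF lm(1,2)] lm(3) that
      by (simp add: moved_eq)
    then show "moved l \<inter> moved m = {}"
      by blast
  qed
  ultimately show ?thesis
    using emeasure_UN_countable[of ?L moved lborel] moved countable_rect_lattice eq by simp
qed

section \<open>The fibre product as a flat torus\<close>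

lemma coset_eq_iff:
  assumes "0 \<in> L" "\<And>l m. l \<in> L \<Longrightarrow> m \<in> L \<Longrightarrow> l - m \<in> L"
  shows "coset L x = coset L y \<longleftrightarrow> x - y \<in> L"
proof
  assume "coset L x = coset L y"
  moreover have "x \<in> coset L x"
    using assms(1) by (auto simp: coset_def intro: image_eqI[of _ _ 0])
  ultimately show "x - y \<in> L"
    by (auto simp: coset_def)
next
  have sub: "coset L x \<subseteq> coset L y" if "x - y \<in> L" for x y
  proof
    fix z assume "z \<in> coset L x"
    then obtain l where l: "l \<in> L" "z = x + l"
      by (auto simp: coset_def)
    have "l - (0 - (x - y)) \<in> L"
      using assms l(1) that by blast
    then show "z \<in> coset L y"
      unfolding coset_def l(2) by (intro image_eqI[of _ _ "l - (0 - (x - y))"]) auto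
  qed
  assume *: "x - y \<in> L"
  then have "0 - (x - y) \<in> L"
    using assms by blast
  then show "coset L x = coset L y"
    using sub[OF *] sub[of y x] by simp
qed

lemma discrete_quotient_quot:
  assumes "0 \<in> L" "\<And>l m. l \<in> L \<Longrightarrow> m \<in> L \<Longrightarrow> l - m \<in> L"
    and "0 < r" "\<And>l. l \<in> L \<Longrightarrow> l \<noteq> 0 \<Longrightarrow> r \<le> norm l"
  shows "discrete_quotient (quot L) (coset L) L r"
proof
  \<comment> \<open>\<open>topology\<close> returns an object with the prescribed open sets only if
    these form a topology.\<close>
  have "istopology (\<lambda>U. U \<subseteq> range (coset L) \<and> open {x. coset L x \<in> U})"
    unfolding istopology_def
  proof (intro conjI allI impI)
    fix S T assume "S \<subseteq> range (coset L) \<and> open {x. coset L x \<in> S}"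
      "T \<subseteq> range (coset L) \<and> open {x. coset L x \<in> T}"
    moreover have "{x. coset L x \<in> S \<inter> T} = {x. coset L x \<in> S} \<inter> {x. coset L x \<in> T}"
      by auto
    ultimately show "S \<inter> T \<subseteq> range (coset L)" "open {x. coset L x \<in> S \<inter> T}"
      by auto
  next
    fix \<K> assume *: "\<forall>K\<in>\<K>. K \<subseteq> range (coset L) \<and> open {x. coset L x \<in> K}"
    then show "\<Union>\<K> \<subseteq> range (coset L)"
      by blast
    have "{x. coset L x \<in> \<Union>\<K>} = (\<Union>K\<in>\<K>. {x. coset L x \<in> K})"
      by auto
    then show "open {x. coset L x \<in> \<Union>\<K>}"
      using * by auto
  qed
  then show "openin (mtop (quot L)) U \<longleftrightarrow> U \<subseteq> range (coset L) \<and> open (coset L -` U)" for U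
    by (simp add: quot_def topology_inverse' vimage_def)
  show "coset L x = coset L y \<longleftrightarrow> x - y \<in> L" for x y
    by (rule coset_eq_iff[OF assms(1,2)])
qed (use assms in \<open>auto simp: quot_def\<close>)

section \<open>The lattices of the curves and of the base circle\<close>

lemma mem_lattice_iff:
  "z \<in> lattice \<tau> 1 \<longleftrightarrow> (\<exists>(m::int) (n::int). Re z = m * Re \<tau> + n \<and> Im z = m * Im \<tau>)"
  by (auto simp: lattice_def complex_eq_iff)

text \<open>A lattice vector \<open>m * \<tau> + n\<close> has imaginary part at least
  \<open>Im \<tau>\<close> in absolute value if \<open>m \<noteq> 0\<close>, and is an integer
  otherwise; hence the radius \<open>min 1 (Im \<tau>)\<close>.\<close>

lemma discrete_quotient_E_mfd:
  assumes "0 < Im \<tau>"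
  shows "discrete_quotient (E_mfd \<tau>) (coset (lattice \<tau> 1)) (lattice \<tau> 1) (min 1 (Im \<tau>))"
  unfolding E_mfd_def
proof (rule discrete_quotient_quot)
  show "0 \<in> lattice \<tau> 1"
    by (auto simp: mem_lattice_iff intro: exI[of _ 0])
  fix l assume l: "l \<in> lattice \<tau> 1"
  then obtain m n :: int where mn: "Re l = m * Re \<tau> + n" "Im l = m * Im \<tau>"
    by (auto simp: mem_lattice_iff)
  show "l - l' \<in> lattice \<tau> 1" if "l' \<in> lattice \<tau> 1" for l'
  proof -
    obtain m' n' :: int where "Re l' = m' * Re \<tau> + n'" "Im l' = m' * Im \<tau>"
      using \<open>l' \<in> _\<close> by (auto simp: mem_lattice_iff)
    with mn show ?thesis
      unfolding mem_lattice_iff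
      by (intro exI[of _ "m - m'"] exI[of _ "n - n'"]) (simp add: algebra_simps)
  qed
  assume "l \<noteq> 0"
  show "min 1 (Im \<tau>) \<le> norm l"
  proof (cases "m = 0")
    case True
    then have "n \<noteq> 0"
      using mn \<open>l \<noteq> 0\<close> by (auto simp: complex_eq_iff)
    then have "1 \<le> \<bar>Re l\<bar>"
      using mn True by simp
    then show ?thesis
      using abs_Re_le_cmod[of l] by linarith
  next
    case False
    then have "1 * Im \<tau> \<le> \<bar>real_of_int m\<bar> * Im \<tau>"
      using assms by (intro mult_right_mono) auto
    then have "Im \<tau> \<le> \<bar>Im l\<bar>"
      using mn assms by (simp add: abs_mult)
    then show ?thesis
      using abs_Im_le_cmod[of l] by linarith
  qed
qed (use assms in simp)

lemma discrete_quotient_base_mfd: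
  assumes "0 < Im \<tau>" "0 < Im t"
  shows "discrete_quotient (base_mfd \<tau> t) (coset (base_lattice \<tau> t)) (base_lattice \<tau> t)
    (sqrt (Im t * Im \<tau>))"
  unfolding base_mfd_def
proof (rule discrete_quotient_quot)
  show "0 \<in> base_lattice \<tau> t"
    by (auto simp: base_lattice_def intro: exI[of _ 0])
  fix l assume "l \<in> base_lattice \<tau> t"
  then obtain k where k: "l = of_int k * sqrt (Im t * Im \<tau>)"
    by (auto simp: base_lattice_def)
  show "l - l' \<in> base_lattice \<tau> t" if "l' \<in> base_lattice \<tau> t" for l'
  proof -
    obtain k' where "l' = of_int k' * sqrt (Im t * Im \<tau>)"
      using \<open>l' \<in> _\<close> by (auto simp: base_lattice_def)
    then have "l - l' = of_int (k - k') * sqrt (Im t * Im \<tau>)"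
      by (simp add: k left_diff_distrib)
    then show ?thesis
      unfolding base_lattice_def by blast
  qed
  assume "l \<noteq> 0"
  then have "1 * sqrt (Im t * Im \<tau>) \<le> \<bar>real_of_int k\<bar> * sqrt (Im t * Im \<tau>)"
    using assms k by (intro mult_right_mono) auto
  then show "sqrt (Im t * Im \<tau>) \<le> norm l"
    using assms by (simp add: k abs_mult)
qed (use assms in simp)

lemma base_lattice_commute: "base_lattice \<tau> t = base_lattice t \<tau>"
  by (simp add: base_lattice_def mult.commute)

text \<open>\<open>the_elem\<close> is meaningful here because a lattice vector has imaginary part
  \<open>m * Im \<tau>\<close>, which the scaling turns into \<open>m\<close> periods of the base
  circle. So the image of a coset is a single point.\<close>

lemma E_to_base_coset:
  assumes "0 < Im \<tau>" "0 < Im t"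
  shows "E_to_base \<tau> t (coset (lattice \<tau> 1) z) = coset (base_lattice \<tau> t) (sqrt (Im t / Im \<tau>) * Im z)"
proof -
  interpret E: discrete_quotient "E_mfd \<tau>" "coset (lattice \<tau> 1)" "lattice \<tau> 1" "min 1 (Im \<tau>)"
    by (rule discrete_quotient_E_mfd[OF assms(1)])
  interpret B: discrete_quotient "base_mfd \<tau> t" "coset (base_lattice \<tau> t)" "base_lattice \<tau> t"
    "sqrt (Im t * Im \<tau>)"
    by (rule discrete_quotient_base_mfd[OF assms])
  have "coset (base_lattice \<tau> t) (sqrt (Im t / Im \<tau>) * Im (z + l)) =
      coset (base_lattice \<tau> t) (sqrt (Im t / Im \<tau>) * Im z)" if l: "l \<in> lattice \<tau> 1" for l
  proof -
    obtain m :: int where m: "Im l = m * Im \<tau>"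
      using l by (auto simp: mem_lattice_iff)
    have "sqrt (Im t / Im \<tau>) * Im \<tau> = sqrt (Im t * Im \<tau>)"
      using assms by (simp add: real_sqrt_divide real_sqrt_mult real_div_sqrt mult.assoc[symmetric] field_simps)
    then have "sqrt (Im t / Im \<tau>) * Im (z + l) - sqrt (Im t / Im \<tau>) * Im z = m * sqrt (Im t * Im \<tau>)"
      by (simp add: m algebra_simps)
    then have "sqrt (Im t / Im \<tau>) * Im (z + l) - sqrt (Im t / Im \<tau>) * Im z \<in> base_lattice \<tau> t"
      unfolding base_lattice_def by blast
    then show ?thesis
      using B.eq_iff by blast
  qed
  then have "(\<lambda>z. coset (base_lattice \<tau> t) (sqrt (Im t / Im \<tau>) * Im z)) ` coset (lattice \<tau> 1) z =
      {coset (base_lattice \<tau> t) (sqrt (Im t / Im \<tau>) * Im z)}"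
    using E.zero_mem by (auto simp: coset_def[of "lattice \<tau> 1"] image_image)
  then show ?thesis
    by (simp add: E_to_base_def)
qed

text \<open>The integer \<open>m\<close> counts turns around the base and is shared by both curves,
  as the fibre product identifies their base coordinates; \<open>n\<close> and \<open>k\<close>
  count turns along the real directions of the two curves.\<close>

definition X_lattice :: "complex \<Rightarrow> complex \<Rightarrow> (real \<times> real \<times> real) set" where
  "X_lattice \<tau> t = {(y, a, b). \<exists>(m::int) (n::int) (k::int). y = m * sqrt (Im t * Im \<tau>) \<and>
     a = sqrt (Im t / Im \<tau>) * (m * Re \<tau> + n) \<and> b = sqrt (Im \<tau> / Im t) * (m * Re t + k)}"

text \<open>A bound for the length of nonzero lattice vectors: either \<open>m \<noteq> 0\<close>
  and the first coordinate is large, or \<open>m = 0\<close> and one of the others is a nonzero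
  integer multiple of its period.\<close>

definition X_radius :: "complex \<Rightarrow> complex \<Rightarrow> real" where
  "X_radius \<tau> t = min (sqrt (Im t * Im \<tau>)) (min (sqrt (Im t / Im \<tau>)) (sqrt (Im \<tau> / Im t)))"

text \<open>\<open>lift1\<close> and \<open>lift2\<close> are the linear lifts of the projections
  from the fibre product to the two curves.\<close>

definition lift1 :: "complex \<Rightarrow> complex \<Rightarrow> real \<times> real \<times> real \<Rightarrow> complex" where
  "lift1 \<tau> t = (\<lambda>(y, a, b). of_real (sqrt (Im \<tau> / Im t)) * Complex a y)"

definition lift2 :: "complex \<Rightarrow> complex \<Rightarrow> real \<times> real \<times> real \<Rightarrow> complex" where
  "lift2 \<tau> t = (\<lambda>(y, a, b). of_real (sqrt (Im t / Im \<tau>)) * Complex b y)"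

lemma X_param_lift:
  "X_param \<tau> t x = (coset (lattice \<tau> 1) (lift1 \<tau> t x), coset (lattice t 1) (lift2 \<tau> t x))"
  by (simp add: X_param_def lift1_def lift2_def split: prod.split)

lemma linear_lift1: "linear (lift1 \<tau> t)" and linear_lift2: "linear (lift2 \<tau> t)"
  by (auto simp: lift1_def lift2_def complex_eq_iff algebra_simps intro!: linearI)

lemma bounded_linear_lift1: "bounded_linear (lift1 \<tau> t)"
  and bounded_linear_lift2: "bounded_linear (lift2 \<tau> t)"
  using linear_lift1 linear_lift2 linear_conv_bounded_linear by blast+

locale two_half_planes =
  fixes \<tau> t :: complex
  assumes Im_tau: "0 < Im \<tau>" and Im_t: "0 < Im t"
begin

abbreviation "\<alpha> \<equiv> sqrt (Im t / Im \<tau>)"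
abbreviation "\<beta> \<equiv> sqrt (Im \<tau> / Im t)"
abbreviation "\<eta> \<equiv> sqrt (Im t * Im \<tau>)"
abbreviation "X \<equiv> X_mfd \<tau> t"
abbreviation "\<pi> \<equiv> X_param \<tau> t"
abbreviation "\<Lambda> \<equiv> X_lattice \<tau> t"

sublocale E: discrete_quotient "E_mfd \<tau>" "coset (lattice \<tau> 1)" "lattice \<tau> 1" "min 1 (Im \<tau>)"
  by (rule discrete_quotient_E_mfd[OF Im_tau])

sublocale E': discrete_quotient "E_mfd t" "coset (lattice t 1)" "lattice t 1" "min 1 (Im t)"
  by (rule discrete_quotient_E_mfd[OF Im_t])

sublocale B: discrete_quotient "base_mfd \<tau> t" "coset (base_lattice \<tau> t)" "base_lattice \<tau> t" \<eta>
  by (rule discrete_quotient_base_mfd[OF Im_tau Im_t])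

lemma pos: "0 < \<alpha>" "0 < \<beta>" "0 < \<eta>"
  using Im_tau Im_t by auto

lemma scale_simps: "\<alpha> * \<beta> = 1" "\<beta> * \<alpha> = 1" "\<alpha> * Im \<tau> = \<eta>" "\<beta> * Im t = \<eta>"
  "\<beta> * \<eta> = Im \<tau>" "\<alpha> * \<eta> = Im t"
  using Im_tau Im_t
  by (simp_all add: real_sqrt_divide real_sqrt_mult field_simps)

lemma cancel: "\<beta> * (\<alpha> * c) = c" "\<alpha> * (\<beta> * c) = c"
  by (simp_all only: mult.assoc[symmetric] scale_simps mult_1)

lemma scale_eq_iff: "\<beta> * c = d \<longleftrightarrow> c = \<alpha> * d" "\<alpha> * c = d \<longleftrightarrow> c = \<beta> * d"
  using cancel by metis+

lemma scale_Im: "\<alpha> * (c * Im \<tau>) = c * \<eta>" "\<beta> * (c * Im t) = c * \<eta>"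
  by (simp_all only: mult.left_commute[of _ c] scale_simps)

text \<open>Each of the two conditions provides its own integer \<open>m\<close> with
  \<open>y = m * \<eta>\<close>; since \<open>\<eta>\<close> is positive the two coincide, which
  gives the common \<open>m\<close> of \<open>X_lattice\<close>.\<close>

lemma mem_X_lattice_iff:
  "x \<in> \<Lambda> \<longleftrightarrow> lift1 \<tau> t x \<in> lattice \<tau> 1 \<and> lift2 \<tau> t x \<in> lattice t 1"
proof -
  obtain y a b where x: "x = (y, a, b)"
    using prod_cases3 by blast
  have "lift1 \<tau> t x \<in> lattice \<tau> 1 \<longleftrightarrow>
      (\<exists>(m::int) (n::int). a = \<alpha> * (m * Re \<tau> + n) \<and> y = m * \<eta>)"
    "lift2 \<tau> t x \<in> lattice t 1 \<longleftrightarrow>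
      (\<exists>(m::int) (n::int). b = \<beta> * (m * Re t + n) \<and> y = m * \<eta>)"
    by (simp_all add: x lift1_def lift2_def mem_lattice_iff scale_eq_iff scale_Im
        del: real_sqrt_divide real_sqrt_mult)
  moreover have "real_of_int m * \<eta> = real_of_int m' * \<eta> \<longleftrightarrow> m = m'" for m m'
    using Im_tau Im_t by simp
  ultimately show ?thesis
    unfolding X_lattice_def x mem_Collect_eq prod.case by metis
qed

text \<open>The condition defining the fibre product is an equation modulo \<open>\<eta>\<close>.
  For representatives whose base coordinates are less than one period apart it becomes an equation
  of real numbers.\<close>

lemma base_eq:
  assumes "E_to_base \<tau> t (coset (lattice \<tau> 1) z) = E_to_base t \<tau> (coset (lattice t 1) w)"
    "\<bar>\<alpha> * Im z - \<beta> * Im w\<bar> < \<eta>"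
  shows "\<alpha> * Im z = \<beta> * Im w"
proof (rule B.eq_if_close)
  show "coset (base_lattice \<tau> t) (\<alpha> * Im z) = coset (base_lattice \<tau> t) (\<beta> * Im w)"
    using assms(1) E_to_base_coset Im_tau Im_t base_lattice_commute by metis
qed (use assms(2) in \<open>simp add: dist_real_def\<close>)

lemma X_param_eqI:
  assumes "\<alpha> * Im z = \<beta> * Im w"
  shows "\<pi> (\<alpha> * Im z, \<alpha> * Re z, \<beta> * Re w) = (coset (lattice \<tau> 1) z, coset (lattice t 1) w)"
proof -
  have "of_real \<beta> * Complex (\<alpha> * Re z) (\<alpha> * Im z) = z"
    "of_real \<alpha> * Complex (\<beta> * Re w) (\<alpha> * Im z) = w"
    unfolding assms
    by (simp_all only: assms[symmetric] complex_eq_iff Re_complex_of_real Im_complex_of_real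
        complex.sel times_complex.sel cancel mult_zero_left diff_0_right add_0_right) (simp add: assms cancel)
  then show ?thesis
    by (simp add: X_param_def)
qed

lemma E_to_base_X_param:
  "E_to_base \<tau> t (fst (\<pi> x)) = coset (base_lattice \<tau> t) (fst x)"
  "E_to_base t \<tau> (snd (\<pi> x)) = coset (base_lattice \<tau> t) (fst x)"
  by (cases x; simp add: X_param_def E_to_base_coset Im_tau Im_t cancel
      base_lattice_commute[of t \<tau>] del: real_sqrt_divide)+

lemma topspace_X: "topspace (mtop X) = range \<pi>"
proof -
  have "p \<in> range \<pi>" if "p \<in> topspace (mtop X)" for p
  proof -
    have fibre: "fst p \<in> range (coset (lattice \<tau> 1))" "snd p \<in> range (coset (lattice t 1))"
      "E_to_base \<tau> t (fst p) = E_to_base t \<tau> (snd p)"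
      using that by (auto simp: X_mfd_def E.topspace_eq E'.topspace_eq)
    obtain z w where "fst p = coset (lattice \<tau> 1) z" "snd p = coset (lattice t 1) w"
      using fibre(1,2) by blast
    then have p: "p = (coset (lattice \<tau> 1) z, coset (lattice t 1) w)"
      and base: "E_to_base \<tau> t (coset (lattice \<tau> 1) z) = E_to_base t \<tau> (coset (lattice t 1) w)"
      using fibre(3) by (simp_all add: prod_eq_iff)
    have "coset (base_lattice \<tau> t) (\<alpha> * Im z) = coset (base_lattice \<tau> t) (\<beta> * Im w)"
      using base E_to_base_coset Im_tau Im_t base_lattice_commute by metis
    then have "\<alpha> * Im z - \<beta> * Im w \<in> base_lattice \<tau> t"
      by (simp only: B.eq_iff)
    then obtain k :: int where k: "\<alpha> * Im z - \<beta> * Im w = k * \<eta>"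
      unfolding base_lattice_def by blast
    \<comment> \<open>The base coordinates of \<open>z\<close> and \<open>w\<close> agree only up to
      \<open>k\<close> periods. Replacing \<open>w\<close> by \<open>w + k * t\<close> keeps its
      class and shifts its base coordinate by exactly \<open>k * \<eta>\<close>.\<close>
    have "of_int k * t \<in> lattice t 1"
      unfolding mem_lattice_iff by (intro exI[of _ k] exI[of _ 0]) simp
    then have w: "coset (lattice t 1) (w + of_int k * t) = coset (lattice t 1) w"
      by (rule E'.translate)
    have Im_eq: "\<alpha> * Im z = \<beta> * Im (w + of_int k * t)"
    proof -
      have "\<beta> * Im (w + of_int k * t) = \<beta> * Im w + \<beta> * (k * Im t)"
        by (simp add: distrib_left del: real_sqrt_divide)
      then show ?thesis
        using k unfolding scale_Im by linarith
    qed
    have "\<pi> (\<alpha> * Im z, \<alpha> * Re z, \<beta> * Re (w + of_int k * t)) = p"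
      unfolding X_param_eqI[OF Im_eq] p w ..
    then show ?thesis
      by (metis rangeI)
  qed
  moreover have "\<pi> x \<in> topspace (mtop X)" for x
    using E_to_base_X_param[of x]
    by (auto simp: X_mfd_def E.topspace_eq E'.topspace_eq X_param_lift)
  ultimately show ?thesis
    by auto
qed

lemma continuous_X_param: "continuous_map euclidean (mtop X) \<pi>"
proof -
  have "continuous_map euclidean (mtop (E_mfd \<tau>)) (coset (lattice \<tau> 1) \<circ> lift1 \<tau> t)"
    using E.continuous_proj[of UNIV]
    by (intro continuous_map_compose[of _ euclidean])
      (simp_all add: linear_continuous_on bounded_linear_lift1)
  moreover have "continuous_map euclidean (mtop (E_mfd t)) (coset (lattice t 1) \<circ> lift2 \<tau> t)"
    using E'.continuous_proj[of UNIV]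
    by (intro continuous_map_compose[of _ euclidean])
      (simp_all add: linear_continuous_on bounded_linear_lift2)
  ultimately have "continuous_map euclidean (prod_topology (mtop (E_mfd \<tau>)) (mtop (E_mfd t))) \<pi>"
    by (simp add: continuous_map_paired X_param_lift[abs_def] o_def)
  moreover have "\<pi> x \<in> topspace (mtop X)" for x
    by (simp add: topspace_X)
  ultimately show ?thesis
    by (auto simp: X_mfd_def continuous_map_in_subtopology)
qed

text \<open>The subspace topology of the product is thus the quotient topology of the flat
  coordinates. The harder direction needs a local inverse of the parametrization that is continuous
  for the product topology; it is provided by \<open>g\<close> on pairs of representatives.\<close>

lemma openin_X_iff: "openin (mtop X) U \<longleftrightarrow> U \<subseteq> range \<pi> \<and> open (\<pi> -` U)"
proof
  assume "openin (mtop X) U"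
  then show "U \<subseteq> range \<pi> \<and> open (\<pi> -` U)"
    using openin_subset[of "mtop X" U] openin_continuous_map_preimage[OF continuous_X_param]
    by (auto simp: topspace_X vimage_def)
next
  assume U: "U \<subseteq> range \<pi> \<and> open (\<pi> -` U)"
  show "openin (mtop X) U"
  proof (subst openin_subopen, intro ballI)
    fix p assume "p \<in> U"
    then obtain x where x: "p = \<pi> x" "x \<in> \<pi> -` U"
      using U by auto
    define g where "g = (\<lambda>(z, w). (\<alpha> * Im z, \<alpha> * Re z, \<beta> * Re w))"
    \<comment> \<open>The second set bounds the discrepancy of the base coordinates by a period, so
      that \<open>base_eq\<close> applies to every point of the fibre product represented in
      \<open>O'\<close>.\<close>
    define O' where "O' = g -` (\<pi> -` U) \<inter> {(z, w). \<bar>\<alpha> * Im z - \<beta> * Im w\<bar> < \<eta>}"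
    have "open (g -` (\<pi> -` U))"
      using U unfolding g_def case_prod_unfold
      by (intro open_vimage continuous_intros) auto
    moreover have "open {(z, w). \<bar>\<alpha> * Im z - \<beta> * Im w\<bar> < \<eta>}"
      unfolding case_prod_unfold by (intro open_Collect_less continuous_intros)
    ultimately have "open O'"
      unfolding O'_def by (rule open_Int)
    have "(lift1 \<tau> t x, lift2 \<tau> t x) \<in> O'"
      using x(2) pos(3) by (cases x) (simp add: O'_def g_def lift1_def lift2_def cancel)
    then obtain A C where AC: "open A" "open C" "lift1 \<tau> t x \<in> A" "lift2 \<tau> t x \<in> C" "A \<times> C \<subseteq> O'"
      using \<open>open O'\<close> by (auto elim: open_prod_elim)
    define T where "T = (coset (lattice \<tau> 1) ` A \<times> coset (lattice t 1) ` C) \<inter> topspace (mtop X)"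
    have "openin (mtop X) T"
    proof -
      have "openin (prod_topology (mtop (E_mfd \<tau>)) (mtop (E_mfd t)))
          (coset (lattice \<tau> 1) ` A \<times> coset (lattice t 1) ` C)"
        using E.open_image[OF AC(1)] E'.open_image[OF AC(2)] by (simp add: openin_prod_Times_iff)
      then have "openin (mtop X) (topspace (mtop X) \<inter> (coset (lattice \<tau> 1) ` A \<times> coset (lattice t 1) ` C))"
        by (auto simp: X_mfd_def openin_subtopology_alt topspace_subtopology Int_assoc[symmetric]
            dest: openin_subset)
      then show ?thesis
        by (simp only: T_def Int_commute)
    qed
    moreover have "p \<in> T"
      using AC x(1) by (auto simp: T_def topspace_X X_param_lift)
    moreover have "q \<in> U" if "q \<in> T" for q
    proof -
      obtain z w where q: "q = (coset (lattice \<tau> 1) z, coset (lattice t 1) w)" "(z, w) \<in> O'"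
        using \<open>q \<in> T\<close> AC(5) by (auto simp: T_def)
      have "E_to_base \<tau> t (fst q) = E_to_base t \<tau> (snd q)"
        using \<open>q \<in> T\<close> E_to_base_X_param by (auto simp: T_def topspace_X)
      then have "\<alpha> * Im z = \<beta> * Im w"
        using q by (intro base_eq) (auto simp: O'_def)
      then have "\<pi> (g (z, w)) = q"
        unfolding g_def prod.case q(1) by (rule X_param_eqI)
      then show ?thesis
        using q(2) by (auto simp: O'_def)
    qed
    ultimately show "\<exists>T. openin (mtop X) T \<and> p \<in> T \<and> T \<subseteq> U"
      by blast
  qed
qed

sublocale X: discrete_quotient X \<pi> \<Lambda> "X_radius \<tau> t"
proof
  show "charts X = {(V, \<pi>) |V. open V \<and> inj_on \<pi> V}"
    by (simp add: X_mfd_def)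
  show "\<pi> x = \<pi> x' \<longleftrightarrow> x - x' \<in> \<Lambda>" for x x'
    by (simp add: X_param_lift E.eq_iff E'.eq_iff mem_X_lattice_iff linear_diff[OF linear_lift1]
        linear_diff[OF linear_lift2])
  show "0 < X_radius \<tau> t"
    using pos by (simp add: X_radius_def)
  fix l assume "l \<in> \<Lambda>" "l \<noteq> 0"
  then obtain m n k :: int
    where l: "l = (m * \<eta>, \<alpha> * (m * Re \<tau> + n), \<beta> * (m * Re t + k))"
    by (auto simp: X_lattice_def)
  have int_le: "c \<le> \<bar>c * real_of_int i\<bar>" if "0 < c" "i \<noteq> 0" for c and i :: int
    using that mult_left_mono[of 1 "\<bar>real_of_int i\<bar>" c] by (simp add: abs_mult)
  have norms: "\<bar>fst l\<bar> \<le> norm l" "\<bar>fst (snd l)\<bar> \<le> norm l" "\<bar>snd (snd l)\<bar> \<le> norm l"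
    using norm_fst_le[of "fst l" "snd l"] norm_snd_le[of "snd l" "fst l"]
      norm_fst_le[of "fst (snd l)" "snd (snd l)"] norm_snd_le[of "snd (snd l)" "fst (snd l)"]
    by auto
  have "\<not> (m = 0 \<and> n = 0 \<and> k = 0)"
    using \<open>l \<noteq> 0\<close> l by (auto simp: zero_prod_def)
  then consider "m \<noteq> 0" | "m = 0" "n \<noteq> 0" | "m = 0" "k \<noteq> 0"
    by blast
  then show "X_radius \<tau> t \<le> norm l"
  proof cases
    case 1
    then show ?thesis
      using norms(1) int_le[OF pos(3), of m] l by (simp add: X_radius_def mult.commute)
  next
    case 2
    then show ?thesis
      using norms(2) int_le[OF pos(1), of n] l by (simp add: X_radius_def)
  next
    case 3
    then show ?thesis
      using norms(3) int_le[OF pos(2), of k] l by (simp add: X_radius_def)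
  qed
qed (rule openin_X_iff)

end

section \<open>The tensors in flat coordinates\<close>

text \<open>In coordinates \<open>(y, a, b)\<close> numbered 0, 1, 2 this is
  \<open>dy \<and> da\<close>; \<open>wedge02\<close> and \<open>wedge12\<close> are
  \<open>dy \<and> db\<close> and \<open>da \<and> db\<close>.\<close>

definition wedge01 :: "real \<times> real \<times> real \<Rightarrow> real \<times> real \<times> real \<Rightarrow> real" where
  "wedge01 u v = fst u * fst (snd v) - fst (snd u) * fst v"

definition wedge02 :: "real \<times> real \<times> real \<Rightarrow> real \<times> real \<times> real \<Rightarrow> real" where
  "wedge02 u v = fst u * snd (snd v) - snd (snd u) * fst v"

definition wedge12 :: "real \<times> real \<times> real \<Rightarrow> real \<times> real \<times> real \<Rightarrow> real" where
  "wedge12 u v = fst (snd u) * snd (snd v) - snd (snd u) * fst (snd v)"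

lemma linear_wedge:
  "linear (wedge01 u)" "linear (\<lambda>u. wedge01 u v)"
  "linear (wedge02 u)" "linear (\<lambda>u. wedge02 u v)"
  "linear (wedge12 u)" "linear (\<lambda>u. wedge12 u v)"
  by (auto intro!: linearI simp: wedge01_def wedge02_def wedge12_def algebra_simps)

lemma wedge_self: "wedge01 u u = 0" "wedge02 u u = 0" "wedge12 u u = 0"
  by (simp_all add: wedge01_def wedge02_def wedge12_def)

text \<open>The hypotheses are the contractions of \<open>v* \<and> w1*\<close> and
  \<open>v* \<and> w2*\<close> with the frame vectors. On the standard basis they force every
  component except the first of \<open>v\<close> to be zero or determined by it. Both the
  choice-independence of \<open>omega_D\<close> and the rigidity of isomorphisms rest on
  this.\<close>

lemma frame_unique:
  assumes "\<And>b. wedge01 v b = w1 \<bullet> b" "\<And>b. wedge01 w1 b = - (v \<bullet> b)"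
    and "\<And>b. wedge02 v b = w2 \<bullet> b" "\<And>b. wedge02 w2 b = - (v \<bullet> b)"
    and "v \<bullet> v = 1"
  obtains s :: real where "s * s = 1" "v = (s, 0, 0)" "w1 = (0, s, 0)" "w2 = (0, 0, s)"
proof -
  obtain v0 v1 v2 a0 a1 a2 b0 b1 b2 where eqs:
    "v = (v0, v1, v2)" "w1 = (a0, a1, a2)" "w2 = (b0, b1, b2)"
    by (metis prod.exhaust)
  have "a0 = - v1" "a1 = v0" "a2 = 0" "v2 = 0" "b0 = - v2" "b1 = 0" "b2 = v0" "v1 = 0"
    using assms(1)[of "(1, 0, 0)"] assms(1)[of "(0, 1, 0)"] assms(1)[of "(0, 0, 1)"]
      assms(2)[of "(1, 0, 0)"] assms(2)[of "(0, 1, 0)"] assms(2)[of "(0, 0, 1)"]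
      assms(3)[of "(1, 0, 0)"] assms(3)[of "(0, 1, 0)"] assms(3)[of "(0, 0, 1)"]
      assms(4)[of "(1, 0, 0)"] assms(4)[of "(0, 1, 0)"] assms(4)[of "(0, 0, 1)"]
    by (simp_all add: wedge01_def wedge02_def eqs)
  with assms(5) show ?thesis
    using that[of v0] eqs by simp
qed

lemma lift_simps:
  "Re (lift1 \<tau> t u) = sqrt (Im \<tau> / Im t) * fst (snd u)" "Im (lift1 \<tau> t u) = sqrt (Im \<tau> / Im t) * fst u"
  "Re (lift2 \<tau> t u) = sqrt (Im t / Im \<tau>) * snd (snd u)" "Im (lift2 \<tau> t u) = sqrt (Im t / Im \<tau>) * fst u"
  by (simp_all add: lift1_def lift2_def split: prod.split)

text \<open>In real terms \<open>-i dz \<and> dz'\<close> is \<open>2 dy \<and> dx\<close>; this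
  sign is the reason why \<open>y\<close> is the first coordinate in the flat forms.\<close>

lemma Re_dz_dzbar: "Re (- \<i> * of_real s * dz_dzbar u v) = 2 * s * (Im u * Re v - Re u * Im v)"
  by (simp add: dz_dzbar_def algebra_simps)

lemma const_tensor2_E_kaehler:
  "const_tensor2 (E_mfd \<tau>) (E_kaehler \<tau> s)
     (\<lambda>u v. s / Im \<tau> * (Im u * Re v - Re u * Im v))"
  unfolding const_tensor2_def E_kaehler_def Re_dz_dzbar by simp

lemma const_tensor2_E_metric: "const_tensor2 (E_mfd \<tau>) (E_metric \<tau> s) (\<lambda>u v. s / Im \<tau> * (u \<bullet> v))"
  by (simp add: const_tensor2_def E_metric_def)

context two_half_planes
begin

abbreviation "XX \<equiv> X_tk \<tau> t"

lemma tk_mfd_X: "tk_mfd XX = X"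
  by (simp add: X_tk_def)

lemma pullback_fst:
  assumes "const_tensor2 (E_mfd \<tau>) \<omega> B" "c \<in> charts X"
  shows "pullback (E_mfd \<tau>) fst \<omega> c x u v = B (lift1 \<tau> t u) (lift1 \<tau> t v)"
proof -
  have "(lift1 \<tau> t has_derivative lift1 \<tau> t) (at x)"
    by (rule bounded_linear_imp_has_derivative[OF bounded_linear_lift1])
  moreover have "\<forall>\<^sub>F y in nhds x. (fst \<circ> snd c) y = coset (lattice \<tau> 1) (lift1 \<tau> t y)"
    by (simp add: X.chartD(1)[OF assms(2)] X_param_lift)
  ultimately show ?thesis
    unfolding pullback_def using assms(1) by (rule E.pull2_lift)
qed

lemma pullback_snd:
  assumes "const_tensor2 (E_mfd t) \<omega> B" "c \<in> charts X"
  shows "pullback (E_mfd t) snd \<omega> c x u v = B (lift2 \<tau> t u) (lift2 \<tau> t v)"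
proof -
  have "(lift2 \<tau> t has_derivative lift2 \<tau> t) (at x)"
    by (rule bounded_linear_imp_has_derivative[OF bounded_linear_lift2])
  moreover have "\<forall>\<^sub>F y in nhds x. (snd \<circ> snd c) y = coset (lattice t 1) (lift2 \<tau> t y)"
    by (simp add: X.chartD(1)[OF assms(2)] X_param_lift)
  ultimately show ?thesis
    unfolding pullback_def using assms(1) by (rule E'.pull2_lift)
qed

text \<open>The lift to the first curve scales by \<open>\<beta>\<close>, and
  \<open>\<beta>\<^sup>2 = Im \<tau> / Im t\<close> cancels the coefficient of the Kaehler form. The
  flat coordinates are scaled for this purpose.\<close>

lemma const_tensor2_om1: "const_tensor2 X (tk_om1 XX) wedge01"
proof -
  have "Im t / Im \<tau> * \<beta>\<^sup>2 = 1"
    using Im_tau Im_t by simp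
  moreover have "p * s\<^sup>2 = 1 \<Longrightarrow> p * ((s * a) * (s * b) - (s * c) * (s * d)) = a * b - c * d"
    for p s a b c d :: real
    by (simp add: power2_eq_square algebra_simps)
  ultimately have "Im t / Im \<tau> * (Im (lift1 \<tau> t u) * Re (lift1 \<tau> t v) -
      Re (lift1 \<tau> t u) * Im (lift1 \<tau> t v)) = wedge01 u v" for u v
    unfolding lift_simps wedge01_def by blast
  note eq = this
  show ?thesis
    unfolding const_tensor2_def X_tk_def two_kaehler.select_convs
  proof (intro ballI allI)
    fix c x u v assume "c \<in> charts X"
    then show "pullback (E_mfd \<tau>) fst (E_kaehler \<tau> (Im t)) c x u v = wedge01 u v"
      by (simp only: pullback_fst[OF const_tensor2_E_kaehler] eq)
  qed
qed

lemma const_tensor2_om2: "const_tensor2 X (tk_om2 XX) wedge02"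
proof -
  have "Im \<tau> / Im t * \<alpha>\<^sup>2 = 1"
    using Im_tau Im_t by simp
  moreover have "p * s\<^sup>2 = 1 \<Longrightarrow> p * ((s * a) * (s * b) - (s * c) * (s * d)) = a * b - c * d"
    for p s a b c d :: real
    by (simp add: power2_eq_square algebra_simps)
  ultimately have "Im \<tau> / Im t * (Im (lift2 \<tau> t u) * Re (lift2 \<tau> t v) -
      Re (lift2 \<tau> t u) * Im (lift2 \<tau> t v)) = wedge02 u v" for u v
    unfolding lift_simps wedge02_def by blast
  note eq = this
  show ?thesis
    unfolding const_tensor2_def X_tk_def two_kaehler.select_convs
  proof (intro ballI allI)
    fix c x u v assume "c \<in> charts X"
    then show "pullback (E_mfd t) snd (E_kaehler t (Im \<tau>)) c x u v = wedge02 u v"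
      by (simp only: pullback_snd[OF const_tensor2_E_kaehler] eq)
  qed
qed

text \<open>Both curves contribute the base direction, so the induced metric is
  \<open>2 dy\<^sup>2 + da\<^sup>2 + db\<^sup>2\<close>. The factor 1/2 in \<open>X_metric\<close>
  undoes this doubling.\<close>

lemma X_metric'_eq:
  assumes "c \<in> charts X"
  shows "X_metric' \<tau> t c x = (\<lambda>u v. u \<bullet> v + fst u * fst v)"
proof (intro ext)
  fix u v
  have scale: "p * s\<^sup>2 = 1 \<Longrightarrow> p * ((s * a) * (s * b) + (s * c) * (s * d)) = a * b + c * d"
    for p s a b c d :: real
    by (simp add: power2_eq_square algebra_simps)
  have "Im t / Im \<tau> * \<beta>\<^sup>2 = 1"
    using Im_tau Im_t by simp
  then have "Im t / Im \<tau> * (lift1 \<tau> t u \<bullet> lift1 \<tau> t v) = fst (snd u) * fst (snd v) + fst u * fst v"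
    unfolding inner_complex_def lift_simps by (rule scale)
  moreover have "Im \<tau> / Im t * \<alpha>\<^sup>2 = 1"
    using Im_tau Im_t by simp
  then have "Im \<tau> / Im t * (lift2 \<tau> t u \<bullet> lift2 \<tau> t v) = snd (snd u) * snd (snd v) + fst u * fst v"
    unfolding inner_complex_def lift_simps by (rule scale)
  ultimately show "X_metric' \<tau> t c x u v = u \<bullet> v + fst u * fst v"
    unfolding X_metric'_def pullback_fst[OF const_tensor2_E_metric assms]
      pullback_snd[OF const_tensor2_E_metric assms]
    by (simp add: inner_prod_def)
qed

lemma X_ker_dF_eq:
  assumes "c \<in> charts X"
  shows "X_ker_dF \<tau> t c x = {u. fst u = 0}"
proof -
  have "tderiv (base_mfd \<tau> t) (E_to_base \<tau> t \<circ> fst \<circ> snd c) x u = fst u" for u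
    by (rule B.tderiv_lift[OF bounded_linear_imp_has_derivative[OF bounded_linear_fst]])
      (simp add: X.chartD(1)[OF assms] E_to_base_X_param)
  then show ?thesis
    by (simp add: X_ker_dF_def)
qed

lemma const_tensor2_met: "const_tensor2 X (tk_met XX) (\<bullet>)"
proof -
  have proj: "orth_proj (\<lambda>u v. u \<bullet> v + fst u * fst v) {u. fst u = 0} u = (0, snd u)"
    for u :: "real \<times> real \<times> real"
    unfolding orth_proj_def
  proof (rule the_equality)
    show "(0, snd u) \<in> {u. fst u = 0} \<and> (\<forall>w\<in>{u. fst u = 0}.
        (u - (0, snd u)) \<bullet> w + fst (u - (0, snd u)) * fst w = 0)"
      by (simp add: inner_prod_def)
  next
    fix k :: "real \<times> real \<times> real"
    assume k: "k \<in> {u. fst u = 0} \<and> (\<forall>w\<in>{u. fst u = 0}. (u - k) \<bullet> w + fst (u - k) * fst w = 0)"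
    \<comment> \<open>Orthogonality is tested on the tangential part of \<open>u - k\<close> itself,
      which must therefore have norm zero.\<close>
    then have "(u - k) \<bullet> (0, snd u - snd k) + fst (u - k) * fst (0::real, snd u - snd k) = 0"
      by (intro bspec[OF conjunct2[OF k]]) simp
    then have "(snd u - snd k) \<bullet> (snd u - snd k) = 0"
      by (simp add: inner_prod_def)
    with k show "k = (0, snd u)"
      by (simp add: prod_eq_iff)
  qed
  have "X_metric \<tau> t c x u v = u \<bullet> v" if "c \<in> charts X" for c x u v
    unfolding X_metric_def X_metric'_eq[OF that] X_ker_dF_eq[OF that] proj Let_def
    by (simp add: inner_prod_def algebra_simps)
  then show ?thesis
    by (simp add: const_tensor2_def X_tk_def)
qed

lemma tk_iso_refl: "tk_iso XX XX"
  unfolding tk_iso_def tk_mfd_X using X.diffeo_id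
    X.pullback_id[OF const_tensor2_om1] X.pullback_id[OF const_tensor2_om2]
    X.pullback_id[OF const_tensor2_met]
  by (intro exI[of _ id]) simp

text \<open>The kernel of \<open>dy \<and> da\<close> is the \<open>b\<close>-axis and that of
  \<open>dy \<and> db\<close> the \<open>a\<close>-axis; together they span the plane
  \<open>dy = 0\<close>.\<close>

lemma leaf_dist_X:
  assumes "c \<in> charts X" "x \<in> cdom c"
  shows "leaf_dist XX c x = {u. fst u = 0}"
proof -
  have "perp (tk_om1 XX) c x = {v. fst v = 0 \<and> fst (snd v) = 0}"
    unfolding perp_def const_tensor2D[OF const_tensor2_om1 assms]
  proof (intro equalityI subsetI CollectI)
    fix v assume "v \<in> {v. \<forall>u. wedge01 v u = 0}"
    then have "wedge01 v (1, 0, 0) = 0" "wedge01 v (0, 1, 0) = 0"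
      by blast+
    then show "fst v = 0 \<and> fst (snd v) = 0"
      by (simp add: wedge01_def)
  qed (simp add: wedge01_def)
  moreover have "perp (tk_om2 XX) c x = {v. fst v = 0 \<and> snd (snd v) = 0}"
    unfolding perp_def const_tensor2D[OF const_tensor2_om2 assms]
  proof (intro equalityI subsetI CollectI)
    fix v assume "v \<in> {v. \<forall>u. wedge02 v u = 0}"
    then have "wedge02 v (1, 0, 0) = 0" "wedge02 v (0, 0, 1) = 0"
      by blast+
    then show "fst v = 0 \<and> snd (snd v) = 0"
      by (simp add: wedge02_def)
  qed (simp add: wedge02_def)
  moreover have "\<exists>v w. u = v + w \<and> (fst v = 0 \<and> fst (snd v) = 0) \<and> fst w = 0 \<and> snd (snd w) = 0"
    if "fst u = 0" for u :: "real \<times> real \<times> real"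
    using that by (intro exI[of _ "(0, 0, snd (snd u))"] exI[of _ "(0, fst (snd u), 0)"])
      (simp add: prod_eq_iff)
  ultimately show ?thesis
    unfolding leaf_dist_def by auto
qed

text \<open>The parameter \<open>n\<close> is \<open>DIM(real) = 1\<close>, so only the vectors with
  index 0 matter.\<close>

lemma adapted_basis_X_iff:
  assumes "c \<in> charts X" "x \<in> cdom c"
  shows "adapted_basis XX c x v w1 w2 \<longleftrightarrow>
    v 0 \<bullet> v 0 = 1 \<and> w1 0 \<bullet> w1 0 = 1 \<and> w2 0 \<bullet> w2 0 = 1 \<and>
    v 0 \<bullet> w1 0 = 0 \<and> v 0 \<bullet> w2 0 = 0 \<and> w1 0 \<bullet> w2 0 = 0 \<and>
    wedge01 = (\<lambda>a b. (v 0 \<bullet> a) * (w1 0 \<bullet> b) - (v 0 \<bullet> b) * (w1 0 \<bullet> a)) \<and>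
    wedge02 = (\<lambda>a b. (v 0 \<bullet> a) * (w2 0 \<bullet> b) - (v 0 \<bullet> b) * (w2 0 \<bullet> a))"
  unfolding adapted_basis_def const_tensor2D[OF const_tensor2_om1 assms]
    const_tensor2D[OF const_tensor2_om2 assms] const_tensor2D[OF const_tensor2_met assms]
  by (simp add: Let_def wedge_sum_def[abs_def])

lemma adapted_basis_X:
  assumes "c \<in> charts X" "x \<in> cdom c"
  shows "adapted_basis XX c x (\<lambda>i. (1, 0, 0)) (\<lambda>i. (0, 1, 0)) (\<lambda>i. (0, 0, 1))"
  unfolding adapted_basis_X_iff[OF assms]
  by (auto simp: wedge01_def wedge02_def fun_eq_iff)

lemma adapted_basis_X_unique:
  assumes "c \<in> charts X" "x \<in> cdom c" "adapted_basis XX c x v w1 w2"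
  obtains s :: real where "s * s = 1" "v 0 = (s, 0, 0)" "w1 0 = (0, s, 0)" "w2 0 = (0, 0, s)"
proof -
  note * = assms(3)[unfolded adapted_basis_X_iff[OF assms(1,2)]]
  have "wedge01 a b = (v 0 \<bullet> a) * (w1 0 \<bullet> b) - (v 0 \<bullet> b) * (w1 0 \<bullet> a)"
    "wedge02 a b = (v 0 \<bullet> a) * (w2 0 \<bullet> b) - (v 0 \<bullet> b) * (w2 0 \<bullet> a)" for a b
    using * by meson+
  moreover have "w1 0 \<bullet> v 0 = 0" "w2 0 \<bullet> v 0 = 0"
    using * by (simp_all add: inner_commute)
  ultimately have "wedge01 (v 0) b = w1 0 \<bullet> b" "wedge01 (w1 0) b = - (v 0 \<bullet> b)"
    "wedge02 (v 0) b = w2 0 \<bullet> b" "wedge02 (w2 0) b = - (v 0 \<bullet> b)" for b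
    using * by simp_all
  from frame_unique[OF this] * show ?thesis
    using that by blast
qed

text \<open>Whatever adapted basis is chosen, it is the standard one times a common sign, and the
  sign enters \<open>w1* \<and> w2*\<close> twice.\<close>

lemma const_tensor2_omega_D: "const_tensor2 X (omega_D XX) wedge12"
  unfolding const_tensor2_def
proof (intro ballI allI)
  fix c x u w assume cx: "c \<in> charts X" "x \<in> cdom c"
  define b where "b = (SOME (v, w1, w2). adapted_basis XX c x v w1 w2)"
  have "case b of (v, w1, w2) \<Rightarrow> adapted_basis XX c x v w1 w2"
    unfolding b_def by (rule someI_ex) (use adapted_basis_X[OF cx] in auto)
  moreover obtain v w1 w2 where b: "b = (v, w1, w2)"
    using prod_cases3 by blast
  ultimately have "adapted_basis XX c x v w1 w2"
    by simp
  from adapted_basis_X_unique[OF cx this] obtain s :: real where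
    s: "s * s = 1" "w1 0 = (0, s, 0)" "w2 0 = (0, 0, s)"
    by metis
  have "omega_D XX c x u w = (s * s) * wedge12 u w"
    unfolding omega_D_def b_def[symmetric] b
    by (simp add: wedge_sum_def const_tensor2D[OF const_tensor2_met cx] s(2,3) wedge12_def
        inner_prod_def algebra_simps)
  then show "omega_D XX c x u w = wedge12 u w"
    by (simp add: s(1))
qed

end

section \<open>Isomorphisms determine the lattice\<close>

lemma rigid_linear:
  fixes A :: "real \<times> real \<times> real \<Rightarrow> real \<times> real \<times> real"
  assumes "linear A" "\<And>u v. wedge01 (A u) (A v) = wedge01 u v"
    "\<And>u v. wedge02 (A u) (A v) = wedge02 u v" "\<And>u v. A u \<bullet> A v = u \<bullet> v"
  obtains s where "s * s = 1" "A = (\<lambda>u. s *\<^sub>R u)"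
proof -
  have "norm (A u) = norm u" for u
    by (simp add: norm_eq_sqrt_inner assms(4))
  then have "inj A"
    using assms(1) by (metis linear_injective_0 norm_eq_zero)
  then have surj: "surj A"
    using linear_injective_imp_surjective assms(1) by blast
  \<comment> \<open>The relations of \<open>frame_unique\<close> are to hold for all
    \<open>b\<close>. Since \<open>A\<close> is surjective they may be tested on vectors
    \<open>A u\<close>, where they reduce to relations of the standard basis.\<close>
  have pull: "P b" if "\<And>u. P (A u)" for P b
    using that surj by (metis surjD)
  obtain s where s: "s * s = 1" "A (1, 0, 0) = (s, 0, 0)" "A (0, 1, 0) = (0, s, 0)" "A (0, 0, 1) = (0, 0, s)"
  proof (rule frame_unique)
    show "wedge01 (A (1, 0, 0)) b = A (0, 1, 0) \<bullet> b" for b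
      by (rule pull) (simp add: assms(2,4), simp add: wedge01_def inner_prod_def)
    show "wedge01 (A (0, 1, 0)) b = - (A (1, 0, 0) \<bullet> b)" for b
      by (rule pull) (simp add: assms(2,4), simp add: wedge01_def inner_prod_def)
    show "wedge02 (A (1, 0, 0)) b = A (0, 0, 1) \<bullet> b" for b
      by (rule pull) (simp add: assms(3,4), simp add: wedge02_def inner_prod_def)
    show "wedge02 (A (0, 0, 1)) b = - (A (1, 0, 0) \<bullet> b)" for b
      by (rule pull) (simp add: assms(3,4), simp add: wedge02_def inner_prod_def)
    show "A (1, 0, 0) \<bullet> A (1, 0, 0) = 1"
      by (simp add: assms(4))
  qed
  have "A u = s *\<^sub>R u" for u
  proof -
    obtain x y z where u: "u = (x, y, z)"
      using prod_cases3 by blast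
    then have "u = x *\<^sub>R (1, 0, 0) + y *\<^sub>R (0, 1, 0) + z *\<^sub>R (0, 0, 1)"
      by simp
    then have "A u = x *\<^sub>R A (1, 0, 0) + y *\<^sub>R A (0, 1, 0) + z *\<^sub>R A (0, 0, 1)"
      by (simp only: linear_add[OF assms(1)] linear_scale[OF assms(1)])
    then show ?thesis
      by (simp add: s u)
  qed
  then show ?thesis
    using that s(1) by blast
qed

text \<open>In a chart the derivative of the map is plus or minus the identity by
  \<open>rigid_linear\<close>. The sign depends continuously on the point and is thus constant on a
  ball, where the map is then affine.\<close>

lemma tk_iso_local:
  assumes "two_half_planes \<tau> t" "two_half_planes \<tau>' t'"
    and "smooth_map (X_mfd \<tau> t) (X_mfd \<tau>' t') \<phi>"
    and om1: "\<And>c x u v. c \<in> charts (X_mfd \<tau> t) \<Longrightarrow> x \<in> cdom c \<Longrightarrow>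
      pullback (X_mfd \<tau>' t') \<phi> (tk_om1 (X_tk \<tau>' t')) c x u v = wedge01 u v"
    and om2: "\<And>c x u v. c \<in> charts (X_mfd \<tau> t) \<Longrightarrow> x \<in> cdom c \<Longrightarrow>
      pullback (X_mfd \<tau>' t') \<phi> (tk_om2 (X_tk \<tau>' t')) c x u v = wedge02 u v"
    and met: "\<And>c x u v. c \<in> charts (X_mfd \<tau> t) \<Longrightarrow> x \<in> cdom c \<Longrightarrow>
      pullback (X_mfd \<tau>' t') \<phi> (tk_met (X_tk \<tau>' t')) c x u v = u \<bullet> v"
  shows "\<exists>s c S. s * s = 1 \<and> open S \<and> x \<in> S \<and>
    (\<forall>y\<in>S. \<phi> (X_param \<tau> t y) = X_param \<tau>' t' (s *\<^sub>R y + c))"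
proof -
  interpret Y: two_half_planes \<tau> t by (rule assms(1))
  interpret Z: two_half_planes \<tau>' t' by (rule assms(2))
  define f where "f = \<phi> \<circ> X_param \<tau> t"
  define k where "k = (ball x (X_radius \<tau> t / 2), X_param \<tau> t)"
  have k: "k \<in> charts (X_mfd \<tau> t)" "snd k = X_param \<tau> t" "cdom k = ball x (X_radius \<tau> t / 2)"
    using Y.X.chart_ball by (simp_all add: k_def cdom_def)
  have "smooth_into (X_mfd \<tau>' t') (cdom k) (\<phi> \<circ> snd k)"
    using assms(3) k(1) unfolding smooth_map_def by blast
  then have smooth: "smooth_into (X_mfd \<tau>' t') (cdom k) f"
    by (simp add: f_def k(2))
  have x: "x \<in> cdom k"
    using Y.X.r_pos by (simp add: k(3))
  have cont: "continuous_map (top_of_set (cdom k)) (mtop (X_mfd \<tau>' t')) f"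
    using smooth by (simp add: smooth_into_def)
  then have "f x \<in> range (X_param \<tau>' t')"
    using x continuous_map_funspace[OF cont] by (auto simp: Z.topspace_X)
  then obtain d where d: "d \<in> charts (X_mfd \<tau>' t')" "f x \<in> cimg d"
    using Z.X.chart_at by blast
  define U where "U = {y \<in> cdom k. f y \<in> cimg d}"
  define G where "G = cinv d \<circ> f"
  have "openin (top_of_set (cdom k)) U"
    using openin_continuous_map_preimage[OF cont Z.X.cimg_open[OF d(1)]] by (simp add: U_def)
  then have "open U"
    using k(3) by (simp add: openin_open_eq)
  moreover have "x \<in> U"
    using x d(2) by (simp add: U_def)
  ultimately obtain e where e: "0 < e" "ball x e \<subseteq> U"
    using open_contains_ball by blast
  have smoothG: "smooth_on U G"
    using smooth d(1) by (simp add: smooth_into_def U_def G_def)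
  have lift: "f y = X_param \<tau>' t' (G y)" if "y \<in> U" for y
    using Z.X.cinv_mem(2)[OF d(1)] that by (simp add: U_def G_def)
  have deriv: "\<exists>s. s * s = 1 \<and> frechet_derivative G (at y) = (\<lambda>u. s *\<^sub>R u)" if "y \<in> U" for y
  proof -
    have G': "(G has_derivative frechet_derivative G (at y)) (at y)"
      by (rule smooth_on_has_derivative[OF smoothG that])
    have ev: "\<forall>\<^sub>F z in nhds y. f z = X_param \<tau>' t' (G z)"
      using eventually_nhds_in_open[OF \<open>open U\<close> that] by eventually_elim (rule lift)
    have y: "y \<in> cdom k"
      using that by (simp add: U_def)
    have "wedge01 (frechet_derivative G (at y) u) (frechet_derivative G (at y) v) = wedge01 u v" for u v
      using om1[OF k(1) y, of u v]
      unfolding pullback_def k(2) f_def[symmetric] Z.X.pull2_lift[OF G' ev Z.const_tensor2_om1] .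
    moreover
    have "wedge02 (frechet_derivative G (at y) u) (frechet_derivative G (at y) v) = wedge02 u v" for u v
      using om2[OF k(1) y, of u v]
      unfolding pullback_def k(2) f_def[symmetric] Z.X.pull2_lift[OF G' ev Z.const_tensor2_om2] .
    moreover
    have "frechet_derivative G (at y) u \<bullet> frechet_derivative G (at y) v = u \<bullet> v" for u v
      using met[OF k(1) y, of u v]
      unfolding pullback_def k(2) f_def[symmetric] Z.X.pull2_lift[OF G' ev Z.const_tensor2_met] .
    ultimately show ?thesis
      using rigid_linear[OF has_derivative_linear[OF G']] by blast
  qed
  \<comment> \<open>Reads the sign off the derivative by a formula, so that its continuity is
    inherited from that of the derivative.\<close>
  define s where "s = (\<lambda>y. fst (frechet_derivative G (at y) (1, 0, 0)))"
  have s: "s y * s y = 1" "frechet_derivative G (at y) = (\<lambda>u. s y *\<^sub>R u)" if "y \<in> U" for y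
    using deriv[OF that] by (auto simp: s_def)
  have "continuous_on (ball x e) s"
    unfolding s_def
    by (intro continuous_on_fst continuous_on_subset[OF smooth_on_continuous_derivative[OF smoothG] e(2)])
  moreover have "s ` ball x e \<subseteq> {1, -1}"
  proof (rule image_subsetI)
    fix y assume "y \<in> ball x e"
    then have "s y * s y = 1"
      using s(1) e(2) by blast
    then show "s y \<in> {1, -1}"
      by (simp add: square_eq_1_iff)
  qed
  then have "finite (s ` ball x e)"
    by (rule finite_subset) simp
  ultimately have "s constant_on ball x e"
    by (rule continuous_finite_range_constant[OF connected_ball])
  then have const: "s y = s x" if "y \<in> ball x e" for y
    using that e(1) unfolding constant_on_def by (metis centre_in_ball)
  have "((\<lambda>y. G y - s x *\<^sub>R y) has_derivative (\<lambda>h. 0)) (at y within ball x e)"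
    if y: "y \<in> ball x e" for y
  proof -
    have "y \<in> U"
      using e(2) y by blast
    then have "(G has_derivative (\<lambda>u. s x *\<^sub>R u)) (at y within ball x e)"
      using smooth_on_has_derivative[OF smoothG] s(2) const[OF y] has_derivative_at_withinI by metis
    then have "((\<lambda>y. G y - s x *\<^sub>R y) has_derivative (\<lambda>h. s x *\<^sub>R h - s x *\<^sub>R h)) (at y within ball x e)"
      by (intro has_derivative_diff has_derivative_scaleR_right has_derivative_ident)
    then show ?thesis
      by simp
  qed
  from has_derivative_zero_constant[OF convex_ball this]
  obtain c where "\<forall>y\<in>ball x e. G y - s x *\<^sub>R y = c"
    by blast
  then have "G y = s x *\<^sub>R y + c" if "y \<in> ball x e" for y
    using that by (simp add: algebra_simps)
  then have "\<phi> (X_param \<tau> t y) = X_param \<tau>' t' (s x *\<^sub>R y + c)" if "y \<in> ball x e" for y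
    using lift[of y] that e(2) by (auto simp: f_def)
  then show ?thesis
    using e(1) s(1)[OF \<open>x \<in> U\<close>] by (intro exI[of _ "s x"] exI[of _ c] exI[of _ "ball x e"]) simp
qed

text \<open>In place of a lifting theorem for coverings, the affine formula found at the origin is
  continued: the points near which it holds with fixed \<open>s\<close> and \<open>c\<close> form an
  open and closed subset of the connected parameter space.\<close>

lemma tk_iso_lattice_eq:
  assumes "two_half_planes \<tau> t" "two_half_planes \<tau>' t'" "tk_iso (X_tk \<tau> t) (X_tk \<tau>' t')"
  shows "X_lattice \<tau> t = X_lattice \<tau>' t'"
proof -
  interpret Y: two_half_planes \<tau> t by (rule assms(1))
  interpret Z: two_half_planes \<tau>' t' by (rule assms(2))
  obtain \<phi> where diffeo: "diffeo (X_mfd \<tau> t) (X_mfd \<tau>' t') \<phi>"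
    and pull: "\<And>c x u v. c \<in> charts (X_mfd \<tau> t) \<Longrightarrow> x \<in> cdom c \<Longrightarrow>
      pullback (X_mfd \<tau>' t') \<phi> (tk_om1 (X_tk \<tau>' t')) c x u v = tk_om1 (X_tk \<tau> t) c x u v \<and>
      pullback (X_mfd \<tau>' t') \<phi> (tk_om2 (X_tk \<tau>' t')) c x u v = tk_om2 (X_tk \<tau> t) c x u v \<and>
      pullback (X_mfd \<tau>' t') \<phi> (tk_met (X_tk \<tau>' t')) c x u v = tk_met (X_tk \<tau> t) c x u v"
    using assms(3) unfolding tk_iso_def Y.tk_mfd_X Z.tk_mfd_X by blast
  have inj: "inj_on \<phi> (range (X_param \<tau> t))"
    using diffeo unfolding diffeo_def homeomorphic_maps_def Y.topspace_X by (metis inj_on_def)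
  define P where "P = (\<lambda>s c x. \<exists>S. open S \<and> x \<in> S \<and>
    (\<forall>y\<in>S. \<phi> (X_param \<tau> t y) = X_param \<tau>' t' (s *\<^sub>R y + c)))"
  have local: "\<exists>s c. s * s = 1 \<and> P s c x" for x
    unfolding P_def
    using tk_iso_local[OF assms(1,2), of \<phi> x] diffeo pull
    by (simp add: diffeo_def const_tensor2D[OF Y.const_tensor2_om1] const_tensor2D[OF Y.const_tensor2_om2]
        const_tensor2D[OF Y.const_tensor2_met])
  obtain s c where s: "s * s = 1" and "P s c 0"
    using local by blast
  \<comment> \<open>If two local formulas overlap at \<open>z\<close>, they have the same sign and
    their constants differ by a lattice vector. So the formula with \<open>s\<close> and
    \<open>c\<close> spreads from \<open>z\<close> to all of \<open>S\<close>, which also shows that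
    its failure is an open condition.\<close>
  have ext: "P s c x" if P': "s' * s' = 1" "open S" "x \<in> S" "z \<in> S" "P s c z"
      and eq: "\<forall>y\<in>S. \<phi> (X_param \<tau> t y) = X_param \<tau>' t' (s' *\<^sub>R y + c')" for s' c' S x z
  proof -
    obtain S' where S': "open S'" "z \<in> S'" "\<forall>y\<in>S'. \<phi> (X_param \<tau> t y) = X_param \<tau>' t' (s *\<^sub>R y + c)"
      using P'(5) unfolding P_def by blast
    have mem: "(s' *\<^sub>R y + c') - (s *\<^sub>R y + c) \<in> X_lattice \<tau>' t'" if "y \<in> S \<inter> S'" for y
      unfolding Z.X.eq_iff[symmetric] using that eq S'(3) by (metis IntE)
    have "s' = s"
    proof (rule ccontr)
      assume "s' \<noteq> s"
      obtain e where e: "0 < e" "ball z e \<subseteq> S \<inter> S'"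
        using P'(2,4) S'(1,2) open_contains_ball[of "S \<inter> S'"] by blast
      \<comment> \<open>Comparing the formulas at \<open>z\<close> and \<open>z + h\<close> puts
        \<open>(s' - s) *\<^sub>R h\<close> into the lattice. With \<open>\<delta>\<close> below
        \<open>e\<close> both points lie in the overlap, and the vector has length at most
        \<open>2 * \<delta>\<close>, too short for a nonzero lattice vector.\<close>
      define \<delta> where "\<delta> = min (e / 2) (X_radius \<tau>' t' / 4)"
      have \<delta>: "0 < \<delta>" "\<delta> < e" "2 * \<delta> < X_radius \<tau>' t'"
        using e(1) Z.X.r_pos by (auto simp: \<delta>_def)
      define h :: "real \<times> real \<times> real" where "h = (\<delta>, 0, 0)"
      have "norm h = \<delta>"
        using \<delta>(1) by (simp add: h_def norm_Pair)
      then have "z + h \<in> S \<inter> S'"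
        using e(2) \<delta>(2) by (auto simp: dist_norm)
      from Z.X.diff_mem[OF mem[OF this] mem[of z]] P'(4) S'(2)
      have "(s' - s) *\<^sub>R h \<in> X_lattice \<tau>' t'"
        by (simp add: algebra_simps)
      moreover have "(s' - s) *\<^sub>R h \<noteq> 0"
        using \<open>s' \<noteq> s\<close> \<delta>(1) by (simp add: h_def zero_prod_def)
      ultimately have "X_radius \<tau>' t' \<le> \<bar>s' - s\<bar> * \<delta>"
        using Z.X.r_le[of "(s' - s) *\<^sub>R h"] \<open>norm h = \<delta>\<close> by simp
      moreover have "\<bar>s' - s\<bar> \<le> 2"
        using P'(1) s by (auto simp: square_eq_1_iff)
      ultimately show False
        using \<delta> mult_right_mono[of "\<bar>s' - s\<bar>" 2 \<delta>] by linarith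
    qed
    then have "c - c' \<in> X_lattice \<tau>' t'"
      using Z.X.uminus_mem[OF mem[of z]] P'(4) S'(2) by simp
    then have "X_param \<tau>' t' (s *\<^sub>R y + c') = X_param \<tau>' t' (s *\<^sub>R y + c)" for y
      using Z.X.translate[of "c - c'" "s *\<^sub>R y + c'"] by (simp add: algebra_simps)
    then show ?thesis
      unfolding P_def using P'(2,3) eq \<open>s' = s\<close> by (intro exI[of _ S]) simp
  qed
  have "open {x. P s c x}"
  proof (rule Topological_Spaces.openI)
    fix x assume "x \<in> {x. P s c x}"
    then obtain S where "open S" "x \<in> S"
      "\<forall>y\<in>S. \<phi> (X_param \<tau> t y) = X_param \<tau>' t' (s *\<^sub>R y + c)"
      unfolding P_def by blast
    then show "\<exists>T. open T \<and> x \<in> T \<and> T \<subseteq> {x. P s c x}"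
      unfolding P_def by (intro exI[of _ S]) blast
  qed
  moreover have "open (- {x. P s c x})"
  proof (rule Topological_Spaces.openI)
    fix x assume x: "x \<in> - {x. P s c x}"
    obtain s' c' S where S: "s' * s' = 1" "open S" "x \<in> S"
      "\<forall>y\<in>S. \<phi> (X_param \<tau> t y) = X_param \<tau>' t' (s' *\<^sub>R y + c')"
      using local[of x] unfolding P_def by blast
    then have "S \<subseteq> - {x. P s c x}"
      using ext[OF S(1-3) _ _ S(4)] x by blast
    then show "\<exists>T. open T \<and> x \<in> T \<and> T \<subseteq> - {x. P s c x}"
      using S(2,3) by blast
  qed
  ultimately have "{x. P s c x} = {} \<or> {x. P s c x} = UNIV"
    unfolding clopen[symmetric] closed_def by blast
  then have "{x. P s c x} = UNIV"
    using \<open>P s c 0\<close> by blast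
  then have glob: "\<phi> (X_param \<tau> t x) = X_param \<tau>' t' (s *\<^sub>R x + c)" for x
    unfolding P_def by blast
  \<comment> \<open>Lattice vectors are the parameters with the same image as the origin.
    Injectivity of \<open>\<phi>\<close> transports this condition, and the sign \<open>s\<close>
    does not affect membership.\<close>
  have "l \<in> X_lattice \<tau> t \<longleftrightarrow> l \<in> X_lattice \<tau>' t'" for l
  proof -
    have "l \<in> X_lattice \<tau> t \<longleftrightarrow> X_param \<tau> t l = X_param \<tau> t 0"
      by (simp add: Y.X.eq_iff)
    also have "\<dots> \<longleftrightarrow> \<phi> (X_param \<tau> t l) = \<phi> (X_param \<tau> t 0)"
      using inj by (metis inj_onD rangeI)
    also have "\<dots> \<longleftrightarrow> s *\<^sub>R l \<in> X_lattice \<tau>' t'"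
      by (simp add: glob Z.X.eq_iff)
    also have "\<dots> \<longleftrightarrow> l \<in> X_lattice \<tau>' t'"
      using s Z.X.uminus_mem[of l] Z.X.uminus_mem[of "- l"] by (auto simp: square_eq_1_iff)
    finally show ?thesis .
  qed
  then show ?thesis
    by blast
qed

section \<open>Recovering the parameters from the lattice\<close>

lemma pos_int_multiples_eq:
  fixes x y :: real
  assumes "0 < x" "0 < y" "x = of_int m * y" "y = of_int n * x"
  shows "x = y" "m = 1"
proof -
  have "x = of_int (m * n) * x"
    using assms(3,4) by simp
  then have "m * n = 1"
    using assms(1) by (metis less_irrefl mult_cancel_right2 of_int_eq_1_iff)
  moreover have "0 < m"
    using assms(1-3) by (metis of_int_0_less_iff zero_less_mult_pos2)
  ultimately show "m = 1"
    by (simp add: pos_zmult_eq_1_iff)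
  then show "x = y"
    using assms(3) by simp
qed

text \<open>A lattice vector with first coordinate zero has \<open>m = 0\<close>, so
  \<open>(0, \<alpha>, 0)\<close> shows that \<open>\<alpha>\<close> is an integer multiple of its
  counterpart, and conversely; the two are equal. The generator with \<open>m = 1\<close> and
  \<open>n = k = 0\<close> gives the same for \<open>\<eta>\<close> and, in its other coordinates,
  the real parts up to integers. The imaginary parts are \<open>\<beta> * \<eta>\<close> and
  \<open>\<alpha> * \<eta>\<close>.\<close>

lemma X_lattice_eq_imp:
  assumes "two_half_planes \<tau> t" "two_half_planes \<tau>' t'" "X_lattice \<tau> t = X_lattice \<tau>' t'"
  shows "Im \<tau> = Im \<tau>'" "Im t = Im t'" "\<exists>n::int. Re \<tau> = Re \<tau>' + n" "\<exists>n::int. Re t = Re t' + n"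
proof -
  interpret Y: two_half_planes \<tau> t by (rule assms(1))
  interpret Z: two_half_planes \<tau>' t' by (rule assms(2))
  have a: "\<exists>n::int. sqrt (Im t / Im \<tau>) = of_int n * sqrt (Im t' / Im \<tau>')"
    if prems: "two_half_planes \<tau> t" "two_half_planes \<tau>' t'" "X_lattice \<tau> t = X_lattice \<tau>' t'" for \<tau> t \<tau>' t'
  proof -
    interpret W: two_half_planes \<tau>' t' by (rule prems(2))
    have "(0, sqrt (Im t / Im \<tau>), 0) \<in> X_lattice \<tau> t"
      unfolding X_lattice_def mem_Collect_eq prod.case
      by (intro exI[of _ 0] exI[of _ 1]) simp
    then obtain m n :: int where "0 = m * sqrt (Im t' * Im \<tau>')"
      "sqrt (Im t / Im \<tau>) = sqrt (Im t' / Im \<tau>') * (m * Re \<tau>' + n)"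
      unfolding prems(3) unfolding X_lattice_def mem_Collect_eq prod.case by blast
    then have "sqrt (Im t / Im \<tau>) = of_int n * sqrt (Im t' / Im \<tau>')"
      using W.Im_tau W.Im_t by simp
    then show ?thesis ..
  qed
  have h: "\<exists>m n k :: int. sqrt (Im t * Im \<tau>) = of_int m * sqrt (Im t' * Im \<tau>') \<and>
      sqrt (Im t / Im \<tau>) * Re \<tau> = sqrt (Im t' / Im \<tau>') * (of_int m * Re \<tau>' + of_int n) \<and>
      sqrt (Im \<tau> / Im t) * Re t = sqrt (Im \<tau>' / Im t') * (of_int m * Re t' + of_int k)"
    if "X_lattice \<tau> t = X_lattice \<tau>' t'" for \<tau> t \<tau>' t'
  proof -
    have "(sqrt (Im t * Im \<tau>), sqrt (Im t / Im \<tau>) * Re \<tau>, sqrt (Im \<tau> / Im t) * Re t) \<in> X_lattice \<tau> t"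
      unfolding X_lattice_def mem_Collect_eq prod.case
      by (intro exI[of _ 1] exI[of _ 0]) simp
    then show ?thesis
      unfolding that unfolding X_lattice_def mem_Collect_eq prod.case by blast
  qed
  obtain n n' :: int where "sqrt (Im t / Im \<tau>) = of_int n * sqrt (Im t' / Im \<tau>')"
    "sqrt (Im t' / Im \<tau>') = of_int n' * sqrt (Im t / Im \<tau>)"
    using a[OF assms] a[OF assms(2,1) assms(3)[symmetric]] by blast
  then have alpha: "sqrt (Im t / Im \<tau>) = sqrt (Im t' / Im \<tau>')"
    by (rule pos_int_multiples_eq(1)[OF Y.pos(1) Z.pos(1)])
  obtain m m' n k :: int where
    m: "sqrt (Im t * Im \<tau>) = of_int m * sqrt (Im t' * Im \<tau>')" and
    m': "sqrt (Im t' * Im \<tau>') = of_int m' * sqrt (Im t * Im \<tau>)" and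
    n: "sqrt (Im t / Im \<tau>) * Re \<tau> = sqrt (Im t' / Im \<tau>') * (of_int m * Re \<tau>' + of_int n)" and
    k: "sqrt (Im \<tau> / Im t) * Re t = sqrt (Im \<tau>' / Im t') * (of_int m * Re t' + of_int k)"
    using h[OF assms(3)] h[OF assms(3)[symmetric]] by blast
  note eta = pos_int_multiples_eq[OF Y.pos(3) Z.pos(3) m m']
  have beta: "sqrt (Im \<tau> / Im t) = sqrt (Im \<tau>' / Im t')"
    using Y.scale_simps(1) Z.scale_simps(1) alpha Y.pos(1) by (metis mult_left_cancel less_irrefl)
  show "Im \<tau> = Im \<tau>'"
    using Y.scale_simps(5) Z.scale_simps(5) beta eta(1) by metis
  show "Im t = Im t'"
    using Y.scale_simps(6) Z.scale_simps(6) alpha eta(1) by metis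
  have "Re \<tau> = Re \<tau>' + of_int n"
    using n Z.pos(1) unfolding alpha eta(2) by (metis mult_left_cancel less_irrefl mult_1 of_int_1)
  then show "\<exists>n::int. Re \<tau> = Re \<tau>' + n" ..
  have "Re t = Re t' + of_int k"
    using k Z.pos(2) unfolding beta eta(2) by (metis mult_left_cancel less_irrefl mult_1 of_int_1)
  then show "\<exists>n::int. Re t = Re t' + n" ..
qed

text \<open>\<open>E_ck\<close> depends on \<open>\<tau>\<close> only through the lattice and
  \<open>Im \<tau>\<close>. As the two objects are equal, \<open>ck_iso\<close> statements transfer
  by substitution.\<close>

lemma E_ck_cong:
  assumes "Im \<tau> = Im \<tau>'" "Re \<tau> = Re \<tau>' + of_int n"
  shows "E_ck \<tau> t = E_ck \<tau>' t"
proof -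
  have sub: "lattice \<tau> 1 \<subseteq> lattice \<tau>' 1" if "Im \<tau> = Im \<tau>'" "Re \<tau> = Re \<tau>' + of_int n" for \<tau> \<tau>' n
  proof
    fix z assume "z \<in> lattice \<tau> 1"
    then obtain m k :: int where "Re z = m * Re \<tau> + k" "Im z = m * Im \<tau>"
      unfolding mem_lattice_iff by blast
    then show "z \<in> lattice \<tau>' 1"
      unfolding mem_lattice_iff
      by (intro exI[of _ m] exI[of _ "m * n + k"]) (simp add: that distrib_left)
  qed
  have "lattice \<tau> 1 = lattice \<tau>' 1"
    using sub[OF assms] sub[of \<tau>' \<tau> "- n"] assms by simp
  then show ?thesis
    by (simp add: E_ck_def E_mfd_def assms(1))
qed

lemma arrows_imp_mirror_pair:
  assumes "two_half_planes \<tau> t" "arrow1 (X_tk \<tau> t) E1" "arrow2 (X_tk \<tau> t) E2"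
  shows "mirror_pair E1 E2"
proof -
  obtain \<tau>' t' where 1: "\<tau>' \<in> upper_half_plane" "t' \<in> upper_half_plane"
    "tk_iso (X_tk \<tau> t) (X_tk \<tau>' t')" "ck_iso E1 (E_ck \<tau>' t')"
    using assms(2) unfolding arrow1_def by blast
  obtain \<tau>'' t'' where 2: "\<tau>'' \<in> upper_half_plane" "t'' \<in> upper_half_plane"
    "tk_iso (X_tk \<tau> t) (X_tk \<tau>'' t'')" "ck_iso E2 (E_ck t'' \<tau>'')"
    using assms(3) unfolding arrow2_def by blast
  have hp: "two_half_planes \<tau>' t'" "two_half_planes \<tau>'' t''"
    using 1(1,2) 2(1,2) by (simp_all add: two_half_planes_def upper_half_plane_def)
  have "X_lattice \<tau>' t' = X_lattice \<tau>'' t''"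
    using tk_iso_lattice_eq[OF assms(1) hp(1) 1(3)] tk_iso_lattice_eq[OF assms(1) hp(2) 2(3)] by simp
  note eq = X_lattice_eq_imp[OF hp this]
  obtain m n :: int where mn: "Re \<tau>' = Re \<tau>'' + m" "Re t' = Re t'' + n"
    using eq(3,4) by blast
  have "E_ck \<tau>' t' = E_ck \<tau>'' t'"
    by (rule E_ck_cong[OF eq(1) mn(1)])
  moreover have "E_ck t' \<tau>'' = E_ck t'' \<tau>''"
    by (rule E_ck_cong[OF eq(2) mn(2)])
  ultimately show ?thesis
    unfolding mirror_pair_def using 1 2 by metis
qed

section \<open>Leaves and their volume\<close>

context two_half_planes
begin

abbreviation slice :: "real \<Rightarrow> real \<times> real \<Rightarrow> complex set \<times> complex set" where
  "slice y w \<equiv> \<pi> (y, w)"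

abbreviation "\<Gamma> \<equiv> rect_lattice \<alpha> \<beta>"

text \<open>With \<open>y\<close> fixed the integer \<open>m\<close> must vanish, and with it the
  shear by \<open>Re \<tau>\<close> and \<open>Re t\<close>; what remains of the lattice is
  rectangular.\<close>

lemma slice_eq_iff: "slice y v = slice y w \<longleftrightarrow> v - w \<in> \<Gamma>"
proof -
  have "(0, v - w) \<in> \<Lambda> \<longleftrightarrow> v - w \<in> \<Gamma>"
  proof (cases "v - w")
    case (Pair a b)
    have "(0 = real_of_int m * \<eta>) \<longleftrightarrow> m = 0" for m
      using Im_tau Im_t by simp
    then show ?thesis
      unfolding Pair X_lattice_def mem_rect_lattice_iff mem_Collect_eq prod.case by auto
  qed
  then show ?thesis
    by (simp add: X.eq_iff)
qed

text \<open>This is the monodromy around the base circle: each turn glues the fibre to itself by the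
  translation with \<open>(\<alpha> * Re \<tau>, \<beta> * Re t)\<close>.\<close>

lemma slice_change_base:
  assumes "coset (base_lattice \<tau> t) y = coset (base_lattice \<tau> t) y'"
  obtains c where "\<And>w. slice y w = slice y' (w + c)"
proof -
  have "y - y' \<in> base_lattice \<tau> t"
    using assms B.eq_iff by blast
  then obtain m :: int where m: "y - y' = m * \<eta>"
    unfolding base_lattice_def by blast
  \<comment> \<open>The summands \<open>of_int 0\<close> are the witnesses for \<open>n\<close> and
    \<open>k\<close>, written in the shape required by \<open>X_lattice\<close>.\<close>
  define c where "c = (\<alpha> * (m * Re \<tau> + of_int 0), \<beta> * (m * Re t + of_int 0))"
  have "(y - y', c) \<in> \<Lambda>"
    unfolding X_lattice_def mem_Collect_eq prod.case m c_def by blast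
  then have "slice y w = slice y' (w - c)" for w
    by (simp add: X.eq_iff)
  then show ?thesis
    using that[of "- c"] by simp
qed

lemma base_slice: "E_to_base \<tau> t (fst (slice y w)) = coset (base_lattice \<tau> t) y"
  by (simp add: E_to_base_X_param)

text \<open>Describes the slice as a fibre of the map to the base, which is the function that stays
  constant along connected plaques.\<close>

lemma mem_range_slice_iff:
  "p \<in> range (slice y) \<longleftrightarrow> p \<in> range \<pi> \<and> E_to_base \<tau> t (fst p) = coset (base_lattice \<tau> t) y"
proof
  assume "p \<in> range \<pi> \<and> E_to_base \<tau> t (fst p) = coset (base_lattice \<tau> t) y"
  then obtain y' w where p: "p = slice y' w" "coset (base_lattice \<tau> t) y' = coset (base_lattice \<tau> t) y"
    by (metis base_slice imageE prod.collapse)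
  then show "p \<in> range (slice y)"
    using slice_change_base[OF p(2)] by (metis rangeI)
qed (auto simp: base_slice)

section \<open>Plaques, their lifts, and the leaves\<close>

abbreviation "plaqs \<equiv> tk_plaques XX"

lemma plaque_iff:
  "(W, k) \<in> plaqs \<longleftrightarrow> smooth_into X W k \<and> inj_on k W \<and>
    (\<forall>x\<in>W. \<forall>c\<in>charts X. k x \<in> cimg c \<longrightarrow>
      inj (frechet_derivative (cinv c \<circ> k) (at x)) \<and>
      range (frechet_derivative (cinv c \<circ> k) (at x)) = {u. fst u = 0})"
  unfolding tk_plaques_def plaques_def tk_mfd_X
  by (auto simp: Let_def leaf_dist_X X.cinv_mem)

lemma slice_plaque:
  assumes "open W" "inj_on (slice y) W"
  shows "(W, slice y) \<in> plaqs"
proof -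
  have D: "((\<lambda>w :: real \<times> real. (y, w)) has_derivative (\<lambda>h. (0, h))) (at x)" for x
    by (intro has_derivative_Pair has_derivative_const has_derivative_ident)
  have "smooth_into X W (slice y)"
    using X.smooth_into_lift[OF assms(1) D] by (simp add: o_def)
  moreover have "frechet_derivative (cinv c \<circ> slice y) (at x) = (\<lambda>h. (0, h))"
    if "c \<in> charts X" "slice y x \<in> cimg c" for c x
    using X.has_derivative_chart[OF that(1) D[of x], of "slice y"] that(2)
    by (intro frechet_derivative_at[symmetric]) simp
  moreover have "inj (\<lambda>h :: real \<times> real. (0 :: real, h))"
    by (auto intro: injI)
  moreover have "range (\<lambda>h :: real \<times> real. (0 :: real, h)) = {u. fst u = 0}"
    by (force simp: image_iff)
  ultimately show ?thesis
    unfolding plaque_iff using assms(2) by simp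
qed

text \<open>A plaque is tangent to the planes \<open>dy = 0\<close>, so the first coordinate of its
  lift has derivative zero and is constant on a ball. The remaining two coordinates form
  \<open>\<kappa>\<close>.\<close>

lemma plaque_lift:
  assumes "(W, k) \<in> plaqs" "x \<in> W"
  obtains e y \<kappa> \<kappa>' where "0 < e" "ball x e \<subseteq> W" "\<And>w. w \<in> ball x e \<Longrightarrow> k w = slice y (\<kappa> w)"
    "\<And>w. w \<in> ball x e \<Longrightarrow> (\<kappa> has_derivative \<kappa>' w) (at w)"
    "\<And>u. continuous_on (ball x e) (\<lambda>w. \<kappa>' w u)"
proof -
  note k = assms(1)[unfolded plaque_iff]
  have cont: "continuous_map (top_of_set W) (mtop X) k" and W: "open W"
    using k by (auto simp: smooth_into_def)
  have "k x \<in> range \<pi>"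
    using continuous_map_funspace[OF cont] assms(2) by (auto simp: topspace_X)
  then obtain c where c: "c \<in> charts X" "k x \<in> cimg c"
    using X.chart_at by blast
  define U where "U = {w \<in> W. k w \<in> cimg c}"
  define G where "G = cinv c \<circ> k"
  have "openin (top_of_set W) U"
    using openin_continuous_map_preimage[OF cont X.cimg_open[OF c(1)]] by (simp add: U_def)
  then have "open U"
    using W by (simp add: openin_open_eq)
  moreover have "x \<in> U"
    using assms(2) c(2) by (simp add: U_def)
  ultimately obtain e where e: "0 < e" "ball x e \<subseteq> U"
    using open_contains_ball by blast
  have smoothG: "smooth_on U G"
    using k c(1) by (simp add: smooth_into_def U_def G_def)
  have D: "(G has_derivative frechet_derivative G (at w)) (at w)" if "w \<in> ball x e" for w
    using smooth_on_has_derivative[OF smoothG] that e(2) by blast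
  have D0: "fst (frechet_derivative G (at w) u) = 0" if "w \<in> ball x e" for w u
  proof -
    have "w \<in> W" "k w \<in> cimg c"
      using that e(2) by (auto simp: U_def)
    then have "range (frechet_derivative G (at w)) = {u. fst u = 0}"
      using k c(1) by (simp add: G_def)
    then show ?thesis
      by blast
  qed
  have "((\<lambda>w. fst (G w)) has_derivative (\<lambda>h. 0)) (at w within ball x e)" if "w \<in> ball x e" for w
    using has_derivative_fst[OF D[OF that]] by (simp add: D0[OF that] has_derivative_at_withinI)
  from has_derivative_zero_constant[OF convex_ball this]
  obtain y where y: "\<forall>w\<in>ball x e. fst (G w) = y"
    by blast
  show ?thesis
  proof (rule that[of e y "\<lambda>w. snd (G w)" "\<lambda>w h. snd (frechet_derivative G (at w) h)"])
    show "0 < e" "ball x e \<subseteq> W"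
      using e by (auto simp: U_def)
    fix w assume w: "w \<in> ball x e"
    then have "k w \<in> cimg c"
      using e(2) by (auto simp: U_def)
    then have "k w = \<pi> (G w)"
      using X.cinv_mem(2)[OF c(1)] by (simp add: G_def)
    then show "k w = slice y (snd (G w))"
      using y w by (metis prod.collapse)
    show "((\<lambda>w. snd (G w)) has_derivative (\<lambda>h. snd (frechet_derivative G (at w) h))) (at w)"
      by (rule has_derivative_snd[OF D[OF w]])
  next
    fix u
    show "continuous_on (ball x e) (\<lambda>w. snd (frechet_derivative G (at w) u))"
      by (intro continuous_on_snd continuous_on_subset[OF smooth_on_continuous_derivative[OF smoothG] e(2)])
  qed
qed

lemma gram_det_lift:
  assumes "open S" "x \<in> S" "\<And>w. w \<in> S \<Longrightarrow> k w = slice y (\<kappa> w)" "(\<kappa> has_derivative A) (at x)"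
  shows "sqrt (gram_det (pull2 X (tk_met XX) k x)) = \<bar>jac A\<bar>"
proof (rule sqrt_gram_det_jac)
  show "linear A"
    by (rule has_derivative_linear[OF assms(4)])
  have D: "((\<lambda>w. (y, \<kappa> w)) has_derivative (\<lambda>h. (0, A h))) (at x)"
    by (intro has_derivative_Pair has_derivative_const assms(4))
  have "\<forall>\<^sub>F w in nhds x. k w = \<pi> (y, \<kappa> w)"
    using eventually_nhds_in_open[OF assms(1,2)] by eventually_elim (rule assms(3))
  from X.pull2_lift[OF D this const_tensor2_met]
  show "pull2 X (tk_met XX) k x u v = A u \<bullet> A v" for u v
    by simp
qed

text \<open>The sides are full periods: since the box is open its slice is still injective, and it
  is large enough for any two points of a leaf to have representatives in a common box.\<close>

definition box_at :: "real \<times> real \<Rightarrow> (real \<times> real) set" where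
  "box_at m = {fst m - \<alpha> / 2<..<fst m + \<alpha> / 2} \<times> {snd m - \<beta> / 2<..<snd m + \<beta> / 2}"

lemma box_at: "open (box_at m)" "connected (box_at m)" "m \<in> box_at m" "inj_on (slice y) (box_at m)"
proof -
  show "open (box_at m)" "connected (box_at m)"
    unfolding box_at_def by (auto intro!: open_Times connected_Times)
  show "m \<in> box_at m"
    using Im_tau Im_t by (simp add: box_at_def mem_Times_iff)
  show "inj_on (slice y) (box_at m)"
  proof (rule inj_onI)
    fix v w assume vw: "v \<in> box_at m" "w \<in> box_at m" "slice y v = slice y w"
    have "\<bar>fst (v - w)\<bar> < \<alpha>" "\<bar>snd (v - w)\<bar> < \<beta>"
      using vw(1,2) by (auto simp: box_at_def abs_less_iff)
    moreover have "v - w \<in> \<Gamma>"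
      using vw(3) by (simp only: slice_eq_iff)
    ultimately have "v - w = 0"
      by (intro rect_lattice_small[OF pos(1,2)])
    then show "v = w"
      by simp
  qed
qed

lemma box_plaque: "(box_at m, slice y) \<in> plaqs"
  by (rule slice_plaque[OF box_at(1,4)])

lemma plaque_base_constant:
  assumes "(W, k) \<in> plaqs" "connected W" "v \<in> W" "w \<in> W"
  shows "E_to_base \<tau> t (fst (k v)) = E_to_base \<tau> t (fst (k w))"
proof -
  have "(\<lambda>w. E_to_base \<tau> t (fst (k w))) constant_on W"
  proof (rule locally_constant_imp_constant[OF assms(2)])
    fix x assume "x \<in> W"
    from plaque_lift[OF assms(1) this]
    obtain e y \<kappa> where e: "0 < e" "ball x e \<subseteq> W" "\<And>w. w \<in> ball x e \<Longrightarrow> k w = slice y (\<kappa> w)"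
      by metis
    show "\<exists>T. openin (top_of_set W) T \<and> x \<in> T \<and>
        (\<forall>w\<in>T. E_to_base \<tau> t (fst (k w)) = E_to_base \<tau> t (fst (k x)))"
    proof (intro exI conjI ballI)
      show "openin (top_of_set W) (ball x e)"
        using e(2) by (simp add: open_subset)
      show "x \<in> ball x e"
        using e(1) by simp
      fix w assume "w \<in> ball x e"
      then show "E_to_base \<tau> t (fst (k w)) = E_to_base \<tau> t (fst (k x))"
        using e(1,3) by (simp add: base_slice)
    qed
  qed
  then show ?thesis
    using assms(3,4) unfolding constant_on_def by metis
qed

text \<open>A chain of connected plaques cannot leave a fibre of the base map. Conversely one plaque
  suffices: two points of the slice have representatives less than a period apart in each
  coordinate, and these lie in the box around their midpoint.\<close>

lemma leaf_X: "leaf plaqs (slice y w) = range (slice y)"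
proof -
  define R where "R = {(a, b). \<exists>k\<in>plaqs. connected (cdom k) \<and> a \<in> cimg k \<and> b \<in> cimg k}"
  have leaf: "leaf plaqs (slice y w) = {q. (slice y w, q) \<in> R\<^sup>*}"
    by (simp add: leaf_def R_def)
  have "b \<in> range (slice y)" if "(a, b) \<in> R\<^sup>*" "a \<in> range (slice y)" for a b
    using that
  proof (induction rule: rtrancl_induct)
    case (step b c)
    then obtain k where k: "k \<in> plaqs" "connected (cdom k)" "b \<in> cimg k" "c \<in> cimg k"
      by (auto simp: R_def)
    obtain W f where Wf: "k = (W, f)"
      by (cases k)
    obtain v w where vw: "v \<in> W" "w \<in> W" "b = f v" "c = f w"
      using k(3,4) by (auto simp: Wf cimg_def)
    have "E_to_base \<tau> t (fst c) = E_to_base \<tau> t (fst b)"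
      using plaque_base_constant[of W f w v] k(1,2) vw by (simp add: Wf cdom_def)
    moreover have "c \<in> range \<pi>"
    proof -
      have "continuous_map (top_of_set W) (mtop X) f"
        using k(1) by (simp add: Wf plaque_iff smooth_into_def)
      from continuous_map_funspace[OF this] show ?thesis
        using vw by (auto simp: topspace_X)
    qed
    ultimately show ?case
      using step.IH[OF step.prems] by (simp add: mem_range_slice_iff)
  qed
  moreover have "(slice y w, slice y v) \<in> R" for v
  proof -
    have round: "\<bar>a + c * of_int (round ((b - a) / c)) - b\<bar> < c" if "0 < c" for a b c :: real
    proof -
      have "\<bar>of_int (round ((b - a) / c)) - (b - a) / c\<bar> < 1"
        using of_int_round_abs_le[of "(b - a) / c"] by linarith
      then have "\<bar>of_int (round ((b - a) / c)) - (b - a) / c\<bar> * c < 1 * c"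
        using that by (rule mult_strict_right_mono)
      moreover have "\<bar>of_int (round ((b - a) / c)) - (b - a) / c\<bar> * c =
          \<bar>(of_int (round ((b - a) / c)) - (b - a) / c) * c\<bar>"
        using that by (simp add: abs_mult)
      moreover have "(of_int (round ((b - a) / c)) - (b - a) / c) * c =
          a + c * of_int (round ((b - a) / c)) - b"
        using that by (simp add: field_simps)
      ultimately show ?thesis
        by simp
    qed
    \<comment> \<open>Rounding selects the representative \<open>v + l\<close> that is nearest to
      \<open>w\<close> in each coordinate.\<close>
    define l where "l = (\<alpha> * of_int (round ((fst w - fst v) / \<alpha>)), \<beta> * of_int (round ((snd w - snd v) / \<beta>)))"
    have "l \<in> \<Gamma>"
      unfolding l_def mem_rect_lattice_iff by blast
    then have v: "slice y v = slice y (v + l)"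
      using slice_eq_iff[of y "v + l" v] by simp
    have near: "\<bar>fst (v + l) - fst w\<bar> < \<alpha>" "\<bar>snd (v + l) - snd w\<bar> < \<beta>"
      using round[OF pos(1)] round[OF pos(2)] by (simp_all add: l_def)
    define m where "m = ((fst (v + l) + fst w) / 2, (snd (v + l) + snd w) / 2)"
    have midpoint: "(a + b) / 2 - c / 2 < a" "a < (a + b) / 2 + c / 2"
      "(a + b) / 2 - c / 2 < b" "b < (a + b) / 2 + c / 2" if "\<bar>a - b\<bar> < c" for a b c :: real
      using that by (simp_all add: abs_less_iff field_simps)
    have "w \<in> box_at m" "v + l \<in> box_at m"
      using midpoint[OF near(1)] midpoint[OF near(2)]
      unfolding box_at_def m_def mem_Times_iff greaterThanLessThan_iff fst_conv snd_conv by blast+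
    then show ?thesis
      unfolding R_def v using box_plaque[of m y] box_at(2)[of m]
      by (auto simp: cdom_def cimg_def intro!: bexI[of _ "(box_at m, slice y)"])
  qed
  ultimately show ?thesis
    unfolding leaf by blast
qed

text \<open>The lift of a plaque may live over another representative of the base point; a monodromy
  translation moves it to \<open>y\<close>. Injectivity of \<open>\<kappa>\<close> is inherited from
  \<open>k\<close>.\<close>

lemma leaf_plaque_lift:
  assumes "(W, k) \<in> plaqs" "k ` W \<subseteq> range (slice y)" "x \<in> W"
  obtains e \<kappa> \<kappa>' where "0 < e" "ball x e \<subseteq> W" "\<And>w. w \<in> ball x e \<Longrightarrow> k w = slice y (\<kappa> w)"
    "\<And>w. w \<in> ball x e \<Longrightarrow> (\<kappa> has_derivative \<kappa>' w) (at w)"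
    "\<And>u. continuous_on (ball x e) (\<lambda>w. \<kappa>' w u)" "inj_on \<kappa> (ball x e)"
    "continuous_on (ball x e) \<kappa>"
proof -
  obtain e y' \<kappa> \<kappa>' where e: "0 < e" "ball x e \<subseteq> W" and lift: "\<And>w. w \<in> ball x e \<Longrightarrow> k w = slice y' (\<kappa> w)"
    and D: "\<And>w. w \<in> ball x e \<Longrightarrow> (\<kappa> has_derivative \<kappa>' w) (at w)"
    and C: "\<And>u. continuous_on (ball x e) (\<lambda>w. \<kappa>' w u)"
    using plaque_lift[OF assms(1,3)] by metis
  have "slice y' (\<kappa> x) \<in> range (slice y)"
    using assms(2,3) lift[of x] e(1) by (metis centre_in_ball image_subset_iff)
  then have "coset (base_lattice \<tau> t) y' = coset (base_lattice \<tau> t) y"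
    unfolding mem_range_slice_iff base_slice by blast
  then obtain c where c: "\<And>w. slice y' w = slice y (w + c)"
    by (rule slice_change_base) blast
  show ?thesis
  proof (rule that[of e "\<lambda>w. \<kappa> w + c" \<kappa>'])
    show lift': "k w = slice y (\<kappa> w + c)" if "w \<in> ball x e" for w
      using lift[OF that] c by simp
    show "((\<lambda>w. \<kappa> w + c) has_derivative \<kappa>' w) (at w)" if "w \<in> ball x e" for w
      using has_derivative_add_const[OF D[OF that]] .
    then show "continuous_on (ball x e) (\<lambda>w. \<kappa> w + c)"
      by (meson continuous_at_imp_continuous_on has_derivative_continuous)
    show "inj_on (\<lambda>w. \<kappa> w + c) (ball x e)"
    proof (rule inj_onI)
      fix v w assume vw: "v \<in> ball x e" "w \<in> ball x e" "\<kappa> v + c = \<kappa> w + c"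
      then have "k v = k w"
        using lift' by simp
      moreover have "inj_on k W"
        using assms(1) by (simp add: plaque_iff)
      ultimately show "v = w"
        using vw(1,2) e(2) by (meson inj_onD subsetD)
    qed
  qed (use e C in auto)
qed

text \<open>By invariance of domain \<open>\<kappa>\<close> has open images. The preimage under the
  slice is invariant under the rectangular lattice, so near \<open>v\<close> it contains a lattice
  translate of such an image.\<close>

lemma open_vimage_slice_plaque:
  assumes "(W, k) \<in> plaqs" "k ` W \<subseteq> range (slice y)" "open A" "A \<subseteq> W"
  shows "open (slice y -` (k ` A))"
proof (rule Topological_Spaces.openI)
  fix v assume "v \<in> slice y -` (k ` A)"
  then obtain x where x: "x \<in> A" "slice y v = k x"
    by auto
  obtain e \<kappa> where e: "0 < e" "\<And>w. w \<in> ball x e \<Longrightarrow> k w = slice y (\<kappa> w)"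
    "inj_on \<kappa> (ball x e)" "continuous_on (ball x e) \<kappa>"
    using leaf_plaque_lift[OF assms(1,2), of x] x(1) assms(4) by (metis subsetD)
  define S where "S = ball x e \<inter> A"
  have S: "open S" "x \<in> S" "S \<subseteq> ball x e" "S \<subseteq> A"
    using assms(3) x(1) e(1) by (auto simp: S_def)
  have "open (\<kappa> ` S)"
    using invariance_of_domain[of S \<kappa>] S e(3,4) continuous_on_subset inj_on_subset by metis
  \<comment> \<open>\<open>v\<close> and \<open>\<kappa> x\<close> represent the same point, so this
    translation is by a vector of \<open>\<Gamma>\<close>.\<close>
  then have "open ((+) (v - \<kappa> x) ` \<kappa> ` S)"
    by (rule open_translation)
  moreover have "v \<in> (+) (v - \<kappa> x) ` \<kappa> ` S"
    using S(2) by (auto simp: image_image intro!: image_eqI[of _ _ x])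
  moreover have "v - \<kappa> x + \<kappa> w \<in> slice y -` (k ` A)" if w: "w \<in> S" for w
  proof -
    have "slice y v = slice y (\<kappa> x)"
      using x(2) e(1,2) by simp
    then have "slice y (v - \<kappa> x + \<kappa> w) = slice y (\<kappa> w)"
      by (simp add: slice_eq_iff)
    also have "\<dots> = k w"
      using e(2)[OF subsetD[OF S(3) w]] by simp
    finally show ?thesis
      using w S(4) by auto
  qed
  then have "(+) (v - \<kappa> x) ` \<kappa> ` S \<subseteq> slice y -` (k ` A)"
    by (simp only: image_image image_subset_iff) blast
  ultimately show "\<exists>T. open T \<and> v \<in> T \<and> T \<subseteq> slice y -` (k ` A)"
    by blast
qed

section \<open>Charts and topology of a leaf\<close>

abbreviation "leaf_mfd y \<equiv> leaf_manifold plaqs (slice y 0)"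

lemma charts_leaf: "charts (leaf_mfd y) = {k \<in> plaqs. cimg k \<subseteq> range (slice y)}"
  by (simp add: leaf_manifold_def leaf_X)

lemma box_chart: "(box_at m, slice y) \<in> charts (leaf_mfd y)"
  using box_plaque by (auto simp: charts_leaf cimg_def)

lemma mtop_leaf:
  "mtop (leaf_mfd y) = topology_generated_by
    {snd k ` A |k A. k \<in> charts (leaf_mfd y) \<and> open A \<and> A \<subseteq> cdom k}"
  unfolding charts_leaf by (simp add: leaf_manifold_def leaf_X conj_assoc)

lemma openin_leaf_chart:
  "k \<in> charts (leaf_mfd y) \<Longrightarrow> open A \<Longrightarrow> A \<subseteq> cdom k \<Longrightarrow> openin (mtop (leaf_mfd y)) (snd k ` A)"
  unfolding mtop_leaf by (rule topology_generated_by_Basis) blast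

lemma topspace_leaf: "topspace (mtop (leaf_mfd y)) = range (slice y)"
proof
  show "range (slice y) \<subseteq> topspace (mtop (leaf_mfd y))"
  proof (rule image_subsetI)
    fix w
    have "openin (mtop (leaf_mfd y)) (slice y ` box_at w)"
      using openin_leaf_chart[OF box_chart[of w y] box_at(1)[of w]] by (simp add: cdom_def)
    then show "slice y w \<in> topspace (mtop (leaf_mfd y))"
      using openin_subset box_at(3) by blast
  qed
  have "snd k ` A \<subseteq> range (slice y)" if "k \<in> charts (leaf_mfd y)" "A \<subseteq> cdom k" for k A
  proof -
    have "cimg k \<subseteq> range (slice y)"
      using that(1) by (simp add: charts_leaf)
    then show ?thesis
      using that(2) unfolding cimg_def cdom_def by (meson image_mono order_trans)
  qed
  then show "topspace (mtop (leaf_mfd y)) \<subseteq> range (slice y)"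
    unfolding mtop_leaf topology_generated_by_topspace by blast
qed

text \<open>Continuity of the slice for the leaf topology, which makes the slice measurable for the
  Borel sets of the leaf.\<close>

lemma openin_leaf_imp_open:
  assumes "openin (mtop (leaf_mfd y)) U"
  shows "open (slice y -` U)"
  using assms[unfolded mtop_leaf openin_topology_generated_by_iff]
proof (induction rule: generate_topology_on.induct)
  case (UN K)
  have "slice y -` \<Union>K = (\<Union>k\<in>K. slice y -` k)"
    by auto
  then show ?case
    using UN.IH by auto
next
  case (Basis s)
  then obtain k A where "k \<in> charts (leaf_mfd y)" "open A" "A \<subseteq> cdom k" "s = snd k ` A"
    by blast
  then show ?case
    using open_vimage_slice_plaque[of "fst k" "snd k" y A]
    by (auto simp: charts_leaf cimg_def cdom_def)
qed auto

end

section \<open>The Riemannian measure of a leaf\<close>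

context two_half_planes
begin

abbreviation "leaf_opens y \<equiv> {U. openin (mtop (leaf_mfd y)) U}"

lemma chart_leaf_iff:
  "k \<in> charts (leaf_mfd y) \<longleftrightarrow> (cdom k, snd k) \<in> plaqs \<and> snd k ` cdom k \<subseteq> range (slice y)"
  by (cases k) (simp add: charts_leaf cdom_def cimg_def)

lemma leaf_chart_image_sets:
  assumes "sets M = sigma_sets (range (slice y)) (leaf_opens y)" "k \<in> charts (leaf_mfd y)"
    "A \<in> sets borel" "A \<subseteq> cdom k"
  shows "snd k ` A \<in> sets M"
proof (rule borel_sets_image[OF _ _ _ assms(3,4)])
  show "open (cdom k)" "inj_on (snd k) (cdom k)"
    using assms(2) by (simp_all add: chart_leaf_iff plaque_iff smooth_into_def)
  show "snd k ` U \<in> sets M" if "open U" "U \<subseteq> cdom k" for U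
    unfolding assms(1) using openin_leaf_chart[OF assms(2) that] by (intro sigma_sets.Basic) simp
qed

lemma slice_image_sets:
  assumes "sets M = sigma_sets (range (slice y)) (leaf_opens y)" "A \<in> sets borel"
  shows "slice y ` A \<in> sets M"
proof -
  \<comment> \<open>The slice is not injective on the whole plane, so the image is assembled from
    countably many boxes, each of which is a chart.\<close>
  obtain \<F> where \<F>: "\<F> \<subseteq> range box_at" "countable \<F>" "\<Union>\<F> = \<Union>(range box_at)"
    by (rule Lindelof[of "range box_at"]) (use box_at(1) in auto)
  have "\<Union>\<F> = UNIV"
    unfolding \<F>(3) using box_at(3) by blast
  then have "slice y ` A = (\<Union>S\<in>\<F>. slice y ` (A \<inter> S))"
    by blast
  moreover have "slice y ` (A \<inter> S) \<in> sets M" if S: "S \<in> \<F>" for S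
  proof -
    obtain m where "S = box_at m"
      using S \<F>(1) by blast
    then show ?thesis
      using leaf_chart_image_sets[OF assms(1) box_chart[of m], of "A \<inter> S"] assms(2) box_at(1)[of m]
      by (simp add: cdom_def)
  qed
  ultimately show ?thesis
    using \<F>(2) by (simp add: sets.countable_UN'')
qed

abbreviation "\<Delta> \<equiv> rect_domain \<alpha> \<beta>"

text \<open>The image of the area of the fundamental rectangle, which is the candidate that proves
  the existence of a Riemannian measure.\<close>

definition leaf_measure :: "real \<Rightarrow> (complex set \<times> complex set) measure" where
  "leaf_measure y = distr (restrict_space lborel \<Delta>) (sigma (range (slice y)) (leaf_opens y)) (slice y)"

lemma leaf_opens_subset: "leaf_opens y \<subseteq> Pow (range (slice y))"
  using openin_subset topspace_leaf by blast

lemma space_leaf_measure: "space (leaf_measure y) = range (slice y)"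
  by (simp add: leaf_measure_def space_measure_of[OF leaf_opens_subset])

lemma sets_leaf_measure: "sets (leaf_measure y) = sigma_sets (range (slice y)) (leaf_opens y)"
  by (simp add: leaf_measure_def sets_measure_of[OF leaf_opens_subset])

lemma emeasure_leaf_measure:
  assumes "C \<in> sets (leaf_measure y)"
  shows "emeasure (leaf_measure y) C = emeasure lborel (slice y -` C \<inter> \<Delta>)"
proof -
  have "slice y \<in> measurable lborel (sigma (range (slice y)) (leaf_opens y))"
  proof (rule measurable_measure_of[OF leaf_opens_subset])
    fix U assume "U \<in> leaf_opens y"
    then show "slice y -` U \<inter> space lborel \<in> sets lborel"
      using openin_leaf_imp_open by simp
  qed simp
  then have meas: "slice y \<in> measurable (restrict_space lborel \<Delta>) (sigma (range (slice y)) (leaf_opens y))"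
    by (rule measurable_restrict_space1)
  have C: "C \<in> sets (sigma (range (slice y)) (leaf_opens y))"
    using assms by (simp add: leaf_measure_def)
  show ?thesis
    unfolding leaf_measure_def emeasure_distr[OF meas C]
    using rect_domain_borel by (simp add: space_restrict_space emeasure_restrict_space)
qed

text \<open>The part of the fundamental rectangle over the image of \<open>V\<close> is
  \<open>V\<close> folded along the lattice, and folding preserves area if no two points of
  \<open>V\<close> are identified.\<close>

lemma emeasure_leaf_image:
  assumes "V \<in> sets borel" "inj_on (slice y) V" "slice y ` V \<in> sets (leaf_measure y)"
  shows "emeasure (leaf_measure y) (slice y ` V) = emeasure lborel V"
proof -
  have "slice y -` (slice y ` V) \<inter> \<Delta> = {x \<in> \<Delta>. \<exists>v\<in>V. x - v \<in> \<Gamma>}"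
    using slice_eq_iff by blast
  moreover have "v = w" if "v \<in> V" "w \<in> V" "v - w \<in> \<Gamma>" for v w
    using that assms(2) slice_eq_iff[of y v w] by (meson inj_onD)
  ultimately show ?thesis
    using emeasure_leaf_measure[OF assms(3)] emeasure_fold_rect_domain[OF pos(1,2) assms(1)] by simp
qed

text \<open>The chart \<open>k\<close> is an arbitrary plaque. On small balls it is the slice after
  some \<open>\<kappa>\<close>, so the measure of an image is the area of its image under
  \<open>\<kappa>\<close>, that is the integral of the Jacobian, which is the Riemannian density. As
  \<open>\<kappa>\<close> exists only locally, \<open>countably_additive_local_eq\<close> has to
  glue these identities.\<close>

lemma leaf_measure_chart:
  assumes k: "k \<in> charts (leaf_mfd y)" and A: "A \<in> sets borel" "A \<subseteq> cdom k"
  shows "emeasure (leaf_measure y) (snd k ` A) =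
    (\<integral>\<^sup>+x\<in>A. ennreal (sqrt (gram_det (pull2 X (tk_met XX) (snd k) x))) \<partial>lborel)"
proof -
  define W f where "W = cdom k" and "f = snd k"
  note plaque = k[unfolded chart_leaf_iff, folded W_def f_def]
  have W: "open W" and inj: "inj_on f W"
    using plaque by (auto simp: plaque_iff smooth_into_def)
  have sets_f: "f ` A \<in> sets (leaf_measure y)" if "A \<in> sets borel" "A \<subseteq> W" for A
    using leaf_chart_image_sets[OF sets_leaf_measure k, of A] that by (simp add: W_def f_def)
  define g where "g = (\<lambda>x. sqrt (gram_det (pull2 X (tk_met XX) f x)))"
  \<comment> \<open>The density is known to be continuous only on \<open>W\<close>; the indicator
    makes it Borel measurable on the whole plane.\<close>
  define N where "N = density lborel (\<lambda>x. ennreal (indicator W x *\<^sub>R g x))"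
  have lift: "\<exists>e \<kappa> \<kappa>'. 0 < e \<and> ball x e \<subseteq> W \<and> (\<forall>w\<in>ball x e. f w = slice y (\<kappa> w)) \<and>
    (\<forall>w\<in>ball x e. (\<kappa> has_derivative \<kappa>' w) (at w)) \<and> continuous_on (ball x e) (\<lambda>w. \<bar>jac (\<kappa>' w)\<bar>) \<and>
    inj_on \<kappa> (ball x e) \<and> continuous_on (ball x e) \<kappa> \<and> (\<forall>w\<in>ball x e. g w = \<bar>jac (\<kappa>' w)\<bar>)"
    if x: "x \<in> W" for x
  proof -
    obtain e \<kappa> \<kappa>' where e: "0 < e" "ball x e \<subseteq> W" "\<And>w. w \<in> ball x e \<Longrightarrow> f w = slice y (\<kappa> w)"
      and D: "\<And>w. w \<in> ball x e \<Longrightarrow> (\<kappa> has_derivative \<kappa>' w) (at w)"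
      and C: "\<And>u. continuous_on (ball x e) (\<lambda>w. \<kappa>' w u)" "inj_on \<kappa> (ball x e)" "continuous_on (ball x e) \<kappa>"
      by (rule leaf_plaque_lift[OF conjunct1[OF plaque] conjunct2[OF plaque] x]) blast
    have "g w = \<bar>jac (\<kappa>' w)\<bar>" if "w \<in> ball x e" for w
      unfolding g_def by (rule gram_det_lift[OF open_ball that e(3) D[OF that]])
    moreover have "continuous_on (ball x e) (\<lambda>w. \<bar>jac (\<kappa>' w)\<bar>)"
      unfolding jac_def by (intro continuous_intros C(1))
    ultimately show ?thesis
      using e D C(2,3) by blast
  qed
  have "isCont g x" if x: "x \<in> W" for x
  proof -
    obtain e \<kappa>' where e: "0 < e" "continuous_on (ball x e) (\<lambda>w. \<bar>jac (\<kappa>' w)\<bar>)"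
      "\<forall>w\<in>ball x e. g w = \<bar>jac (\<kappa>' w)\<bar>"
      using lift[OF x] by blast
    have "continuous_on (ball x e) g"
      using continuous_on_eq[OF e(2)] e(3) by simp
    then show ?thesis
      using e(1) by (simp add: continuous_on_eq_continuous_at)
  qed
  then have "continuous_on W g"
    by (simp add: continuous_at_imp_continuous_on)
  then have "(\<lambda>x. indicator W x *\<^sub>R g x) \<in> borel_measurable borel"
    using W by (intro borel_measurable_continuous_on_indicator) simp_all
  then have meas: "(\<lambda>x. ennreal (indicator W x *\<^sub>R g x)) \<in> borel_measurable lborel"
    by simp
  have N: "emeasure N A = (\<integral>\<^sup>+x\<in>A. ennreal (g x) \<partial>lborel)" if "A \<in> sets borel" "A \<subseteq> W" for A
  proof -
    have "emeasure N A = (\<integral>\<^sup>+x. ennreal (indicator W x *\<^sub>R g x) * indicator A x \<partial>lborel)"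
      unfolding N_def using that(1) meas by (simp add: emeasure_density)
    also have "\<dots> = (\<integral>\<^sup>+x\<in>A. ennreal (g x) \<partial>lborel)"
      using that(2) by (intro nn_integral_cong) (auto simp: indicator_def)
    finally show ?thesis .
  qed
  have "emeasure (leaf_measure y) (f ` A) = emeasure N A"
  proof (rule countably_additive_local_eq[where W = W and F = "\<lambda>A. emeasure (leaf_measure y) (f ` A)"])
    show "A \<in> sets borel" "A \<subseteq> W"
      using A by (simp_all add: W_def)
  next
    fix C :: "nat \<Rightarrow> (real \<times> real) set"
    assume C: "range C \<subseteq> sets borel" "disjoint_family C" "(\<Union>n. C n) \<subseteq> W"
    then show "emeasure N (\<Union>n. C n) = suminf (\<lambda>n. emeasure N (C n))"
      by (intro suminf_emeasure[symmetric]) (simp_all add: N_def)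
    have "f ` C n \<in> sets (leaf_measure y)" for n
      using C(1,3) by (intro sets_f) auto
    moreover have "disjoint_family (\<lambda>n. f ` C n)"
      unfolding disjoint_family_on_def
    proof (intro ballI impI)
      fix m n :: nat assume "m \<noteq> n"
      then have "C m \<inter> C n = {}"
        using C(2) by (simp add: disjoint_family_on_def)
      then show "f ` C m \<inter> f ` C n = {}"
        using inj_on_image_Int[OF inj, of "C m" "C n"] C(3) by blast
    qed
    ultimately show "emeasure (leaf_measure y) (f ` (\<Union>n. C n)) =
        suminf (\<lambda>n. emeasure (leaf_measure y) (f ` C n))"
      unfolding image_UN by (intro suminf_emeasure[symmetric]) auto
  next
    fix x assume "x \<in> W"
    from lift[OF this] obtain e \<kappa> \<kappa>' where e: "0 < e" "ball x e \<subseteq> W"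
      and \<kappa>: "\<forall>w\<in>ball x e. f w = slice y (\<kappa> w)" "\<forall>w\<in>ball x e. (\<kappa> has_derivative \<kappa>' w) (at w)"
        "continuous_on (ball x e) (\<lambda>w. \<bar>jac (\<kappa>' w)\<bar>)" "inj_on \<kappa> (ball x e)"
        "continuous_on (ball x e) \<kappa>" "\<forall>w\<in>ball x e. g w = \<bar>jac (\<kappa>' w)\<bar>"
      by blast
    have "emeasure (leaf_measure y) (f ` C) = emeasure N C"
      if C: "C \<in> sets borel" "C \<subseteq> ball x e" "C \<subseteq> W" for C
    proof -
      have "\<kappa> ` U \<in> sets borel" if "open U" "U \<subseteq> ball x e" for U
        using invariance_of_domain[of U \<kappa>] that \<kappa>(4,5)
        by (intro borel_open) (meson continuous_on_subset inj_on_subset)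
      then have \<kappa>C: "\<kappa> ` C \<in> sets borel"
        using borel_sets_image[OF open_ball \<kappa>(4) _ C(1,2)] by blast
      have fC: "f ` C = slice y ` \<kappa> ` C"
        using \<kappa>(1) C(2) by (force simp: image_image intro: image_cong)
      \<comment> \<open>The slice alone identifies lattice translates, but two identified points of
        the image of \<open>\<kappa>\<close> would give two points of \<open>C\<close> with the same
        image under the injective \<open>f\<close>.\<close>
      have inj': "inj_on (slice y) (\<kappa> ` C)"
      proof (rule inj_onI, elim imageE)
        fix p q v w assume *: "slice y p = slice y q" "p = \<kappa> v" "v \<in> C" "q = \<kappa> w" "w \<in> C"
        have "f v = slice y (\<kappa> v)" "f w = slice y (\<kappa> w)"
          using \<kappa>(1) C(2) *(3,5) by blast+
        then have "f v = f w"
          using *(1,2,4) by simp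
        then have "v = w"
          using inj_onD[OF inj] * C(3) by blast
        then show "p = q"
          using * by simp
      qed
      \<comment> \<open>The Jacobian is controlled only on the ball, so measurability is obtained
        with the indicator of the ball and then restricted to \<open>C\<close>.\<close>
      have "(\<lambda>w. indicator (ball x e) w *\<^sub>R \<bar>jac (\<kappa>' w)\<bar>) \<in> borel_measurable borel"
        using \<kappa>(3) by (intro borel_measurable_continuous_on_indicator) simp_all
      then have "(\<lambda>w. indicator C w * (indicator (ball x e) w *\<^sub>R \<bar>jac (\<kappa>' w)\<bar>)) \<in> borel_measurable borel"
        using C(1) by (intro borel_measurable_times borel_measurable_indicator)
      also have "(\<lambda>w. indicator C w * (indicator (ball x e) w *\<^sub>R \<bar>jac (\<kappa>' w)\<bar>)) =
          (\<lambda>w. indicator C w * \<bar>jac (\<kappa>' w)\<bar>)"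
        using C(2) by (auto simp: indicator_def fun_eq_iff)
      finally have meas': "(\<lambda>w. indicator C w * \<bar>jac (\<kappa>' w)\<bar>) \<in> borel_measurable borel" .
      have "emeasure (leaf_measure y) (f ` C) = emeasure lborel (\<kappa> ` C)"
        using emeasure_leaf_image[OF \<kappa>C inj'] sets_f[OF C(1,3)] by (simp add: fC)
      also have "\<dots> = (\<integral>\<^sup>+w\<in>C. ennreal \<bar>jac (\<kappa>' w)\<bar> \<partial>lborel)"
      proof (rule emeasure_differentiable_image_plane[OF C(1) \<kappa>C _ _ meas'])
        show "(\<kappa> has_derivative \<kappa>' w) (at w)" if "w \<in> C" for w
          using \<kappa>(2) that C(2) by blast
        show "inj_on \<kappa> C"
          using \<kappa>(4) C(2) by (rule inj_on_subset)
      qed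
      also have "\<dots> = (\<integral>\<^sup>+w\<in>C. ennreal (g w) \<partial>lborel)"
        using \<kappa>(6) C(2) by (intro nn_integral_cong) (auto simp: indicator_def)
      finally show ?thesis
        by (simp add: N[OF C(1,3)])
    qed
    then show "\<exists>S. open S \<and> x \<in> S \<and> (\<forall>C\<in>sets borel. C \<subseteq> S \<longrightarrow> C \<subseteq> W \<longrightarrow>
        emeasure (leaf_measure y) (f ` C) = emeasure N C)"
      using e(1) by (intro exI[of _ "ball x e"]) simp
  qed simp_all
  then show ?thesis
    using N[of A] A by (simp add: W_def f_def g_def)
qed

abbreviation "leaf_metric \<equiv> (\<lambda>k. pull2 X (tk_met XX) (snd k))"

lemma riemannian_measure_leaf: "riemannian_measure (leaf_mfd y) leaf_metric (leaf_measure y)"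
  unfolding riemannian_measure_def topspace_leaf space_leaf_measure sets_leaf_measure
  using leaf_measure_chart by blast

text \<open>\<open>riemannian_volume\<close> uses a measure chosen by \<open>SOME\<close>, so the
  value is computed for every candidate \<open>\<mu>\<close>. In slice charts the density is 1,
  hence \<open>\<mu>\<close> agrees with area on small pieces of the fundamental rectangle, whose
  area is \<open>\<alpha> * \<beta> = 1\<close>.\<close>

lemma emeasure_leaf:
  assumes "riemannian_measure (leaf_mfd y) leaf_metric \<mu>"
  shows "emeasure \<mu> (range (slice y)) = 1"
proof -
  have sets_\<mu>: "sets \<mu> = sigma_sets (range (slice y)) (leaf_opens y)"
    and chart: "\<And>k A. k \<in> charts (leaf_mfd y) \<Longrightarrow> A \<in> sets borel \<Longrightarrow> A \<subseteq> cdom k \<Longrightarrow>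
      emeasure \<mu> (snd k ` A) = (\<integral>\<^sup>+x\<in>A. ennreal (sqrt (gram_det (leaf_metric k x))) \<partial>lborel)"
    using assms unfolding riemannian_measure_def topspace_leaf by blast+
  have gram: "sqrt (gram_det (pull2 X (tk_met XX) (slice y) x)) = 1" for x
    using gram_det_lift[of UNIV x "slice y" y "\<lambda>w. w" "\<lambda>h. h"] by (simp add: jac_def)
  have inj: "inj_on (slice y) \<Delta>"
  proof (rule inj_onI)
    fix v w assume "v \<in> \<Delta>" "w \<in> \<Delta>" "slice y v = slice y w"
    then show "v = w"
      using rect_domain_unique[OF pos(1,2)] slice_eq_iff[of y v w] by blast
  qed
  \<comment> \<open>Both sides are values at \<open>UNIV\<close> of set functions of
    \<open>C\<close>. Intersecting with the fundamental rectangle makes the slice injective, so the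
    left one is countably additive too.\<close>
  have "emeasure \<mu> (slice y ` (UNIV \<inter> \<Delta>)) = emeasure lborel (UNIV \<inter> \<Delta>)"
  proof (rule countably_additive_local_eq[where W = UNIV and A = UNIV
        and F = "\<lambda>A. emeasure \<mu> (slice y ` (A \<inter> \<Delta>))" and G = "\<lambda>A. emeasure lborel (A \<inter> \<Delta>)"])
    fix C :: "nat \<Rightarrow> (real \<times> real) set"
    assume C: "range C \<subseteq> sets borel" "disjoint_family C"
    have Cdom: "C n \<inter> \<Delta> \<in> sets borel" for n
      using C(1) rect_domain_borel by auto
    have disj: "disjoint_family (\<lambda>n. C n \<inter> \<Delta>)"
      using C(2) by (auto simp: disjoint_family_on_def)
    show "emeasure lborel ((\<Union>n. C n) \<inter> \<Delta>) = suminf (\<lambda>n. emeasure lborel (C n \<inter> \<Delta>))"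
      unfolding Int_UN_distrib2[symmetric] UN_extend_simps
      using Cdom disj by (subst suminf_emeasure) auto
    have "disjoint_family (\<lambda>n. slice y ` (C n \<inter> \<Delta>))"
      unfolding disjoint_family_on_def
    proof (intro ballI impI)
      fix m n :: nat assume "m \<noteq> n"
      then have "(C m \<inter> \<Delta>) \<inter> (C n \<inter> \<Delta>) = {}"
        using disj by (simp add: disjoint_family_on_def)
      then show "slice y ` (C m \<inter> \<Delta>) \<inter> slice y ` (C n \<inter> \<Delta>) = {}"
        using inj_on_image_Int[OF inj, of "C m \<inter> \<Delta>" "C n \<inter> \<Delta>"] by blast
    qed
    moreover have "slice y ` (C n \<inter> \<Delta>) \<in> sets \<mu>" for n
      by (rule slice_image_sets[OF sets_\<mu> Cdom])
    moreover have "slice y ` ((\<Union>n. C n) \<inter> \<Delta>) = (\<Union>n. slice y ` (C n \<inter> \<Delta>))"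
      by blast
    ultimately show "emeasure \<mu> (slice y ` ((\<Union>n. C n) \<inter> \<Delta>)) =
        suminf (\<lambda>n. emeasure \<mu> (slice y ` (C n \<inter> \<Delta>)))"
      by (subst suminf_emeasure) auto
  next
    fix x
    have "emeasure \<mu> (slice y ` (C \<inter> \<Delta>)) = emeasure lborel (C \<inter> \<Delta>)"
      if "C \<in> sets borel" "C \<subseteq> box_at x" for C
    proof -
      have C: "C \<inter> \<Delta> \<in> sets borel" "C \<inter> \<Delta> \<subseteq> cdom (box_at x, slice y)"
        using that rect_domain_borel by (auto simp: cdom_def)
      show ?thesis
        using chart[OF box_chart C] C(1) by (simp add: gram)
    qed
    then show "\<exists>S. open S \<and> x \<in> S \<and> (\<forall>C\<in>sets borel. C \<subseteq> S \<longrightarrow> C \<subseteq> UNIV \<longrightarrow>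
        emeasure \<mu> (slice y ` (C \<inter> \<Delta>)) = emeasure lborel (C \<inter> \<Delta>))"
      using box_at(1,3) by blast
  qed simp_all
  moreover have "slice y ` \<Delta> = range (slice y)"
  proof
    show "range (slice y) \<subseteq> slice y ` \<Delta>"
    proof (rule image_subsetI)
      fix w
      obtain l where l: "l \<in> \<Gamma>" "w - l \<in> \<Delta>"
        by (rule rect_domain_decomp[OF pos(1,2)])
      then have "slice y w = slice y (w - l)"
        by (simp add: slice_eq_iff)
      then show "slice y w \<in> slice y ` \<Delta>"
        using l(2) by blast
    qed
  qed blast
  ultimately show ?thesis
    by (simp only: Int_UNIV_left emeasure_rect_domain[OF pos(1,2)] scale_simps ennreal_1)
qed

lemma leaf_volume_X:
  assumes "p \<in> topspace (mtop X)"
  shows "leaf_volume X (tk_met XX) plaqs p = 1"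
proof -
  obtain y w where p: "p = slice y w"
    using assms by (auto simp: topspace_X)
  \<comment> \<open>The leaf depends on \<open>y\<close> alone, so the base point
    \<open>slice y w\<close> may be replaced by \<open>slice y 0\<close>.\<close>
  have leaf_eq: "leaf_manifold plaqs p = leaf_mfd y"
    by (simp only: leaf_manifold_def p leaf_X)
  have "riemannian_measure (leaf_mfd y) leaf_metric (SOME \<mu>. riemannian_measure (leaf_mfd y) leaf_metric \<mu>)"
    by (rule someI[of _ "leaf_measure y"]) (rule riemannian_measure_leaf)
  then show ?thesis
    unfolding leaf_volume_def leaf_eq riemannian_volume_def topspace_leaf by (rule emeasure_leaf)
qed

section \<open>Self-duality and the equivalence\<close>

lemma almost_2kaehler_X: "almost_2kaehler XX"
  unfolding almost_2kaehler_def tk_mfd_X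
proof (intro conjI ballI)
  show "smooth_manifold X"
    by (rule X.smooth_manifold)
  show "closed_two_form X (tk_om1 XX)"
    by (rule X.closed_two_form_const[OF const_tensor2_om1 linear_wedge(1,2) wedge_self(1)])
  show "closed_two_form X (tk_om2 XX)"
    by (rule X.closed_two_form_const[OF const_tensor2_om2 linear_wedge(3,4) wedge_self(2)])
  have "linear (\<lambda>v. u \<bullet> v)" "linear (\<lambda>u. u \<bullet> v)" for u v :: "real \<times> real \<times> real"
    by (simp_all add: bounded_linear.linear bounded_linear_inner_left bounded_linear_inner_right)
  then have "tensor2_field X (tk_met XX)"
    by (intro X.tensor2_field_const[OF const_tensor2_met])
  then show "riemannian_metric X (tk_met XX)"
    unfolding riemannian_metric_def
    by (simp add: const_tensor2D[OF const_tensor2_met] inner_commute)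
  show "\<exists>k\<in>plaqs. p \<in> cimg k" if p: "p \<in> topspace (mtop X)" for p
  proof -
    obtain y w where "p = slice y w"
      using p by (auto simp: topspace_X)
    then have "p \<in> cimg (box_at w, slice y)"
      using box_at(3) by (simp add: cimg_def)
    then show ?thesis
      using box_plaque by blast
  qed
  show "\<exists>v w1 w2. adapted_basis XX c x v w1 w2" if "c \<in> charts X" "x \<in> cdom c" for c x
    using adapted_basis_X[OF that] by blast
qed

lemma self_dual_X: "self_dual XX"
  unfolding self_dual_def tk_mfd_X
  using almost_2kaehler_X leaf_volume_X
    X.closed_two_form_const[OF const_tensor2_omega_D linear_wedge(5,6) wedge_self(3)]
  by blast

end

theorem theorem5p11:
  fixes E1 :: "'a ck_curve" and E2 :: "'b ck_curve"
  assumes "elliptic_ck E1" and "elliptic_ck E2"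
  shows "mirror_pair E1 E2 \<longleftrightarrow>
    (\<exists>\<tau>\<in>upper_half_plane. \<exists>t\<in>upper_half_plane.
       self_dual (X_tk \<tau> t) \<and> arrow1 (X_tk \<tau> t) E1 \<and> arrow2 (X_tk \<tau> t) E2)"
proof
  assume "mirror_pair E1 E2"
  then obtain \<tau> t where *: "\<tau> \<in> upper_half_plane" "t \<in> upper_half_plane"
    "ck_iso E1 (E_ck \<tau> t)" "ck_iso E2 (E_ck t \<tau>)"
    unfolding mirror_pair_def by blast
  then interpret two_half_planes \<tau> t
    by unfold_locales (simp_all add: upper_half_plane_def)
  show "\<exists>\<tau>\<in>upper_half_plane. \<exists>t\<in>upper_half_plane.
      self_dual (X_tk \<tau> t) \<and> arrow1 (X_tk \<tau> t) E1 \<and> arrow2 (X_tk \<tau> t) E2"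
    unfolding arrow1_def arrow2_def using * self_dual_X tk_iso_refl by blast
next
  assume "\<exists>\<tau>\<in>upper_half_plane. \<exists>t\<in>upper_half_plane.
      self_dual (X_tk \<tau> t) \<and> arrow1 (X_tk \<tau> t) E1 \<and> arrow2 (X_tk \<tau> t) E2"
  then obtain \<tau> t where "\<tau> \<in> upper_half_plane" "t \<in> upper_half_plane"
    "arrow1 (X_tk \<tau> t) E1" "arrow2 (X_tk \<tau> t) E2"
    by blast
  then show "mirror_pair E1 E2"
    by (intro arrows_imp_mirror_pair) (simp_all add: two_half_planes_def upper_half_plane_def)
qed

end
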